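(* Let $k$ be a field, let $N\geq 2$, let $\mathbf{a}=(a_1,\dots,a_N)$ be integers with $a_j\geq 1$, and let $\mathbf{q}=(q_{ij})_{1\le i,j\le N}$ be a family of nonzero constants in $k$ with $q_{ii}=1$ and $q_{ij}q_{ji}=1$ for all $i,j$. Then the Hochschild cohomology ring of the quantum complete intersection $$A(\mathbf{q},\mathbf{a})=\frac{k\langle X_1,\dots,X_N\rangle}{(X_i^{a_i+1},\ X_iX_j-q_{ij}X_jX_i,\ 1\le i,j\le N)}$$ is a Batalin-Vilkovisky algebra.
   Context: Hochschild cohomology of a $k$-algebra $A$: put $\overline{A}=A/(k\cdot 1_A)$, $C^r(A,A)=\mathrm{Hom}_k(\overline{A}^{\otimes r},A)$ for $r\ge 0$, with differential $b^r(f)(\overline{a_1}\otimes\cdots\otimes\overline{a_{r+1}})=(-1)^{r+1}a_1f(\overline{a_2}\otimes\cdots\otimes\overline{a_{r+1}})+\sum_{i=1}^r(-1)^{r+1-i}f(\overline{a_1}\otimes\cdots\otimes\overline{a_ia_{i+1}}\otimes\cdots\otimes\overline{a_{r+1}})+f(\overline{a_1}\otimes\cdots\otimes\overline{a_r})a_{r+1}$. Its cohomology is $HH^*(A)$. The cup product is induced by $(\alpha\cup\beta)(\overline{a_1}\otimes\cdots\otimes\overline{a_{p+q}})=(-1)^{pq}\alpha(\overline{a_1}\otimes\cdots\otimes\overline{a_p})\beta(\overline{a_{p+1}}\otimes\cdots\otimes\overline{a_{p+q}})$ for $\alpha\in C^p$, $\beta\in C^q$. The Lie bracket of degree $-1$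 is induced, for $\alpha\in C^n$, $\beta\in C^m$, by $[\alpha,\beta]=\alpha\,\overline{\circ}\,\beta-(-1)^{(n-1)(m-1)}\beta\,\overline{\circ}\,\alpha$, where $\alpha\,\overline{\circ}\,\beta=\sum_{i=1}^n(-1)^{(m-1)(i-1)}\alpha\,\overline{\circ}_i\,\beta$ and $\alpha\,\overline{\circ}_i\,\beta$ inserts $\beta$ (applied to the $i$-th through $(i+m-1)$-st arguments; the element $\beta\in A$ itself if $m=0$) into the $i$-th slot of $\alpha$; $\alpha\,\overline{\circ}\,\beta=0$ if $n=0$. With these operations $HH^*(A)$ is a Gerstenhaber algebra. Batalin-Vilkovisky algebras: a Gerstenhaber algebra $(\mathcal{H}^*,\cup,[\ ,\ ])$ is a Batalin-Vilkovisky algebra if it has a linear operator $\Delta$ of degree $-1$ with $\Delta\circ\Delta=0$, $\Delta(1)=0$ and $[\alpha,\beta]=(-1)^{|\alpha|+1}\big(\Delta(\alpha\cup\beta)-\Delta(\alpha)\cup\beta-(-1)^{|\alpha|}\alpha\cup\Delta(\beta)\big)$ for all homogeneous $\alpha,\beta$. *)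

theory Defs
  imports "HOL-Algebra.QuotRing" "HOL-Algebra.Module" "HOL-Decision_Procs.Algebra_Aux"
begin

text \<open>
  The ground field \<open>k\<close> is a type of class \<^class>\<open>field\<close>.  \<open>k\<close>-algebras and \<open>k\<close>-vector spaces are
  HOL-Algebra records of type \<open>('k, 'a) module\<close>; in records standing for a mere vector space the
  fields \<^const>\<open>mult\<close> and \<^const>\<open>one\<close> carry no information and are left undefined.
\<close>

section \<open>Quantum complete intersections\<close>

text \<open>
  An element of the free algebra \<open>k\<langle>X_1, \<dots>, X_N\<rangle>\<close> is the finitely supported coefficient function
  of a noncommutative polynomial; the word \<open>X_i X_j \<dots>\<close> is the list \<open>[i, j, \<dots>]\<close>.
\<close>

definition free_algebra :: "nat \<Rightarrow> ('k::field, nat list \<Rightarrow> 'k) module" where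
  "free_algebra N =
     \<lparr>carrier = {f. finite {w. f w \<noteq> 0} \<and> (\<forall>w. f w \<noteq> 0 \<longrightarrow> set w \<subseteq> {1..N})},
      mult = (\<lambda>f g w. \<Sum>l\<le>length w. f (take l w) * g (drop l w)),
      one = (\<lambda>w. if w = [] then 1 else 0),
      zero = (\<lambda>w. 0),
      add = (\<lambda>f g w. f w + g w),
      smult = (\<lambda>c f w. c * f w)\<rparr>"

definition free_gen :: "nat \<Rightarrow> nat list \<Rightarrow> 'k::field" where
  "free_gen i = (\<lambda>w. if w = [i] then 1 else 0)"

text \<open>\<open>A Quot I\<close> of HOL-Algebra, with the scalar multiplication inherited from \<open>A\<close>.\<close>

definition quot_algebra :: "('k, 'a) module \<Rightarrow> 'a set \<Rightarrow> ('k, 'a set) module" where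
  "quot_algebra A I =
     \<lparr>carrier = carrier (A Quot I), mult = mult (A Quot I), one = one (A Quot I),
      zero = zero (A Quot I), add = add (A Quot I),
      smult = (\<lambda>c X. \<Union>x\<in>X. I +>\<^bsub>A\<^esub> (c \<odot>\<^bsub>A\<^esub> x))\<rparr>"

definition qci_relations ::
    "nat \<Rightarrow> (nat \<Rightarrow> nat \<Rightarrow> 'k::field) \<Rightarrow> (nat \<Rightarrow> nat) \<Rightarrow> (nat list \<Rightarrow> 'k) set" where
  "qci_relations N q a =
     (let F = free_algebra N; X = free_gen in
       {X i [^]\<^bsub>F\<^esub> (a i + 1) | i. i \<in> {1..N}} \<union>
       {X i \<otimes>\<^bsub>F\<^esub> X j \<ominus>\<^bsub>F\<^esub> q i j \<odot>\<^bsub>F\<^esub> (X j \<otimes>\<^bsub>F\<^esub> X i) | i j. i \<in> {1..N} \<and> j \<in> {1..N}})"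

definition quantum_complete_intersection ::
    "nat \<Rightarrow> (nat \<Rightarrow> nat \<Rightarrow> 'k::field) \<Rightarrow> (nat \<Rightarrow> nat) \<Rightarrow> ('k, (nat list \<Rightarrow> 'k) set) module" where
  "quantum_complete_intersection N q a =
     quot_algebra (free_algebra N) (Idl\<^bsub>free_algebra N\<^esub> (qci_relations N q a))"


section \<open>The normalized Hochschild complex\<close>

definition tuples :: "('k, 'a) module \<Rightarrow> nat \<Rightarrow> 'a list set" where
  "tuples A r = {as. length as = r \<and> set as \<subseteq> carrier A}"

text \<open>
  By the universal property of \<open>\<otimes>\<close> and of \<open>A/(k\<cdot>1)\<close>, a linear map from the \<open>r\<close>-th tensor power of
  \<open>A/(k\<cdot>1)\<close> to \<open>A\<close> is the same as a \<open>k\<close>-multilinear map of \<open>r\<close> arguments in \<open>A\<close> that vanishes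
  as soon as one argument lies in \<open>k\<cdot>1\<close>.
\<close>

definition cochains :: "('k::field, 'a) module \<Rightarrow> nat \<Rightarrow> ('a list \<Rightarrow> 'a) set" where
  "cochains A r =
     {f \<in> tuples A r \<rightarrow>\<^sub>E carrier A. \<forall>as\<in>tuples A r. \<forall>i<r.
        (\<forall>x\<in>carrier A. \<forall>y\<in>carrier A.
           f (as[i := x \<oplus>\<^bsub>A\<^esub> y]) = f (as[i := x]) \<oplus>\<^bsub>A\<^esub> f (as[i := y])) \<and>
        (\<forall>c. \<forall>x\<in>carrier A. f (as[i := c \<odot>\<^bsub>A\<^esub> x]) = c \<odot>\<^bsub>A\<^esub> f (as[i := x])) \<and>
        (\<forall>c. f (as[i := c \<odot>\<^bsub>A\<^esub> \<one>\<^bsub>A\<^esub>]) = \<zero>\<^bsub>A\<^esub>)}"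

definition cochain_space :: "('k::field, 'a) module \<Rightarrow> nat \<Rightarrow> ('k, 'a list \<Rightarrow> 'a) module" where
  "cochain_space A r =
     \<lparr>carrier = cochains A r, mult = undefined, one = undefined,
      zero = (\<lambda>as\<in>tuples A r. \<zero>\<^bsub>A\<^esub>),
      add = (\<lambda>f g. \<lambda>as\<in>tuples A r. f as \<oplus>\<^bsub>A\<^esub> g as),
      smult = (\<lambda>c f. \<lambda>as\<in>tuples A r. c \<odot>\<^bsub>A\<^esub> f as)\<rparr>"

text \<open>The arguments \<open>a_1, \<dots>, a_{r+1}\<close> are \<open>as ! 0, \<dots>, as ! r\<close>.\<close>

definition differential ::
    "('k::field, 'a) module \<Rightarrow> nat \<Rightarrow> ('a list \<Rightarrow> 'a) \<Rightarrow> 'a list \<Rightarrow> 'a" where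
  "differential A r f = (\<lambda>as\<in>tuples A (r + 1).
       (- 1) ^ (r + 1) \<odot>\<^bsub>A\<^esub> (hd as \<otimes>\<^bsub>A\<^esub> f (tl as))
     \<oplus>\<^bsub>A\<^esub> (\<Oplus>\<^bsub>A\<^esub>i\<in>{1..r}. (- 1) ^ (r + 1 - i) \<odot>\<^bsub>A\<^esub>
             f (take (i - 1) as @ [as ! (i - 1) \<otimes>\<^bsub>A\<^esub> as ! i] @ drop (i + 1) as))
     \<oplus>\<^bsub>A\<^esub> f (butlast as) \<otimes>\<^bsub>A\<^esub> last as)"

definition cocycles :: "('k::field, 'a) module \<Rightarrow> nat \<Rightarrow> ('a list \<Rightarrow> 'a) set" where
  "cocycles A r =
     {f \<in> cochains A r. differential A r f = \<zero>\<^bsub>cochain_space A (r + 1)\<^esub>}"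

fun coboundaries :: "('k::field, 'a) module \<Rightarrow> nat \<Rightarrow> ('a list \<Rightarrow> 'a) set" where
  "coboundaries A 0 = {\<zero>\<^bsub>cochain_space A 0\<^esub>}"
| "coboundaries A (Suc r) = differential A r ` cochains A r"

definition cup_cochain ::
    "('k::field, 'a) module \<Rightarrow> nat \<Rightarrow> nat \<Rightarrow> ('a list \<Rightarrow> 'a) \<Rightarrow> ('a list \<Rightarrow> 'a) \<Rightarrow> 'a list \<Rightarrow> 'a" where
  "cup_cochain A p q \<alpha> \<beta> = (\<lambda>as\<in>tuples A (p + q).
     (- 1) ^ (p * q) \<odot>\<^bsub>A\<^esub> (\<alpha> (take p as) \<otimes>\<^bsub>A\<^esub> \<beta> (drop p as)))"

text \<open>
  The circle product of \<open>\<alpha>\<close> of degree \<open>n\<close> and \<open>\<beta>\<close> of degree \<open>m\<close>.  Signs are integer powers because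
  \<open>m - 1\<close> may be \<open>-1\<close>.  For \<open>n = m = 0\<close>, where \<open>n + m - 1\<close> truncates, the value is not used.
\<close>

definition insert_at ::
    "nat \<Rightarrow> nat \<Rightarrow> ('a list \<Rightarrow> 'a) \<Rightarrow> ('a list \<Rightarrow> 'a) \<Rightarrow> 'a list \<Rightarrow> 'a" where
  "insert_at i m \<alpha> \<beta> as =
     \<alpha> (take (i - 1) as @ [\<beta> (take m (drop (i - 1) as))] @ drop (i - 1 + m) as)"

definition circ_cochain ::
    "('k::field, 'a) module \<Rightarrow> nat \<Rightarrow> nat \<Rightarrow> ('a list \<Rightarrow> 'a) \<Rightarrow> ('a list \<Rightarrow> 'a) \<Rightarrow> 'a list \<Rightarrow> 'a" where
  "circ_cochain A n m \<alpha> \<beta> = (\<lambda>as\<in>tuples A (n + m - 1).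
     \<Oplus>\<^bsub>A\<^esub>i\<in>{1..n}. (- 1) powi ((int m - 1) * (int i - 1)) \<odot>\<^bsub>A\<^esub> insert_at i m \<alpha> \<beta> as)"

definition bracket_cochain ::
    "('k::field, 'a) module \<Rightarrow> nat \<Rightarrow> nat \<Rightarrow> ('a list \<Rightarrow> 'a) \<Rightarrow> ('a list \<Rightarrow> 'a) \<Rightarrow> 'a list \<Rightarrow> 'a" where
  "bracket_cochain A n m \<alpha> \<beta> = (\<lambda>as\<in>tuples A (n + m - 1).
     circ_cochain A n m \<alpha> \<beta> as
     \<ominus>\<^bsub>A\<^esub> (- 1) powi ((int n - 1) * (int m - 1)) \<odot>\<^bsub>A\<^esub> circ_cochain A m n \<beta> \<alpha> as)"


section \<open>Hochschild cohomology\<close>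

text \<open>
  Cohomology is graded by \<open>\<int>\<close> and is zero in negative degrees.  A class is a coset of the
  coboundaries, and operations on classes are induced by operations on representatives.
\<close>

definition cohomology_class ::
    "('k::field, 'a) module \<Rightarrow> nat \<Rightarrow> ('a list \<Rightarrow> 'a) \<Rightarrow> ('a list \<Rightarrow> 'a) set" where
  "cohomology_class A r f = coboundaries A r +>\<^bsub>cochain_space A r\<^esub> f"

definition HH :: "('k::field, 'a) module \<Rightarrow> int \<Rightarrow> ('k, ('a list \<Rightarrow> 'a) set) module" where
  "HH A n =
     (if n < 0 then
        \<lparr>carrier = {{}}, mult = undefined, one = undefined,
         zero = {}, add = (\<lambda>X Y. {}), smult = (\<lambda>c X. {})\<rparr>
      else
        \<lparr>carrier = cohomology_class A (nat n) ` cocycles A (nat n),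
         mult = undefined, one = undefined,
         zero = coboundaries A (nat n),
         add = (\<lambda>X Y. X <+>\<^bsub>cochain_space A (nat n)\<^esub> Y),
         smult = (\<lambda>c X. \<Union>f\<in>X. cohomology_class A (nat n) (c \<odot>\<^bsub>cochain_space A (nat n)\<^esub> f))\<rparr>)"

definition HH_one :: "('k::field, 'a) module \<Rightarrow> ('a list \<Rightarrow> 'a) set" where
  "HH_one A = cohomology_class A 0 (\<lambda>as\<in>tuples A 0. \<one>\<^bsub>A\<^esub>)"

definition HH_cup :: "('k::field, 'a) module \<Rightarrow> int \<Rightarrow> int \<Rightarrow>
    ('a list \<Rightarrow> 'a) set \<Rightarrow> ('a list \<Rightarrow> 'a) set \<Rightarrow> ('a list \<Rightarrow> 'a) set" where
  "HH_cup A p q X Y =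
     (if p < 0 \<or> q < 0 then \<zero>\<^bsub>HH A (p + q)\<^esub>
      else \<Union>\<alpha>\<in>X. \<Union>\<beta>\<in>Y.
        cohomology_class A (nat (p + q)) (cup_cochain A (nat p) (nat q) \<alpha> \<beta>))"

definition HH_bracket :: "('k::field, 'a) module \<Rightarrow> int \<Rightarrow> int \<Rightarrow>
    ('a list \<Rightarrow> 'a) set \<Rightarrow> ('a list \<Rightarrow> 'a) set \<Rightarrow> ('a list \<Rightarrow> 'a) set" where
  "HH_bracket A n m X Y =
     (if n < 0 \<or> m < 0 \<or> n + m - 1 < 0 then \<zero>\<^bsub>HH A (n + m - 1)\<^esub>
      else \<Union>\<alpha>\<in>X. \<Union>\<beta>\<in>Y.
        cohomology_class A (nat (n + m - 1)) (bracket_cochain A (nat n) (nat m) \<alpha> \<beta>))"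


section \<open>Gerstenhaber and Batalin-Vilkovisky algebras\<close>

text \<open>
  A graded vector space is the family \<open>H\<close> of its homogeneous components.  Operations take as
  additional parameters the degrees of their homogeneous arguments.
\<close>

definition graded_vector_space :: "(int \<Rightarrow> ('k::field, 'h) module) \<Rightarrow> bool" where
  "graded_vector_space H \<longleftrightarrow> (\<forall>p. module (cring_class_ops :: 'k ring) (H p))"

definition graded_linear ::
    "(int \<Rightarrow> ('k::field, 'h) module) \<Rightarrow> int \<Rightarrow> (int \<Rightarrow> 'h \<Rightarrow> 'h) \<Rightarrow> bool" where
  "graded_linear H d D \<longleftrightarrow>
     (\<forall>p. D p \<in> carrier (H p) \<rightarrow> carrier (H (p + d)) \<and>
        (\<forall>x\<in>carrier (H p). \<forall>y\<in>carrier (H p).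
           D p (x \<oplus>\<^bsub>H p\<^esub> y) = D p x \<oplus>\<^bsub>H (p + d)\<^esub> D p y) \<and>
        (\<forall>c. \<forall>x\<in>carrier (H p). D p (c \<odot>\<^bsub>H p\<^esub> x) = c \<odot>\<^bsub>H (p + d)\<^esub> D p x))"

definition graded_bilinear ::
    "(int \<Rightarrow> ('k::field, 'h) module) \<Rightarrow> int \<Rightarrow> (int \<Rightarrow> int \<Rightarrow> 'h \<Rightarrow> 'h \<Rightarrow> 'h) \<Rightarrow> bool" where
  "graded_bilinear H d B \<longleftrightarrow>
     (\<forall>p q.
        (\<forall>x\<in>carrier (H p). \<forall>y\<in>carrier (H q). B p q x y \<in> carrier (H (p + q + d))) \<and>
        (\<forall>x\<in>carrier (H p). \<forall>x'\<in>carrier (H p). \<forall>y\<in>carrier (H q).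
           B p q (x \<oplus>\<^bsub>H p\<^esub> x') y = B p q x y \<oplus>\<^bsub>H (p + q + d)\<^esub> B p q x' y) \<and>
        (\<forall>x\<in>carrier (H p). \<forall>y\<in>carrier (H q). \<forall>y'\<in>carrier (H q).
           B p q x (y \<oplus>\<^bsub>H q\<^esub> y') = B p q x y \<oplus>\<^bsub>H (p + q + d)\<^esub> B p q x y') \<and>
        (\<forall>c. \<forall>x\<in>carrier (H p). \<forall>y\<in>carrier (H q).
           B p q (c \<odot>\<^bsub>H p\<^esub> x) y = c \<odot>\<^bsub>H (p + q + d)\<^esub> B p q x y \<and>
           B p q x (c \<odot>\<^bsub>H q\<^esub> y) = c \<odot>\<^bsub>H (p + q + d)\<^esub> B p q x y))"

locale gerstenhaber_algebra =
  fixes H :: "int \<Rightarrow> ('k::field, 'h) module"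
    and cup :: "int \<Rightarrow> int \<Rightarrow> 'h \<Rightarrow> 'h \<Rightarrow> 'h"
    and unit :: 'h
    and bracket :: "int \<Rightarrow> int \<Rightarrow> 'h \<Rightarrow> 'h \<Rightarrow> 'h"
  assumes graded: "graded_vector_space H"
    and cup_bilinear: "graded_bilinear H 0 cup"
    and unit_closed: "unit \<in> carrier (H 0)"
    and cup_unit: "x \<in> carrier (H p) \<Longrightarrow> cup 0 p unit x = x \<and> cup p 0 x unit = x"
    and cup_assoc:
      "\<lbrakk>x \<in> carrier (H p); y \<in> carrier (H q); z \<in> carrier (H r)\<rbrakk> \<Longrightarrow>
         cup (p + q) r (cup p q x y) z = cup p (q + r) x (cup q r y z)"
    and cup_graded_commutative:
      "\<lbrakk>x \<in> carrier (H p); y \<in> carrier (H q)\<rbrakk> \<Longrightarrow>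
         cup p q x y = (- 1) powi (p * q) \<odot>\<^bsub>H (p + q)\<^esub> cup q p y x"
    and bracket_bilinear: "graded_bilinear H (- 1) bracket"
    and bracket_antisymmetric:
      "\<lbrakk>x \<in> carrier (H p); y \<in> carrier (H q)\<rbrakk> \<Longrightarrow>
         bracket p q x y =
           \<ominus>\<^bsub>H (p + q - 1)\<^esub> ((- 1) powi ((p - 1) * (q - 1)) \<odot>\<^bsub>H (p + q - 1)\<^esub> bracket q p y x)"
    and jacobi:
      "\<lbrakk>x \<in> carrier (H p); y \<in> carrier (H q); z \<in> carrier (H r)\<rbrakk> \<Longrightarrow>
         (- 1) powi ((p - 1) * (r - 1)) \<odot>\<^bsub>H (p + q + r - 2)\<^esub>
             bracket (p + q - 1) r (bracket p q x y) z
         \<oplus>\<^bsub>H (p + q + r - 2)\<^esub> (- 1) powi ((q - 1) * (p - 1)) \<odot>\<^bsub>H (p + q + r - 2)\<^esub>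
             bracket (q + r - 1) p (bracket q r y z) x
         \<oplus>\<^bsub>H (p + q + r - 2)\<^esub> (- 1) powi ((r - 1) * (q - 1)) \<odot>\<^bsub>H (p + q + r - 2)\<^esub>
             bracket (r + p - 1) q (bracket r p z x) y
         = \<zero>\<^bsub>H (p + q + r - 2)\<^esub>"
    and poisson:
      "\<lbrakk>x \<in> carrier (H p); y \<in> carrier (H q); z \<in> carrier (H r)\<rbrakk> \<Longrightarrow>
         bracket p (q + r) x (cup q r y z) =
           cup (p + q - 1) r (bracket p q x y) z
           \<oplus>\<^bsub>H (p + q + r - 1)\<^esub> (- 1) powi ((p - 1) * q) \<odot>\<^bsub>H (p + q + r - 1)\<^esub>
             cup q (p + r - 1) y (bracket p r x z)"

definition batalin_vilkovisky_algebra ::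
    "(int \<Rightarrow> ('k::field, 'h) module) \<Rightarrow> (int \<Rightarrow> int \<Rightarrow> 'h \<Rightarrow> 'h \<Rightarrow> 'h) \<Rightarrow> 'h \<Rightarrow>
     (int \<Rightarrow> int \<Rightarrow> 'h \<Rightarrow> 'h \<Rightarrow> 'h) \<Rightarrow> bool" where
  "batalin_vilkovisky_algebra H cup unit bracket \<longleftrightarrow>
     gerstenhaber_algebra H cup unit bracket \<and>
     (\<exists>\<Delta>. graded_linear H (- 1) \<Delta> \<and>
        (\<forall>p. \<forall>x\<in>carrier (H p). \<Delta> (p - 1) (\<Delta> p x) = \<zero>\<^bsub>H (p - 2)\<^esub>) \<and>
        \<Delta> 0 unit = \<zero>\<^bsub>H (- 1)\<^esub> \<and>
        (\<forall>p q. \<forall>x\<in>carrier (H p). \<forall>y\<in>carrier (H q).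
           bracket p q x y = (- 1) powi (p + 1) \<odot>\<^bsub>H (p + q - 1)\<^esub>
             (\<Delta> (p + q) (cup p q x y)
              \<ominus>\<^bsub>H (p + q - 1)\<^esub> cup (p - 1) q (\<Delta> p x) y
              \<ominus>\<^bsub>H (p + q - 1)\<^esub> (- 1) powi p \<odot>\<^bsub>H (p + q - 1)\<^esub> cup p (q - 1) x (\<Delta> q y))))"

end

theory Submission
  imports Defs "HOL-Library.Function_Algebras" "HOL.Vector_Spaces"
begin

text \<open>
  A quantum complete intersection is a Frobenius algebra whose Nakayama automorphism \<open>nu\<close> acts
  diagonally on the basis of ordered monomials.  The Frobenius form turns Connes' operator, twisted
  by \<open>nu\<close>, into an operator \<open>Del\<close> of degree \<open>-1\<close> on normalized Hochschild cochains, and the commutator of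
  \<open>Del\<close> with the differential is, up to sign, \<open>1 - T\<close>, where \<open>T\<close> is the action of \<open>nu\<close> on
  cochains.  As \<open>T\<close> is diagonalizable in every degree, every class has a \<open>T\<close>-invariant
  representative, unique up to the boundary of a \<open>T\<close>-invariant cochain.  On invariant cocycles \<open>Del\<close>
  induces a square-zero operator, and an explicit homotopy identifies its failure to be a derivation of
  the cup product with the Gerstenhaber bracket.
\<close>

section \<open>Brace operations on cochains\<close>

text \<open>Diagonality of \<open>nu\<close> is what singles these algebras out. A Frobenius form
  only makes the twist \<open>T\<close> homotopic to the identity; passing to
  \<open>T\<close>-invariants also requires the eigenvalue 1 to split off. Here every monomial is an
  eigenvector of \<open>nu\<close> with eigenvalue in the ground field, so on cochains of one degree
  \<open>T\<close> is diagonal with finitely many eigenvalues, and the product of the factors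
  \<open>(T - m) / (1 - m)\<close> over the eigenvalues \<open>m\<close> other than 1 is a chain map
  onto the invariants. The eigenvalues come from the bicharacter \<open>chi\<close>, the cost of
  reordering monomials: the form is the coefficient of the top monomial, and comparing both orders
  of two complementary monomials gives \<open>chi u top_exp / chi top_exp u\<close>. The second
  obstacle is the signs, which must be right in every characteristic; nothing is divided by 2 and
  all homotopies are explicit. Normalization matters too: \<open>Del\<close> squares to zero term by
  term because the unit lands in a slot of a normalized cochain.\<close>

text \<open>Signs act through the additive inverse, so the same operator serves scalars, vectors and
  whole cochains; the exponents are integers because degrees may be negative.\<close>

definition sg :: "int \<Rightarrow> 'v::ab_group_add \<Rightarrow> 'v" where
  "sg n v = (if even n then v else - v)"

lemma sg_add: "sg n (x + y) = sg n x + sg n y"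
  and sg_0 [simp]: "sg n 0 = 0"
  and sg_neg: "sg n (- x) = - sg n x"
  and sg_diff: "sg n (x - y) = sg n x - sg n y"
  and sg_sg: "sg a (sg b x) = sg (a + b) x"
  by (auto simp: sg_def)

lemma sg_parity: "even a = even b \<Longrightarrow> sg a x = sg b x"
  by (simp add: sg_def)

text \<open>Sum over all ways to write a list as a concatenation \<open>u @ w\<close>.  All operations on cochains are
  written as such sums, so that identities reduce to matching summands and comparing sign parities.\<close>

primrec ssum :: "('a list \<Rightarrow> 'a list \<Rightarrow> 'v::ab_group_add) \<Rightarrow> 'a list \<Rightarrow> 'v" where
  "ssum F [] = F [] []"
| "ssum F (x # xs) = F [] (x # xs) + ssum (\<lambda>u w. F (x # u) w) xs"

declare ssum.simps [simp del]
lemmas ssum_simps = ssum.simps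

lemma ssum_cong:
  "(\<And>u w. u @ w = as \<Longrightarrow> F u w = G u w) \<Longrightarrow> ssum F as = ssum G as"
proof (induction as arbitrary: F G)
  case Nil
  then show ?case by (simp add: ssum_simps)
next
  case (Cons a as)
  have "ssum (\<lambda>u. F (a # u)) as = ssum (\<lambda>u. G (a # u)) as"
    by (rule Cons.IH) (simp add: Cons.prems)
  then show ?case by (simp add: ssum_simps Cons.prems)
qed

lemma ssum_add: "ssum (\<lambda>u w. F u w + G u w) as = ssum F as + ssum G as"
  by (induction as arbitrary: F G) (simp_all add: ssum_simps algebra_simps)

lemma ssum_neg: "ssum (\<lambda>u w. - F u w) as = - ssum F as"
  by (induction as arbitrary: F) (simp_all add: ssum_simps algebra_simps)

lemma ssum_diff: "ssum (\<lambda>u w. F u w - G u w) as = ssum F as - ssum G as"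
  using ssum_add[of F "\<lambda>u w. - G u w"] by (simp add: ssum_neg)

lemma ssum_zero [simp]: "ssum (\<lambda>u w. 0) as = 0"
  by (induction as) (simp_all add: ssum_simps)

lemma additive_ssum:
  assumes "\<And>x y. h (x + y) = h x + h y"
  shows "h (ssum F as) = ssum (\<lambda>u w. h (F u w)) as"
  by (induction as arbitrary: F) (simp_all add: ssum_simps assms)

lemma sg_ssum: "sg n (ssum F as) = ssum (\<lambda>u w. sg n (F u w)) as"
  by (rule additive_ssum) (rule sg_add)

lemma ssum_commute:
  "ssum (\<lambda>a b. ssum (\<lambda>c d. F a b c d) ys) xs = ssum (\<lambda>c d. ssum (\<lambda>a b. F a b c d) xs) ys"
  by (induction xs arbitrary: F) (simp_all add: ssum_simps ssum_add)

text \<open>A cut of \<open>u @ c # w\<close> falls on one side of the marked letter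
  \<open>c\<close>. Every case distinction on where a block lies relative to an inserted value goes
  back to this rule.\<close>

lemma ssum_mid:
  "ssum F (u @ c # w) = ssum (\<lambda>x y. F x (y @ c # w)) u + ssum (\<lambda>x y. F (u @ c # x) y) w"
  by (induction u arbitrary: F) (cases w, simp_all add: ssum_simps add.assoc)

lemma ssum_map: "ssum F (map g as) = ssum (\<lambda>u w. F (map g u) (map g w)) as"
  by (induction as arbitrary: F) (simp_all add: ssum_simps)

text \<open>Coassociativity of deconcatenation. Used from left to right, it brings iterated sums
  into right-nested form, a sum over consecutive blocks; \<open>ssum_flatten2\<close> to
  \<open>ssum_flatten6\<close> do the same when the sum over the cuts of \<open>x\<close> sits under
  further sums over the remainder.\<close>

lemma ssum_flatten1:
  "ssum (\<lambda>x r. ssum (\<lambda>s t. F x s t r) x) as = ssum (\<lambda>s q. ssum (\<lambda>t r. F (s @ t) s t r) q) as"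
proof (induction as arbitrary: F)
  case (Cons a as)
  show ?case
    by (simp add: ssum_simps ssum_add Cons.IH[of "\<lambda>x s. F (a # x) (a # s)"] add.assoc)
qed (simp add: ssum_simps)

lemma ssum_flatten2:
  "ssum (\<lambda>x r. ssum (\<lambda>y r1. ssum (\<lambda>s t. F x s t r y r1) x) r) as
   = ssum (\<lambda>s q. ssum (\<lambda>t r. ssum (\<lambda>y r1. F (s @ t) s t r y r1) r) q) as"
  (is "?L = ?R")
proof -
  have "?L = ssum (\<lambda>x r. ssum (\<lambda>s t. ssum (\<lambda>y r1. F x s t r y r1) r) x) as"
    by (rule ssum_cong, rule ssum_commute)
  also have "\<dots> = ?R" by (rule ssum_flatten1)
  finally show ?thesis .
qed

lemma ssum_flatten3:
  "ssum (\<lambda>x r. ssum (\<lambda>y r1. ssum (\<lambda>z r2. ssum (\<lambda>s t. F x s t r y r1 z r2) x) r1) r) as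
   = ssum (\<lambda>s q. ssum (\<lambda>t r. ssum (\<lambda>y r1. ssum (\<lambda>z r2. F (s @ t) s t r y r1 z r2) r1) r) q) as"
  (is "?L = ?R")
proof -
  have "?L = ssum (\<lambda>x r. ssum (\<lambda>y r1. ssum (\<lambda>s t. ssum (\<lambda>z r2. F x s t r y r1 z r2) r1) x) r) as"
    by (rule ssum_cong, rule ssum_cong, rule ssum_commute)
  also have "\<dots> = ?R" by (rule ssum_flatten2)
  finally show ?thesis .
qed

lemma ssum_flatten4:
  "ssum (\<lambda>x r. ssum (\<lambda>y r1. ssum (\<lambda>z r2. ssum (\<lambda>z1 r3. ssum (\<lambda>s t. F x s t r y r1 z r2 z1 r3) x) r2)
      r1) r) as
   = ssum (\<lambda>s q. ssum (\<lambda>t r. ssum (\<lambda>y r1. ssum (\<lambda>z r2. ssum (\<lambda>z1 r3. F (s @ t) s t r y r1 z r2 z1 r3)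
       r2) r1) r) q) as"
  (is "?L = ?R")
proof -
  have "?L = ssum (\<lambda>x r. ssum (\<lambda>y r1. ssum (\<lambda>z r2. ssum (\<lambda>s t. ssum (\<lambda>z1 r3. F x s t r y r1 z r2 z1
      r3) r2) x) r1) r) as"
    by (rule ssum_cong, rule ssum_cong, rule ssum_cong, rule ssum_commute)
  also have "\<dots> = ?R" by (rule ssum_flatten3)
  finally show ?thesis .
qed

lemma ssum_flatten5:
  "ssum (\<lambda>x r. ssum (\<lambda>y r1. ssum (\<lambda>z r2. ssum (\<lambda>z1 r3. ssum (\<lambda>z2 r4. ssum (\<lambda>s t. F x s t r y r1 z r2
      z1 r3 z2 r4) x) r3) r2) r1) r) as
   = ssum (\<lambda>s q. ssum (\<lambda>t r. ssum (\<lambda>y r1. ssum (\<lambda>z r2. ssum (\<lambda>z1 r3. ssum (\<lambda>z2 r4. F (s @ t) s t r y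
       r1 z r2 z1 r3 z2 r4) r3) r2) r1) r) q) as"
  (is "?L = ?R")
proof -
  have "?L = ssum (\<lambda>x r. ssum (\<lambda>y r1. ssum (\<lambda>z r2. ssum (\<lambda>z1 r3. ssum (\<lambda>s t. ssum (\<lambda>z2 r4. F x s t r y
      r1 z r2 z1 r3 z2 r4) r3) x) r2) r1) r) as"
    by (rule ssum_cong, rule ssum_cong, rule ssum_cong, rule ssum_cong, rule ssum_commute)
  also have "\<dots> = ?R" by (rule ssum_flatten4)
  finally show ?thesis .
qed

lemma ssum_flatten6:
  "ssum (\<lambda>x r. ssum (\<lambda>y r1. ssum (\<lambda>z r2. ssum (\<lambda>z1 r3. ssum (\<lambda>z2 r4. ssum (\<lambda>z3 r5. ssum (\<lambda>s t. F x s t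
      r y r1 z r2 z1 r3 z2 r4 z3 r5) x) r4) r3) r2) r1) r) as
   = ssum (\<lambda>s q. ssum (\<lambda>t r. ssum (\<lambda>y r1. ssum (\<lambda>z r2. ssum (\<lambda>z1 r3. ssum (\<lambda>z2 r4. ssum (\<lambda>z3 r5. F (s
       @ t) s t r y r1 z r2 z1 r3 z2 r4 z3 r5) r4) r3) r2) r1) r) q) as"
  (is "?L = ?R")
proof -
  have "?L = ssum (\<lambda>x r. ssum (\<lambda>y r1. ssum (\<lambda>z r2. ssum (\<lambda>z1 r3. ssum (\<lambda>z2 r4. ssum (\<lambda>s t. ssum (\<lambda>z3
      r5. F x s t r y r1 z r2 z1 r3 z2 r4 z3 r5) r4) x) r3) r2) r1) r) as"
    by (rule ssum_cong, rule ssum_cong, rule ssum_cong, rule ssum_cong, rule ssum_cong, rule ssum_commute)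
  also have "\<dots> = ?R" by (rule ssum_flatten5)
  finally show ?thesis .
qed

lemmas ssum_flattens = ssum_flatten1 ssum_flatten2 ssum_flatten3 ssum_flatten4 ssum_flatten5 ssum_flatten6

section \<open>Circle product and braces of multiadditive maps\<close>

definition multiadd :: "('v list \<Rightarrow> 'v::ab_group_add) \<Rightarrow> bool" where
  "multiadd f \<longleftrightarrow> (\<forall>u x y w. f (u @ (x + y) # w) = f (u @ x # w) + f (u @ y # w))"

abbreviation len :: "'a list \<Rightarrow> int" where "len u \<equiv> int (length u)"

text \<open>The sign is read off from the block lengths: for \<open>len v = m\<close> and
  \<open>len u = i - 1\<close> it is the parity of \<open>(m - 1) * (i - 1)\<close>, so the
  operation carries no degree parameters.\<close>

definition circ :: "('v list \<Rightarrow> 'v::ab_group_add) \<Rightarrow> ('v list \<Rightarrow> 'v) \<Rightarrow> 'v list \<Rightarrow> 'v" where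
  "circ x y as = ssum (\<lambda>u a. ssum (\<lambda>v w. sg ((len v + 1) * len u) (x (u @ y v # w))) a) as"

text \<open>The extra sign exponent \<open>k\<close> depends on the degrees of the inserted cochains.\<close>

definition brace2 where
  "brace2 k x y z as = ssum (\<lambda>u a. ssum (\<lambda>v b. ssum (\<lambda>w c. ssum (\<lambda>t r.
     sg (k (len v) (len t) + (len v + 1) * len u + (len t + 1) * (len u + len v + len w))
       (x (u @ y v # w @ z t # r))) c) b) a) as"

definition brace3 where
  "brace3 k x y z y' as = ssum (\<lambda>u a. ssum (\<lambda>v b. ssum (\<lambda>w c. ssum (\<lambda>t d. ssum (\<lambda>w' e. ssum (\<lambda>t' r.
     sg (k (len v) (len t) (len t') + (len v + 1) * len u + (len t + 1) * (len u + len v + len w)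
         + (len t' + 1) * (len u + len v + len w + len t + len w'))
       (x (u @ y v # w @ z t # w' @ y' t' # r))) e) d) c) b) a) as"

lemma multiadd_ssum:
  assumes "multiadd x"
  shows "x (u @ ssum F v # w) = ssum (\<lambda>s t. x (u @ F s t # w)) v"
  by (rule additive_ssum) (use assms in \<open>simp add: multiadd_def\<close>)

lemma multiadd_ssum2:
  assumes "multiadd x"
  shows "x (u @ b # u' @ ssum F v # w) = ssum (\<lambda>s t. x (u @ b # u' @ F s t # w)) v"
  using multiadd_ssum[OF assms, of "u @ b # u'"] by simp

lemma multiadd_uminus: assumes "multiadd x" shows "x (u @ (- c) # w) = - x (u @ c # w)"
proof -
  have "x (u @ (0 + 0) # w) = x (u @ 0 # w) + x (u @ 0 # w)"
    using assms unfolding multiadd_def by blast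
  then have "x (u @ 0 # w) = 0" by simp
  moreover have "x (u @ (c + - c) # w) = x (u @ c # w) + x (u @ (- c) # w)"
    using assms unfolding multiadd_def by blast
  ultimately show ?thesis by (simp add: eq_neg_iff_add_eq_0 add.commute)
qed

lemma multiadd_0: assumes "multiadd x" shows "x (u @ 0 # w) = 0"
proof -
  have "x (u @ (0 + 0) # w) = x (u @ 0 # w) + x (u @ 0 # w)"
    using assms unfolding multiadd_def by blast
  then show ?thesis by simp
qed

lemma multiadd_sg: assumes "multiadd x" shows "x (u @ sg k c # w) = sg k (x (u @ c # w))"
  by (simp add: sg_def multiadd_uminus[OF assms])

lemma multiadd_sg2: assumes "multiadd x" shows "x (u @ b # u' @ sg k c # w) = sg k (x (u @ b # u' @ c # w))"
  using multiadd_sg[OF assms, of "u @ b # u'"] by simp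

text \<open>These rules split sums, nest them to the right and merge the signs in the summand, so
  that two expansions can be compared summand by summand.\<close>

lemmas ssum_norm = ssum_mid ssum_add[abs_def] sg_ssum sg_add sg_sg ssum_flattens[abs_def]

text \<open>A cochain of degree \<open>n\<close> is a function on lists of any length that vanishes on lists of length
  other than \<open>n\<close>; thus degrees are integers, and only \<open>0\<close> has negative degree.\<close>

definition homog :: "int \<Rightarrow> ('a list \<Rightarrow> 'v::ab_group_add) \<Rightarrow> bool" where
  "homog n f \<longleftrightarrow> (\<forall>as. f as \<noteq> 0 \<longrightarrow> len as = n)"

text \<open>Signs have to agree only where the summand is nonzero. This is how homogeneity enters:
  on a nonzero summand the block lengths are the degrees.\<close>

lemma sg_parity_nonzero: "(x \<noteq> 0 \<Longrightarrow> even a = even b) \<Longrightarrow> sg a x = sg b x"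
  by (cases "x = 0") (auto simp: sg_def)

text \<open>The equation points from the whole list to its parts, so that lengths of remainders
  occurring in signs are rewritten into block lengths.\<close>

lemma ssum_cong_split:
  "(\<And>u w. as = u @ w \<Longrightarrow> F u w = G u w) \<Longrightarrow> ssum F as = ssum G as"
  by (rule ssum_cong) simp

lemmas ssum_match = arg_cong2[where f="(+)"] ssum_cong sg_parity_nonzero

text \<open>The value of \<open>z\<close> is a marked letter for \<open>circ x y\<close>: the block
  of \<open>y\<close> lies before it, around it or after it. In the last case \<open>y\<close> and
  \<open>z\<close> have changed places, hence the extra sign.\<close>

lemma circ_circ:
  assumes "multiadd x"
  shows "circ (circ x y) z as =
    brace2 (\<lambda>_ _. 0) x y z as + circ x (circ y z) as + brace2 (\<lambda>a b. (a + 1) * (b + 1)) x z y as"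
  unfolding circ_def brace2_def
  apply (simp add: ssum_norm multiadd_ssum[OF assms] multiadd_sg[OF assms])
  apply (intro ssum_match)
  apply (simp; argo)+
  done

text \<open>The block of \<open>w\<close> has six positions relative to the values of
  \<open>y\<close> and \<open>z\<close>: before both, around the first, around both, between them,
  around the second, after both. The summands appear in this order.\<close>

lemma brace2_circ_left:
  assumes "multiadd x" and "homog n w"
  shows "brace2 (\<lambda>_ _. 0) (circ x w) y z as =
     brace3 (\<lambda>_ _ _. 0) x w y z as
     + (brace2 (\<lambda>_ _. 0) x (circ w y) z as + circ x (brace2 (\<lambda>_ _. 0) w y z) as)
     + (brace3 (\<lambda>a b c. (a + 1) * (b + 1)) x y w z as
        + brace2 (\<lambda>a b. (n + 1) * (a + 1)) x y (circ w z) as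
        + brace3 (\<lambda>a b c. (c + 1) * (a + b)) x y z w as)"
proof -
  \<comment> \<open>When \<open>w\<close> surrounds the value of \<open>z\<close>, that value is a
    single letter of the list that \<open>w\<close> reads; the degree \<open>n\<close> then fixes
    the parity of the remaining letters.\<close>
  have n: "even (len u + len v) = even (n + 1)" if "x (l @ w (u @ c # v) # r) \<noteq> 0" for l u c v r
  proof -
    have "w (u @ c # v) \<noteq> 0" using that multiadd_0[OF assms(1)] by metis
    then have "len (u @ c # v) = n" using assms(2) unfolding homog_def by blast
    then show ?thesis by auto
  qed
  have n2: "even (len u + len v) = even (n + 1)" if "x (l @ b # l' @ w (u @ c # v) # r) \<noteq> 0" for b l
      l' u c v r
    using n[of "l @ b # l'"] that by simp
  show ?thesis
  unfolding circ_def brace2_def brace3_def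
  apply (simp add: ssum_norm multiadd_ssum[OF assms(1)] multiadd_sg[OF assms(1)] multiadd_ssum2[OF
      assms(1)] multiadd_sg2[OF assms(1)])
  apply (intro ssum_match)
  subgoal by (simp; argo)
  subgoal by (simp; argo)
  subgoal by (simp; argo)
  subgoal by (simp; argo)
  subgoal by (drule n2) (simp; argo)
  subgoal by (simp; argo)
  done
qed

text \<open>Here the value of \<open>w\<close> is the marked letter. It lies after both blocks,
  inside that of \<open>z\<close>, between them, inside that of \<open>y\<close> or before
  both.\<close>

lemma circ_brace2:
  assumes "multiadd x" and "multiadd y" and "homog n w"
  shows "circ (brace2 (\<lambda>_ _. 0) x y z) w as =
    brace3 (\<lambda>_ _ _. 0) x y z w as
    + brace2 (\<lambda>_ _. 0) x y (circ z w) as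
    + brace3 (\<lambda>a b c. (b + 1) * (c + 1)) x y w z as
    + brace2 (\<lambda>a b. (n + 1) * (b + 1)) x (circ y w) z as
    + brace3 (\<lambda>a b c. (a + 1) * (b + c)) x w y z as"
proof -
  have n: "even (length v) = even n" if "x (l @ y (u @ w v # c) # r) \<noteq> 0" for l u c v r
  proof -
    have "w v \<noteq> 0" using that multiadd_0[OF assms(1)] multiadd_0[OF assms(2)] by metis
    then have "len v = n" using assms(3) unfolding homog_def by blast
    then show ?thesis by auto
  qed
  show ?thesis
    unfolding circ_def brace2_def brace3_def
    apply (simp add: ssum_norm multiadd_ssum[OF assms(1)] multiadd_sg[OF assms(1)] multiadd_ssum2[OF
        assms(1)] multiadd_sg2[OF assms(1)])
    apply (intro ssum_match)
    subgoal by (simp; argo)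
    subgoal by (simp; argo)
    subgoal by (simp; argo)
    subgoal by (drule n) (simp; argo)
    subgoal by (simp; argo)
    done
qed

text \<open>On nonzero summands the block lengths are the degrees, so the extra sign is constant and
  leaves the sum.\<close>

lemma brace2_homog:
  assumes "multiadd x" "homog p y" "homog q z"
  shows "brace2 k x y z as = sg (k p q) (brace2 (\<lambda>_ _. 0) x y z as)"
proof -
  have *: "len v = p \<and> len t = q" if "x (u @ y v # w @ z t # r) \<noteq> 0" for u v w t r
  proof -
    have "y v \<noteq> 0" using that multiadd_0[OF assms(1)] by metis
    moreover have "z t \<noteq> 0" using that multiadd_0[OF assms(1), of "u @ y v # w"] by auto
    ultimately show ?thesis using assms unfolding homog_def by blast
  qed
  show ?thesis
    unfolding brace2_def
    apply (simp add: sg_ssum sg_sg)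
    apply (intro ssum_match)
    subgoal by (drule *) (simp; argo)
    done
qed

lemma brace3_homog:
  assumes "multiadd x" "homog p y" "homog q z" "homog r z'"
  shows "brace3 k x y z z' as = sg (k p q r) (brace3 (\<lambda>_ _ _. 0) x y z z' as)"
proof -
  have *: "len v = p \<and> len t = q \<and> len t' = r" if "x (u @ y v # w @ z t # w' @ z' t' # e) \<noteq> 0" for u v
      w t w' t' e
  proof -
    have "y v \<noteq> 0" using that multiadd_0[OF assms(1)] by metis
    moreover have "z t \<noteq> 0" using that multiadd_0[OF assms(1), of "u @ y v # w"] by auto
    moreover have "z' t' \<noteq> 0" using that multiadd_0[OF assms(1), of "u @ y v # w @ z t # w'"] by auto
    ultimately show ?thesis using assms unfolding homog_def by blast
  qed
  show ?thesis
    unfolding brace3_def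
    apply (simp add: sg_ssum sg_sg)
    apply (intro ssum_match)
    subgoal by (drule *) (simp; argo)
    done
qed

section \<open>The Hochschild complex of an algebra\<close>

lemma ssum_only_end:
  assumes "\<And>u w. w \<noteq> [] \<Longrightarrow> F u w = 0"
  shows "ssum F as = F as []"
  using assms
proof (induction as arbitrary: F)
  case (Cons a as)
  have "ssum (\<lambda>u. F (a # u)) as = F (a # as) []"
    using Cons.prems by (intro Cons.IH) auto
  then show ?case using Cons.prems by (simp add: ssum_simps)
qed (simp add: ssum_simps)

lemma ssum_only_start:
  assumes "\<And>u w. u \<noteq> [] \<Longrightarrow> F u w = 0"
  shows "ssum F as = F [] as"
proof (cases as)
  case (Cons a as')
  have "ssum (\<lambda>u. F (a # u)) as' = ssum (\<lambda>u w. 0) as'"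
    using assms by (intro ssum_cong) auto
  then show ?thesis by (simp add: ssum_simps Cons)
qed (simp add: ssum_simps)

lemma sg_fun [simp]: "sg n f x = sg n (f x)"
  by (simp add: sg_def)

lemma circ_add1: "circ (f + g) h = circ f h + circ g h"
  by (rule ext) (simp add: circ_def sg_add ssum_add[abs_def])

lemma circ_sg1: "circ (sg n f) h = sg n (circ f h)"
  by (rule ext) (simp add: circ_def sg_ssum sg_sg add.commute)

lemma circ_uminus1: "circ (- f) h = - circ f h"
  using circ_sg1[of 1 f h] by (simp add: sg_def)

lemma circ_add2: "multiadd h \<Longrightarrow> circ h (f + g) = circ h f + circ h g"
  by (rule ext) (simp add: circ_def sg_add ssum_add[abs_def] multiadd_def)

lemma circ_sg2: "multiadd h \<Longrightarrow> circ h (sg n f) = sg n (circ h f)"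
  by (rule ext) (simp add: circ_def sg_ssum sg_sg multiadd_sg add.commute)

lemma circ_uminus2: "multiadd h \<Longrightarrow> circ h (- f) = - circ h f"
  using circ_sg2[of h 1 f] by (simp add: sg_def)

lemma circ_diff1: "circ (f - g) h = circ f h - circ g h"
  using circ_add1[of f "- g" h] by (simp add: circ_uminus1)

lemma circ_diff2: "multiadd h \<Longrightarrow> circ h (f - g) = circ h f - circ h g"
  using circ_add2[of h f "- g"] by (simp add: circ_uminus2)

lemma circ_0_1 [simp]: "circ 0 h = 0"
  by (rule ext) (simp add: circ_def)

lemma circ_0_2: "multiadd h \<Longrightarrow> circ h 0 = 0"
  by (rule ext) (simp add: circ_def multiadd_0)

abbreviation br where "br x y z \<equiv> brace2 (\<lambda>_ _. 0) x y z"
abbreviation br3 where "br3 x y z w \<equiv> brace3 (\<lambda>_ _ _. 0) x y z w"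

lemma br_0_1: "brace2 k 0 y z = 0"
  by (rule ext) (simp add: brace2_def)

lemma br_sg1: "br (sg n f) y z = sg n (br f y z)"
  by (rule ext) (simp add: brace2_def sg_ssum sg_sg add.commute)

lemma br_sg2: "multiadd f \<Longrightarrow> br f (sg n y) z = sg n (br f y z)"
  by (rule ext) (simp add: brace2_def sg_ssum sg_sg multiadd_sg add.commute)

lemma br_sg3: "multiadd f \<Longrightarrow> br f y (sg n z) = sg n (br f y z)"
  by (rule ext) (simp add: brace2_def sg_ssum sg_sg multiadd_sg2 add.commute)

lemma homog_circ:
  assumes "multiadd x" "homog p x" "homog q y"
  shows "homog (p + q - 1) (circ x y)"
  unfolding homog_def
proof (intro allI impI)
  fix as assume *: "circ x y as \<noteq> 0"
  show "len as = p + q - 1"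
  proof (rule ccontr)
    assume neq: "len as \<noteq> p + q - 1"
    have "sg k (x (u @ y v # w)) = 0" if "u @ v @ w = as" for u v w k
    proof (rule ccontr)
      assume "sg k (x (u @ y v # w)) \<noteq> 0"
      then have 1: "x (u @ y v # w) \<noteq> 0" by auto
      then have "y v \<noteq> 0" using multiadd_0[OF assms(1)] by metis
      with 1 have "len v = q" "len (u @ y v # w) = p" using assms unfolding homog_def by blast+
      then show False using neq that by auto
    qed
    then have "circ x y as = ssum (\<lambda>u a. ssum (\<lambda>v w. 0) a) as"
      unfolding circ_def by (intro ssum_cong) auto
    then show False using * by simp
  qed
qed

lemma circ_circ_homog:
  assumes "multiadd x" "homog q y" "homog r z"
  shows "circ (circ x y) z = br x y z + circ x (circ y z) + sg ((q + 1) * (r + 1)) (br x z y)"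
  by (rule ext) (simp add: circ_circ[OF assms(1)] brace2_homog[OF assms(1,3,2), of "\<lambda>a b. (a + 1) * (b
      + 1)"] mult.commute)

section \<open>Gerstenhaber bracket and graded Jacobi identity\<close>

definition bracket :: "int \<Rightarrow> int \<Rightarrow> ('v list \<Rightarrow> 'v::ab_group_add) \<Rightarrow> ('v list \<Rightarrow> 'v) \<Rightarrow> 'v list \<Rightarrow> 'v" where
  "bracket p q x y = circ x y - sg ((p + 1) * (q + 1)) (circ y x)"

lemma multiadd_add: "multiadd f \<Longrightarrow> multiadd g \<Longrightarrow> multiadd (f + g)"
  by (simp add: multiadd_def algebra_simps)

lemma multiadd_sgf: "multiadd f \<Longrightarrow> multiadd (sg n f)"
  by (simp add: multiadd_def sg_add)

lemma multiadd_circ: "multiadd f \<Longrightarrow> multiadd g \<Longrightarrow> multiadd (circ f g)"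
  unfolding multiadd_def
proof (intro allI)
  fix u w x y
  assume *: "\<forall>u x y w. f (u @ (x + y) # w) = f (u @ x # w) + f (u @ y # w)"
     "\<forall>u x y w. g (u @ (x + y) # w) = g (u @ x # w) + g (u @ y # w)"
  have f2: "f (u @ c # v @ (x + y) # w) = f (u @ c # v @ x # w) + f (u @ c # v @ y # w)" for u c v w x y
    using *(1)[rule_format, of "u @ c # v"] by simp
  show "circ f g (u @ (x + y) # w) = circ f g (u @ x # w) + circ f g (u @ y # w)"
    by (simp add: circ_def ssum_mid ssum_add[abs_def] sg_add f2 *[rule_format] add_ac)
qed

text \<open>After expansion by \<open>circ_circ_homog\<close> the double braces cancel in pairs,
  since the associator of \<open>circ\<close> is symmetric up to sign in its last two arguments.
  Only the parities of the degrees matter, hence eight cases.\<close>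

lemma bracket_leibniz:
  assumes "multiadd x" "multiadd y" "multiadd z" "homog p x" "homog q y" "homog r z"
  shows "bracket p (q + r - 1) x (bracket q r y z)
    = bracket (p + q - 1) r (bracket p q x y) z
      + sg ((p + 1) * (q + 1)) (bracket q (p + r - 1) y (bracket p r x z))"
  unfolding bracket_def
  by (cases "even p"; cases "even q"; cases "even r";
      simp add: circ_add1 circ_add2 circ_diff1 circ_diff2 circ_uminus1 circ_uminus2 assms
        circ_circ_homog[OF assms(1,5,6)] circ_circ_homog[OF assms(1,6,5)]
        circ_circ_homog[OF assms(2,4,6)] circ_circ_homog[OF assms(2,6,4)]
        circ_circ_homog[OF assms(3,4,5)] circ_circ_homog[OF assms(3,5,4)] sg_def algebra_simps)

lemma bracket_jacobi:
  assumes "multiadd x" "multiadd y" "multiadd z" "homog p x" "homog q y" "homog r z"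
  shows "sg ((p + 1) * (r + 1)) (bracket (p + q - 1) r (bracket p q x y) z)
    + sg ((q + 1) * (p + 1)) (bracket (q + r - 1) p (bracket q r y z) x)
    + sg ((r + 1) * (q + 1)) (bracket (r + p - 1) q (bracket r p z x) y) = 0"
  unfolding bracket_def
  by (cases "even p"; cases "even q"; cases "even r";
      simp add: circ_add1 circ_add2 circ_diff1 circ_diff2 circ_uminus1 circ_uminus2 assms
        circ_circ_homog[OF assms(1,5,6)] circ_circ_homog[OF assms(1,6,5)]
        circ_circ_homog[OF assms(2,4,6)] circ_circ_homog[OF assms(2,6,4)]
        circ_circ_homog[OF assms(3,4,5)] circ_circ_homog[OF assms(3,5,4)] sg_def algebra_simps)

text \<open>The algebra is the image of \<open>x \<mapsto> e \<cdot> x\<close> for a central idempotent \<open>e\<close> of an ambient space, which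
  is a whole type; \<open>e\<close> is the unit of the algebra, and maps on it are maps that factor through that
  projection.\<close>

locale nu_alg = vector_space scale
  for scale :: "'k::field \<Rightarrow> 'v::ab_group_add \<Rightarrow> 'v" (infixr \<open>*s\<close> 75) +
  fixes mul :: "'v \<Rightarrow> 'v \<Rightarrow> 'v" (infixl \<open>\<cdot>\<close> 70) and e :: 'v
  assumes mul_add_left: "(x + y) \<cdot> z = x \<cdot> z + y \<cdot> z"
    and mul_add_right: "x \<cdot> (y + z) = x \<cdot> y + x \<cdot> z"
    and mul_scale_left: "(c *s x) \<cdot> z = c *s (x \<cdot> z)"
    and mul_scale_right: "x \<cdot> (c *s z) = c *s (x \<cdot> z)"
    and mul_assoc: "(x \<cdot> y) \<cdot> z = x \<cdot> (y \<cdot> z)"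
    and e_central: "x \<cdot> e = e \<cdot> x"
    and e_idem: "e \<cdot> e = e"
begin

lemma mul_0_left [simp]: "0 \<cdot> x = 0"
  using mul_add_left[of 0 0 x] by simp

lemma mul_0_right [simp]: "x \<cdot> 0 = 0"
  using mul_add_right[of x 0 0] by simp

lemma mul_minus_left: "(- x) \<cdot> y = - (x \<cdot> y)"
  using mul_add_left[of "- x" x y] by (simp add: eq_neg_iff_add_eq_0)

lemma mul_minus_right: "x \<cdot> (- y) = - (x \<cdot> y)"
  using mul_add_right[of x "- y" y] by (simp add: eq_neg_iff_add_eq_0)

lemma mul_sg_left: "sg n x \<cdot> y = sg n (x \<cdot> y)"
  by (simp add: sg_def mul_minus_left)

lemma mul_sg_right: "x \<cdot> sg n y = sg n (x \<cdot> y)"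
  by (simp add: sg_def mul_minus_right)

lemma mul_ssum_left: "ssum F as \<cdot> y = ssum (\<lambda>u w. F u w \<cdot> y) as"
  by (rule additive_ssum[where h="\<lambda>x. x \<cdot> y"]) (rule mul_add_left)

lemma mul_ssum_right: "x \<cdot> ssum F as = ssum (\<lambda>u w. x \<cdot> F u w) as"
  by (rule additive_ssum) (rule mul_add_right)

lemma scale_ssum: "c *s ssum F as = ssum (\<lambda>u w. c *s F u w) as"
  by (rule additive_ssum) (rule scale_right_distrib)

lemma scale_sg: "c *s sg n x = sg n (c *s x)"
  by (simp add: sg_def)

section \<open>The differential as bracket with the multiplication\<close>

text \<open>The multiplication as a cochain of degree 2. In general it is not normalized, as it does
  not vanish when one argument is \<open>e\<close>; that \<open>d\<close> preserves normalized
  cochains therefore has a proof of its own in \<open>coch_d\<close>.\<close>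

definition mm :: "'v list \<Rightarrow> 'v" where
  "mm xs = (if length xs = 2 then xs ! 0 \<cdot> xs ! 1 else 0)"

lemma mm_simps [simp]: "mm [] = 0" "mm [x] = 0" "mm [x, y] = x \<cdot> y" "mm (x # y # z # w) = 0"
  by (simp_all add: mm_def)

lemma mm_append_long: "length u + length w \<noteq> 1 \<Longrightarrow> mm (u @ x # w) = 0"
  by (simp add: mm_def)

lemma mm_cases:
  obtains "u = []" "w = []" | y where "u = [y]" "w = []" | y where "u = []" "w = [y]"
    | "length u + length w > 1"
  by (cases u; cases w; cases "tl u"; cases "tl w") auto

lemma multiadd_mm: "multiadd mm"
  unfolding multiadd_def
proof (intro allI)
  fix u w :: "'v list" and x y
  show "mm (u @ (x + y) # w) = mm (u @ x # w) + mm (u @ y # w)"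
    by (rule mm_cases[of u w]) (auto simp: mul_add_left mul_add_right mm_append_long)
qed

lemma homog_mm: "homog 2 mm"
  by (auto simp: homog_def mm_def split: if_splits)

text \<open>In degree 3 the two summands are the two bracketings of a triple product with opposite
  signs.\<close>

lemma circ_mm_mm: "circ mm mm = 0"
proof
  fix as :: "'v list"
  show "circ mm mm as = 0 as"
  proof (cases "length as = 3")
    case False
    then have "len as \<noteq> 2 + 2 - 1" by simp
    then show ?thesis using homog_circ[OF multiadd_mm homog_mm homog_mm] unfolding homog_def by auto
  next
    case True
    then obtain a b c where "as = [a, b, c]" by (auto simp: length_Suc_conv numeral_3_eq_3)
    then show ?thesis by (simp add: circ_def ssum_simps sg_def mul_assoc)
  qed
qed

text \<open>With these signs the Hochschild differential is the bracket with \<open>mm\<close>, see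
  \<open>d_eq_bracket\<close>, so its rules come from the brace identities.\<close>

definition d :: "int \<Rightarrow> ('v list \<Rightarrow> 'v) \<Rightarrow> 'v list \<Rightarrow> 'v" where
  "d n f = circ mm f + sg n (circ f mm)"

lemma d_eq_bracket: "d n f = bracket 2 n mm f"
  by (cases "even n") (simp_all add: d_def bracket_def sg_def)

lemmas circ_lin = circ_add1 circ_add2 circ_diff1 circ_diff2 circ_uminus1 circ_uminus2 circ_sg1 circ_sg2

text \<open>The Jacobi identity for \<open>mm\<close>, \<open>mm\<close> and \<open>f\<close> yields
  only that twice the left-hand side vanishes. Expanding by \<open>circ_circ_homog\<close> settles
  characteristic 2 as well.\<close>

lemma d_d:
  assumes "multiadd f" "homog n f"
  shows "d (n + 1) (d n f) = 0"
proof -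
  note h = multiadd_mm homog_mm assms
  have 1: "circ (circ f mm) mm = 0"
    using circ_circ_homog[OF assms(1) homog_mm homog_mm] by (simp add: circ_mm_mm circ_0_2 h sg_def)
  have 2: "circ (circ mm f) mm = br mm f mm + circ mm (circ f mm) + sg ((n + 1) * (2 + 1)) (br mm mm f)"
    by (rule circ_circ_homog[OF h(1,4,2)])
  have 3: "br mm mm f + circ mm (circ mm f) + sg ((2 + 1) * (n + 1)) (br mm f mm) = 0"
    using circ_circ_homog[OF h(1,2,4)] by (simp add: circ_mm_mm)
  then have 4: "circ mm (circ mm f) = - br mm mm f - sg (n + 1) (br mm f mm)"
    by (simp add: algebra_simps eq_neg_iff_add_eq_0 sg_def split: if_splits)
  show ?thesis
    unfolding d_def
    by (cases "even n") (simp_all add: circ_lin h multiadd_circ 1 2 4 sg_def)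
qed

section \<open>Cup product, its Leibniz rules and the Poisson rule\<close>

definition conv :: "('v list \<Rightarrow> 'v) \<Rightarrow> ('v list \<Rightarrow> 'v) \<Rightarrow> 'v list \<Rightarrow> 'v" where
  "conv f g as = ssum (\<lambda>u w. f u \<cdot> g w) as"

definition cup :: "int \<Rightarrow> int \<Rightarrow> ('v list \<Rightarrow> 'v) \<Rightarrow> ('v list \<Rightarrow> 'v) \<Rightarrow> 'v list \<Rightarrow> 'v" where
  "cup p q f g = sg (p * q) (conv f g)"

lemma conv_assoc: "conv (conv f g) h = conv f (conv g h)"
  by (rule ext) (simp add: conv_def mul_ssum_left mul_ssum_right mul_assoc ssum_flattens[abs_def])

lemma cup_assoc: "cup (p + q) r (cup p q f g) h = cup p (q + r) f (cup q r g h)"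
proof -
  have "conv (sg n f) g = sg n (conv f g)" "conv f (sg n g) = sg n (conv f g)" for n f g
    by (rule ext, simp add: conv_def mul_sg_left mul_sg_right sg_ssum)+
  then show ?thesis by (simp add: cup_def conv_assoc sg_sg algebra_simps)
qed

lemma conv_add1: "conv (f + g) h = conv f h + conv g h"
  and conv_add2: "conv h (f + g) = conv h f + conv h g"
  and conv_sg1: "conv (sg n f) h = sg n (conv f h)"
  and conv_sg2: "conv h (sg n f) = sg n (conv h f)"
  by (rule ext, simp add: conv_def mul_add_left mul_add_right mul_sg_left mul_sg_right sg_ssum
       ssum_add[abs_def])+

text \<open>\<open>mm\<close> reads exactly two letters, so only the summand with all three gaps
  empty survives. This places the cup product inside the brace calculus.\<close>

lemma br_mm:
  assumes "homog p f" "homog q g"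
  shows "br mm f g = sg (p * (q + 1)) (conv f g)"
proof
  fix as
  have E: "F = (0 :: 'v)" if "\<not> F \<noteq> 0" for F using that by blast
  have 1: "ssum (\<lambda>u a. ssum (\<lambda>v b. ssum (\<lambda>w c. ssum (\<lambda>t r. sg (k u v w t r)
       (mm (u @ f v # w @ g t # r))) c) b) a) as
     = ssum (\<lambda>v t. sg (k [] v [] t []) (f v \<cdot> g t)) as" for k
  proof -
    have "ssum (\<lambda>u a. ssum (\<lambda>v b. ssum (\<lambda>w c. ssum (\<lambda>t r. sg (k u v w t r)
       (mm (u @ f v # w @ g t # r))) c) b) a) as
      = ssum (\<lambda>v b. ssum (\<lambda>w c. ssum (\<lambda>t r. sg (k [] v w t r)
       (mm (f v # w @ g t # r))) c) b) as"
      by (rule trans[OF ssum_only_start]) (auto simp: mm_append_long)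
    also have "\<dots> = ssum (\<lambda>v b. ssum (\<lambda>t r. sg (k [] v [] t r) (mm (f v # g t # r))) b) as"
    proof (rule ssum_cong)
      fix v b
      show "ssum (\<lambda>w c. ssum (\<lambda>t r. sg (k [] v w t r) (mm (f v # w @ g t # r))) c) b
          = ssum (\<lambda>t r. sg (k [] v [] t r) (mm (f v # g t # r))) b"
        by (subst ssum_only_start) (auto simp: mm_def)
    qed
    also have "\<dots> = ssum (\<lambda>v t. sg (k [] v [] t []) (f v \<cdot> g t)) as"
    proof (rule ssum_cong)
      fix v b
      show "ssum (\<lambda>t r. sg (k [] v [] t r) (mm (f v # g t # r))) b = sg (k [] v [] b []) (f v \<cdot> g b)"
        by (subst ssum_only_end) (auto simp: mm_def)
    qed
    finally show ?thesis .
  qed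
  have "br mm f g as = ssum (\<lambda>v t. sg ((len t + 1) * len v) (f v \<cdot> g t)) as"
    unfolding brace2_def by (subst 1) simp
  also have "\<dots> = ssum (\<lambda>v t. sg (p * (q + 1)) (f v \<cdot> g t)) as"
  proof (intro ssum_cong sg_parity_nonzero)
    fix v t assume "f v \<cdot> g t \<noteq> 0"
    then have "f v \<noteq> 0" "g t \<noteq> 0" by auto
    then have "len v = p" "len t = q" using assms unfolding homog_def by blast+
    then show "even ((len t + 1) * len v) = even (p * (q + 1))" by auto
  qed
  also have "\<dots> = sg (p * (q + 1)) (conv f g) as"
    by (simp add: conv_def sg_ssum)
  finally show "br mm f g as = sg (p * (q + 1)) (conv f g) as" .
qed

lemma br3_mm: "brace3 k mm f g h = 0"
proof
  fix as
  have "brace3 k mm f g h as = ssum (\<lambda>u a. ssum (\<lambda>v b. ssum (\<lambda>w c. ssum (\<lambda>t dd. ssum (\<lambda>w' ee. ssum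
      (\<lambda>t' r. 0) ee) dd) c) b) a) as"
    unfolding brace3_def by (intro ssum_cong) (simp add: mm_append_long)
  then show "brace3 k mm f g h as = 0 as" by simp
qed

lemma homog_add: "homog n f \<Longrightarrow> homog n g \<Longrightarrow> homog n (f + g)"
  unfolding homog_def by (metis add_0 plus_fun_apply)

lemma homog_sg: "homog n f \<Longrightarrow> homog n (sg k f)"
  unfolding homog_def by (auto simp: sg_def split: if_splits)

lemma homog_d:
  assumes "multiadd f" "homog n f"
  shows "homog (n + 1) (d n f)"
  unfolding d_def
  using homog_circ[OF multiadd_mm homog_mm assms(2)] homog_circ[OF assms homog_mm]
  by (intro homog_add homog_sg) (simp_all add: algebra_simps)

lemma d_br_mm:
  assumes "multiadd f" "homog p f" "multiadd g" "homog q g"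
  shows "d (p + q) (br mm f g) = - br mm (d p f) g + sg p (br mm f (d q g))"
proof -
  note h = multiadd_mm homog_mm assms
  note hh = homog_circ[OF multiadd_mm homog_mm assms(2)] homog_circ[OF assms(1,2) homog_mm]
     homog_circ[OF multiadd_mm homog_mm assms(4)] homog_circ[OF assms(3,4) homog_mm]
  \<comment> \<open>This is the expansion of \<open>br (circ mm mm) f g\<close>, which vanishes by
    associativity.\<close>
  have 0: "br mm (circ mm f) g + circ mm (br mm f g) + sg ((2 + 1) * (p + 1)) (br mm f (circ mm g)) = 0"
  proof
    fix as
    show "(br mm (circ mm f) g + circ mm (br mm f g) + sg ((2 + 1) * (p + 1)) (br mm f (circ mm g)))
        as = 0 as"
      using brace2_circ_left[OF h(1,2), of f g as]
      unfolding brace2_homog[OF h(1,4) hh(3), of "\<lambda>a b. (2 + 1) * (a + 1)"]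
      by (simp add: circ_mm_mm br3_mm br_0_1)
  qed
  have 1: "circ (br mm f g) mm = br mm f (circ g mm) + sg ((2 + 1) * (q + 1)) (br mm (circ f mm) g)"
  proof
    fix as
    show "circ (br mm f g) mm as = (br mm f (circ g mm) + sg ((2 + 1) * (q + 1)) (br mm (circ f mm) g)) as"
      using circ_brace2[OF h(1,3,2), of g as]
      unfolding brace2_homog[OF h(1) hh(2) h(6), of "\<lambda>a b. (2 + 1) * (b + 1)"]
      by (simp add: br3_mm)
  qed
  have eq: "br mm (f1 + f2) g = br mm f1 g + br mm f2 g" if "homog (p + 1) f1" "homog (p + 1) f2" for f1 f2
    using that assms(4) by (simp add: br_mm[of "p + 1" _ q] homog_add conv_add1 sg_add)
  have eq2: "br mm f (g1 + g2) = br mm f g1 + br mm f g2" if "homog (q + 1) g1" "homog (q + 1) g2" for g1 g2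
    using that assms(2) by (simp add: br_mm[of p _ "q + 1"] homog_add conv_add2 sg_add)
  have a: "br mm (d p f) g = br mm (circ mm f) g + sg p (br mm (circ f mm) g)"
    unfolding d_def using hh by (subst eq) (simp_all add: homog_sg br_sg1 algebra_simps br_sg2 h)
  have b: "br mm f (d q g) = br mm f (circ mm g) + sg q (br mm f (circ g mm))"
    unfolding d_def using hh by (subst eq2) (simp_all add: homog_sg br_sg3 h algebra_simps)
  have 2: "circ mm (br mm f g) = - br mm (circ mm f) g - sg ((2 + 1) * (p + 1)) (br mm f (circ mm g))"
    using 0 by (simp add: algebra_simps eq_neg_iff_add_eq_0)
  show ?thesis
    unfolding d_def[of "p + q"] a b 1 2
    by (cases "even p"; cases "even q"; simp add: sg_def)
qed

text \<open>On cocycles, \<open>br x y z\<close> is the homotopy that makes insertion into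
  \<open>x\<close> a derivation of the cup product. The triple braces with \<open>mm\<close> as one
  entry arise twice and cancel.\<close>

lemma d_br:
  assumes "multiadd x" "multiadd y" "multiadd z" "homog p x" "homog q y" "homog r z"
    and "d p x = 0" "d q y = 0" "d r z = 0"
  shows "br mm (circ x y) z + sg ((p + 1) * (q + 1)) (br mm y (circ x z)) + sg p (circ x (br mm y z))
     = - d (p + q + r - 2) (br x y z)"
proof -
  note h = multiadd_mm homog_mm
  note a = assms(1-6)
  have hm: "homog (n + 1) (circ mm f)" if "homog n f" for n f
    using homog_circ[OF multiadd_mm homog_mm that] by (simp add: algebra_simps)
  have hm2: "homog (n + 1) (circ f mm)" if "multiadd f" "homog n f" for n f
    using homog_circ[OF that homog_mm] by (simp add: add.commute)
  \<comment> \<open>On cocycles \<open>mm\<close> can be moved from the outside of \<open>f\<close>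
    to the inside.\<close>
  have cz: "circ mm f = sg (n + 1) (circ f mm)" if "d n f = 0" for n f
    using that unfolding d_def by (simp add: eq_neg_iff_add_eq_0 sg_def split: if_splits)
  have 1: "br (circ mm x) y z = br mm (circ x y) z + circ mm (br x y z)
      + sg ((p + 1) * (q + 1)) (br mm y (circ x z))"
  proof
    fix as
    show "br (circ mm x) y z as = (br mm (circ x y) z + circ mm (br x y z)
      + sg ((p + 1) * (q + 1)) (br mm y (circ x z))) as"
      using brace2_circ_left[OF h(1) a(4), of y z as]
      unfolding brace2_homog[OF h(1) a(5) homog_circ[OF a(1,4,6)], of "\<lambda>a b. (p + 1) * (a + 1)"]
      by (simp add: br3_mm)
  qed
  have 2: "br (circ x mm) y z = br3 x mm y z + br x (circ mm y) z + circ x (br mm y z)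
     + sg (3 * (q + 1)) (br3 x y mm z) + sg (3 * (q + 1)) (br x y (circ mm z)) + sg (3 * (q + r)) (br3
         x y z mm)"
  proof
    fix as
    show "br (circ x mm) y z as = (br3 x mm y z + br x (circ mm y) z + circ x (br mm y z)
     + sg (3 * (q + 1)) (br3 x y mm z) + sg (3 * (q + 1)) (br x y (circ mm z)) + sg (3 * (q + r)) (br3
         x y z mm)) as"
      using brace2_circ_left[OF a(1) h(2), of y z as]
      unfolding brace2_homog[OF a(1,5) hm[OF a(6)], of "\<lambda>a b. (2 + 1) * (a + 1)"]
        brace3_homog[OF a(1,5) h(2) a(6), of "\<lambda>a b c. (a + 1) * (b + 1)"]
        brace3_homog[OF a(1,5,6) h(2), of "\<lambda>a b c. (c + 1) * (a + b)"]
      by (simp add: add.assoc mult.commute)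
  qed
  have 3: "circ (br x y z) mm = br3 x y z mm + br x y (circ z mm) + sg (3 * (r + 1)) (br3 x y mm z)
      + sg (3 * (r + 1)) (br x (circ y mm) z) + sg (3 * (q + r)) (br3 x mm y z)"
  proof
    fix as
    show "circ (br x y z) mm as = (br3 x y z mm + br x y (circ z mm) + sg (3 * (r + 1)) (br3 x y mm z)
      + sg (3 * (r + 1)) (br x (circ y mm) z) + sg (3 * (q + r)) (br3 x mm y z)) as"
      using circ_brace2[OF a(1,2) h(2), of z as]
      unfolding brace2_homog[OF a(1) hm2[OF a(2,5)] a(6), of "\<lambda>a b. (2 + 1) * (b + 1)"]
        brace3_homog[OF a(1,5) h(2) a(6), of "\<lambda>a b c. (b + 1) * (c + 1)"]
        brace3_homog[OF a(1) h(2) a(5,6), of "\<lambda>a b c. (a + 1) * (b + c)"]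
      by simp
  qed
  have 4: "circ mm (br x y z) = sg (p + 1) (br (circ x mm) y z) - br mm (circ x y) z
      - sg ((p + 1) * (q + 1)) (br mm y (circ x z))"
    using 1 by (simp add: cz[OF assms(7)] br_sg1 algebra_simps)
  show ?thesis
    unfolding d_def 3 4 2 cz[OF assms(8)] cz[OF assms(9)] br_sg2[OF a(1)] br_sg3[OF a(1)]
    by (cases "even p"; cases "even q"; cases "even r"; simp add: sg_def algebra_simps)
qed

text \<open>Inserting \<open>x\<close> into a product hits one of the two factors, and this holds
  without a homotopy: the value of \<open>x\<close> cannot lie outside both blocks, since
  \<open>mm\<close> has no third slot.\<close>

lemma circ_conv:
  assumes "multiadd x" "multiadd y" "multiadd z" "homog p x" "homog q y" "homog r z"
  shows "circ (br mm y z) x = br mm y (circ z x) + sg ((p + 1) * (r + 1)) (br mm (circ y x) z)"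
proof
  fix as
  show "circ (br mm y z) x as = (br mm y (circ z x) + sg ((p + 1) * (r + 1)) (br mm (circ y x) z)) as"
    using circ_brace2[OF multiadd_mm assms(2,4), of z as]
    unfolding brace2_homog[OF multiadd_mm homog_circ[OF assms(2,5,4)] assms(6), of "\<lambda>a b. (p + 1) * (b
        + 1)"]
    by (simp add: br3_mm)
qed

lemma cup_br: "homog p f \<Longrightarrow> homog q g \<Longrightarrow> cup p q f g = sg p (br mm f g)"
  by (simp add: cup_def br_mm sg_sg) (rule sg_parity, simp, argo)

text \<open>The part of the bracket that inserts \<open>x\<close> obeys the rule strictly by
  \<open>circ_conv\<close>; the part that inserts into \<open>x\<close> obeys it up to the boundary
  from \<open>d_br\<close>.\<close>

lemma poisson:
  assumes "multiadd x" "multiadd y" "multiadd z" "homog p x" "homog q y" "homog r z"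
    and "d p x = 0" "d q y = 0" "d r z = 0"
  shows "bracket p (q + r) x (cup q r y z) - cup (p + q - 1) r (bracket p q x y) z
     - sg ((p - 1) * q) (cup q (p + r - 1) y (bracket p r x z))
   = sg (p + q + 1) (d (p + q + r - 2) (br x y z))"
proof -
  note a = assms(1-6)
  have hb: "homog (m + n - 1) (bracket m n f g)" if "multiadd f" "multiadd g" "homog m f" "homog n g"
      for m n f g
  proof -
    have "bracket m n f g = circ f g + sg ((m + 1) * (n + 1) + 1) (circ g f)"
      by (simp add: bracket_def sg_def)
    then show ?thesis
      using homog_circ[OF that(1,3,4)] homog_circ[OF that(2,4,3)]
      by (simp add: homog_add homog_sg add.commute)
  qed
  have "d (p + q + r - 2) (br x y z) = - (br mm (circ x y) z + sg ((p + 1) * (q + 1)) (br mm y (circ x z))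
     + sg p (circ x (br mm y z)))"
    by (simp only: d_br[OF assms] minus_minus)
  then have D: "d (p + q + r - 2) (br x y z) = - br mm (circ x y) z - sg ((p + 1) * (q + 1)) (br mm y
      (circ x z))
     - sg p (circ x (br mm y z))"
    by simp
  have 1: "cup q r y z = sg q (br mm y z)" by (rule cup_br) (rule a)+
  have cup_lin: "cup k l (f - sg n g) h = cup k l f h - sg n (cup k l g h)"
    "cup k l h (f - sg n g) = cup k l h f - sg n (cup k l h g)" for k l n f g h
    using conv_add1[of "f - sg n g" "sg n g" h] conv_add2[of h "f - sg n g" "sg n g"]
    by (simp_all add: cup_def sg_add conv_sg1 conv_sg2 sg_sg add.commute)
  have 2: "cup (p + q - 1) r (bracket p q x y) z
      = sg (p + q - 1) (br mm (circ x y) z - sg ((p + 1) * (q + 1)) (br mm (circ y x) z))"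
    using homog_circ[OF a(1,4,5)] homog_circ[OF a(2,5,4)]
    by (simp add: bracket_def cup_lin cup_br[of "p + q - 1" _ r] a add.commute[of q p] sg_diff sg_sg
        add.commute)
  have 3: "cup q (p + r - 1) y (bracket p r x z)
      = sg q (br mm y (circ x z) - sg ((p + 1) * (r + 1)) (br mm y (circ z x)))"
    using homog_circ[OF a(1,4,6)] homog_circ[OF a(3,6,4)]
    by (simp add: bracket_def cup_lin cup_br[of q _ "p + r - 1"] a add.commute[of r p] sg_diff sg_sg
        add.commute)
  show ?thesis
    unfolding 1 2 3 D
    unfolding bracket_def circ_sg1 circ_sg2[OF a(1)] circ_conv[OF a]
    by (cases "even p"; cases "even q"; cases "even r"; simp add: sg_def algebra_simps)
qed

text \<open>Composing \<open>circ f g\<close> with \<open>mm\<close> on both sides leaves the two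
  orders of the product, because the braces \<open>br f mm g\<close> and \<open>br f g mm\<close>
  arise twice and cancel.\<close>

lemma cup_commute:
  assumes "multiadd f" "multiadd g" "homog p f" "homog q g" "d p f = 0" "d q g = 0"
  shows "cup p q f g - sg (p * q) (cup q p g f) = sg (p + 1) (d (p + q - 1) (circ f g))"
proof -
  note h = multiadd_mm homog_mm assms(1-4)
  have cz: "circ mm f = sg (n + 1) (circ f mm)" if "d n f = 0" for n f
    using that unfolding d_def by (simp add: eq_neg_iff_add_eq_0 sg_def split: if_splits)
  have 1: "circ (circ mm f) g = br mm f g + circ mm (circ f g) + sg ((p + 1) * (q + 1)) (br mm g f)"
    by (rule circ_circ_homog[OF h(1,5,6)])
  have 2: "circ (circ f mm) g = br f mm g + circ f (circ mm g) + sg ((2 + 1) * (q + 1)) (br f g mm)"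
    by (rule circ_circ_homog[OF h(3,2,6)])
  have 3: "circ (circ f g) mm = br f g mm + circ f (circ g mm) + sg ((q + 1) * (2 + 1)) (br f mm g)"
    by (rule circ_circ_homog[OF h(3,6,2)])
  have 4: "circ mm (circ f g) = sg (p + 1) (circ (circ f mm) g) - br mm f g - sg ((p + 1) * (q + 1))
      (br mm g f)"
    using 1 by (simp add: cz[OF assms(5)] circ_sg1 algebra_simps)
  show ?thesis
    unfolding d_def 3 4 2 cz[OF assms(6)] circ_sg2[OF h(3)] cup_br[OF h(5,6)] cup_br[OF h(6,5)]
    by (cases "even p"; cases "even q"; simp add: sg_def algebra_simps)
qed

lemma d_cup:
  assumes "multiadd f" "homog p f" "multiadd g" "homog q g"
  shows "d (p + q) (cup p q f g) = cup (p + 1) q (d p f) g + sg p (cup p (q + 1) f (d q g))"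
proof -
  have "d n (sg k f) = sg k (d n f)" for n k f
    by (simp add: d_def circ_sg1 circ_sg2 multiadd_mm sg_add sg_sg add.commute)
  then show ?thesis
    by (simp add: cup_br[OF assms(2,4)] cup_br[OF homog_d[OF assms(1,2)] assms(4)]
        cup_br[OF assms(2) homog_d[OF assms(3,4)]] d_br_mm[OF assms] sg_add sg_sg sg_neg)
      (simp add: sg_def)
qed

lemma d_bracket:
  assumes "multiadd f" "homog p f" "multiadd g" "homog q g"
  shows "d (p + q - 1) (bracket p q f g) = bracket (p + 1) q (d p f) g + sg (p + 1) (bracket p (q + 1)
      f (d q g))"
  using bracket_leibniz[OF multiadd_mm assms(1,3) homog_mm assms(2,4)]
  by (simp add: d_eq_bracket add.commute) (simp add: sg_def)

end

section \<open>Normalized cochains, cocycles and boundaries\<close>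

context nu_alg
begin

text \<open>The normalized Hochschild cochains of the algebra with unit \<open>e\<close>. The fourth
  and the sixth condition make them maps on the image of the projection with values in that
  image.\<close>

definition coch :: "int \<Rightarrow> ('v list \<Rightarrow> 'v) \<Rightarrow> bool" where
  "coch n f \<longleftrightarrow> homog n f \<and> multiadd f
     \<and> (\<forall>u c x w. f (u @ (c *s x) # w) = c *s f (u @ x # w))
     \<and> (\<forall>u x w. f (u @ (e \<cdot> x) # w) = f (u @ x # w))
     \<and> (\<forall>u w. f (u @ e # w) = 0)
     \<and> (\<forall>as. e \<cdot> f as = f as)"

lemma cochD:
  assumes "coch n f"
  shows "homog n f" "multiadd f"
    "f (u @ (c *s x) # w) = c *s f (u @ x # w)"
    "f (u @ (e \<cdot> x) # w) = f (u @ x # w)"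
    "f (u @ e # w) = 0"
    "e \<cdot> f as = f as"
    "f (u @ (x + y) # w) = f (u @ x # w) + f (u @ y # w)"
  using assms unfolding coch_def multiadd_def by blast+

text \<open>The slot rules again, for a slot behind another displayed letter, where the pattern of
  \<open>cochD\<close> does not match syntactically.\<close>

lemma cochD2:
  assumes "coch n f"
  shows "f (u @ b # v @ (c *s x) # w) = c *s f (u @ b # v @ x # w)"
    "f (u @ b # v @ (e \<cdot> x) # w) = f (u @ b # v @ x # w)"
    "f (u @ b # v @ e # w) = 0"
    "f (u @ b # v @ (x + y) # w) = f (u @ b # v @ x # w) + f (u @ b # v @ y # w)"
  using cochD(3,4,5,7)[OF assms, of "u @ b # v"] by simp_all

lemma cochI:
  assumes "homog n f" "multiadd f"
    "\<And>u c x w. f (u @ (c *s x) # w) = c *s f (u @ x # w)"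
    "\<And>u x w. f (u @ (e \<cdot> x) # w) = f (u @ x # w)"
    "\<And>u w. f (u @ e # w) = 0"
    "\<And>as. e \<cdot> f as = f as"
  shows "coch n f"
  using assms unfolding coch_def by blast

definition fscale :: "'k \<Rightarrow> ('v list \<Rightarrow> 'v) \<Rightarrow> 'v list \<Rightarrow> 'v" where
  "fscale c f = (\<lambda>as. c *s f as)"

lemma fscale_apply [simp]: "fscale c f as = c *s f as"
  by (simp add: fscale_def)

lemma coch_0: "coch n 0"
  by (rule cochI) (auto simp: homog_def multiadd_def)

lemma coch_add: "coch n f \<Longrightarrow> coch n g \<Longrightarrow> coch n (f + g)"
  by (rule cochI) (auto simp: homog_add multiadd_add cochD scale_right_distrib mul_add_right)

lemma coch_sg: "coch n f \<Longrightarrow> coch n (sg k f)"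
  by (rule cochI) (auto simp: homog_sg multiadd_sgf cochD scale_sg mul_sg_right)

lemma coch_uminus: "coch n f \<Longrightarrow> coch n (- f)"
  using coch_sg[of n f 1] by (simp add: sg_def)

lemma coch_diff: "coch n f \<Longrightarrow> coch n g \<Longrightarrow> coch n (f - g)"
  using coch_add[of n f "- g"] coch_uminus[of n g] by simp

lemma coch_fscale: "coch n f \<Longrightarrow> coch n (fscale c f)"
  by (rule cochI)
    (use cochD(1) in \<open>auto simp: homog_def multiadd_def cochD scale_right_distrib mul_scale_right
        mult.commute\<close>)

lemma coch_circ:
  assumes "coch p x" "coch q y"
  shows "coch (p + q - 1) (circ x y)"
proof (rule cochI)
  note h = cochD[OF assms(1)] cochD[OF assms(2)] cochD2[OF assms(1)]
  show "homog (p + q - 1) (circ x y)" by (rule homog_circ) (rule h)+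
  show "multiadd (circ x y)" by (rule multiadd_circ) (rule h)+
  show "circ x y (u @ (c *s a) # w) = c *s circ x y (u @ a # w)" for u c a w
    by (simp add: circ_def ssum_mid h scale_right_distrib scale_ssum scale_sg)
  show "circ x y (u @ (e \<cdot> a) # w) = circ x y (u @ a # w)" for u a w
    by (simp add: circ_def ssum_mid h)
  show "circ x y (u @ e # w) = 0" for u w
    by (simp add: circ_def ssum_mid h multiadd_0)
  show "e \<cdot> circ x y as = circ x y as" for as
    by (simp add: circ_def mul_ssum_right mul_sg_right h)
qed

lemma mul_e_cancel: "e \<cdot> c = c \<Longrightarrow> c \<cdot> (e \<cdot> x) = c \<cdot> x" "e \<cdot> c = c \<Longrightarrow> (e \<cdot> x) \<cdot> c = x \<cdot> c"
  by (metis e_central mul_assoc)+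

lemma coch_conv:
  assumes "coch p x" "coch q y"
  shows "coch (p + q) (conv x y)"
proof (rule cochI)
  note h = cochD[OF assms(1)] cochD[OF assms(2)]
  show "homog (p + q) (conv x y)"
    unfolding homog_def
  proof (intro allI impI, rule ccontr)
    fix as assume *: "conv x y as \<noteq> 0" "len as \<noteq> p + q"
    have "x u \<cdot> y w = 0" if "u @ w = as" for u w
    proof (rule ccontr)
      assume "x u \<cdot> y w \<noteq> 0"
      then have "x u \<noteq> 0" "y w \<noteq> 0" by auto
      then have "len u = p" "len w = q" using h(1,8) unfolding homog_def by blast+
      with that * show False by auto
    qed
    then have "conv x y as = ssum (\<lambda>u w. 0) as"
      unfolding conv_def by (rule ssum_cong)
    with * show False by simp
  qed
  show "multiadd (conv x y)"
    unfolding multiadd_def by (simp add: conv_def ssum_mid h mul_add_left mul_add_right ssum_add add_ac)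
  show "conv x y (u @ (c *s a) # w) = c *s conv x y (u @ a # w)" for u c a w
    by (simp add: conv_def ssum_mid h scale_right_distrib scale_ssum mul_scale_left mul_scale_right)
  show "conv x y (u @ (e \<cdot> a) # w) = conv x y (u @ a # w)" for u a w
    by (simp add: conv_def ssum_mid h)
  show "conv x y (u @ e # w) = 0" for u w
    by (simp add: conv_def ssum_mid h)
  show "e \<cdot> conv x y as = conv x y as" for as
    by (simp add: conv_def mul_ssum_right h mul_assoc[symmetric])
qed

lemma mm_scale: "mm (u @ (c *s x) # w) = c *s mm (u @ x # w)"
  by (rule mm_cases[of u w]) (auto simp: mul_scale_left mul_scale_right mm_append_long)

lemma mm_scale2: "mm (u @ b # v @ (c *s x) # w) = c *s mm (u @ b # v @ x # w)"
  using mm_scale[of "u @ b # v"] by simp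

lemma mm_e: "mm (v @ (e \<cdot> x) # w) = e \<cdot> mm (v @ x # w)"
  by (rule mm_cases[of v w]) (auto simp: mul_assoc mm_append_long, metis e_central mul_assoc)

lemma mm_proj:
  assumes "e \<cdot> c = c"
  shows "mm (u @ (e \<cdot> x) # v @ c # w) = mm (u @ x # v @ c # w)"
    "mm (u @ c # v @ (e \<cdot> x) # w) = mm (u @ c # v @ x # w)"
  by (cases "u = [] \<and> v = [] \<and> w = []"; auto simp: mm_def mul_e_cancel[OF assms])+

text \<open>Inside \<open>f\<close> the letter \<open>e\<close> gives zero, so it survives only as
  the outer factor, that is as first or as last letter.\<close>

lemma circ_mm_e:
  assumes "coch n f"
  shows "circ mm f (u @ e # w) = (if w = [] then f u else 0) + (if u = [] then sg (len w + 1) (f w) else 0)"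
proof -
  note h = cochD[OF assms]
  have "circ mm f (u @ e # w) =
     ssum (\<lambda>l y. ssum (\<lambda>v r. sg ((len v + 1) * len l) (mm (l @ f v # r @ e # w))) y) u
     + ssum (\<lambda>x y. ssum (\<lambda>v r. sg ((len v + 1) * (1 + (len u + len x))) (mm (u @ e # x @ f v # r))) y) w"
    by (simp add: circ_def ssum_mid h multiadd_0[OF multiadd_mm])
  also have "ssum (\<lambda>l y. ssum (\<lambda>v r. sg ((len v + 1) * len l) (mm (l @ f v # r @ e # w))) y) u
     = (if w = [] then f u else 0)"
  proof (cases "w = []")
    case True
    have "ssum (\<lambda>l y. ssum (\<lambda>v r. sg ((len v + 1) * len l) (mm (l @ f v # r @ e # w))) y) u
      = ssum (\<lambda>v r. mm (f v # r @ e # w)) u"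
      by (rule trans[OF ssum_only_start]) (auto simp: mm_def sg_def[of 0])
    also have "\<dots> = f u \<cdot> e"
      by (rule trans[OF ssum_only_end]) (auto simp: mm_def True)
    finally show ?thesis using True h by (simp add: e_central)
  next
    case False
    have "ssum (\<lambda>l y. ssum (\<lambda>v r. sg ((len v + 1) * len l) (mm (l @ f v # r @ e # w))) y) u
      = ssum (\<lambda>l y. ssum (\<lambda>v r. 0) y) u"
      using False by (intro ssum_cong) (auto simp: mm_def)
    then show ?thesis using False by simp
  qed
  also have "ssum (\<lambda>x y. ssum (\<lambda>v r. sg ((len v + 1) * (1 + (len u + len x))) (mm (u @ e # x @ f v #
      r))) y) w
     = (if u = [] then sg (len w + 1) (f w) else 0)"
  proof (cases "u = []")
    case True
    have "ssum (\<lambda>x y. ssum (\<lambda>v r. sg ((len v + 1) * (1 + (len u + len x))) (mm (u @ e # x @ f v # r))) y) w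
      = ssum (\<lambda>v r. sg (len v + 1) (mm (e # f v # r))) w"
      by (rule trans[OF ssum_only_start]) (auto simp: mm_def True)
    also have "\<dots> = sg (len w + 1) (e \<cdot> f w)"
      by (rule trans[OF ssum_only_end]) (auto simp: mm_def)
    finally show ?thesis using True h by simp
  next
    case False
    have "ssum (\<lambda>x y. ssum (\<lambda>v r. sg ((len v + 1) * (1 + (len u + len x))) (mm (u @ e # x @ f v # r))) y) w
      = ssum (\<lambda>l y. ssum (\<lambda>v r. 0) y) w"
      using False by (intro ssum_cong) (auto simp: mm_def)
    then show ?thesis using False by simp
  qed
  finally show ?thesis .
qed

text \<open>The unit is absorbed by its left or by its right neighbour. Both contributions are
  \<open>f (u @ w)\<close> with opposite signs, so they cancel except at the ends of the
  list.\<close>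

lemma circ_e_mm:
  assumes "coch n f"
  shows "circ f mm (u @ e # w) = (if u = [] then 0 else sg (len u + 1) (f (u @ w)))
    + (if w = [] then 0 else sg (len u) (f (u @ w)))"
proof -
  note h = cochD[OF assms]
  have right: "ssum (\<lambda>s t. sg ((len s + 2) * len u) (f (u @ mm (e # s) # t))) w
      = (if w = [] then 0 else sg (len u) (f (u @ w)))" for u
  proof (cases w)
    case (Cons b w')
    have "ssum (\<lambda>s t. sg ((len s + 2) * len u) (f (u @ mm (e # s) # t))) w
       = ssum (\<lambda>s t. sg ((len s + 3) * len u) (f (u @ mm (e # b # s) # t))) w'"
      by (simp add: Cons ssum_simps multiadd_0 h add_ac)
    also have "\<dots> = sg (3 * len u) (f (u @ (e \<cdot> b) # w'))"
      by (rule trans[OF ssum_only_start]) (auto simp: mm_def h multiadd_0)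
    finally show ?thesis using Cons h by simp (rule sg_parity, simp)
  qed (simp add: ssum_simps multiadd_0 h)
  have "circ f mm (u @ e # w) =
    ssum (\<lambda>x y. ssum (\<lambda>s t. sg ((len y + len s + 2) * len x) (f (x @ mm (y @ e # s) # t))) w) u"
    by (simp add: circ_def ssum_mid h cochD2[OF assms] add_ac)
  also have "\<dots> = (if u = [] then 0 else sg (len u + 1) (f (u @ w)))
    + (if w = [] then 0 else sg (len u) (f (u @ w)))"
  proof (cases u rule: rev_cases)
    case Nil
    then show ?thesis using right[of "[]"] by (simp add: ssum_simps)
  next
    case (snoc u' a)
    let ?F = "\<lambda>x y. ssum (\<lambda>s t. sg ((len y + len s + 2) * len x) (f (x @ mm (y @ e # s) # t))) w"
    have "ssum ?F (u' @ a # []) = ssum (\<lambda>x y. ?F x (y @ [a])) u' + ?F u []"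
      by (subst ssum_mid) (simp add: ssum_simps snoc)
    also have "ssum (\<lambda>x y. ?F x (y @ [a])) u' = ?F u' [a]"
      by (rule trans[OF ssum_only_end]) (auto simp: mm_def h multiadd_0)
    also have "?F u' [a] = sg (3 * len u') (f (u' @ (a \<cdot> e) # w))"
      by (rule trans[OF ssum_only_start]) (auto simp: mm_def h multiadd_0)
    also have "\<dots> = sg (len u + 1) (f (u @ w))"
      by (simp add: e_central h snoc) (rule sg_parity, simp)
    finally show ?thesis using right[of u] by (simp add: snoc)
  qed
  finally show ?thesis .
qed

text \<open>As \<open>mm\<close> is not normalized, \<open>coch_circ\<close> does not apply. At the
  unit the outer terms of \<open>circ_mm_e\<close> cancel the end terms left over in
  \<open>circ_e_mm\<close>, or each other if the list is \<open>[e]\<close>.\<close>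

lemma coch_d:
  assumes "coch n f"
  shows "coch (n + 1) (d n f)"
proof (rule cochI)
  note h = cochD[OF assms] cochD2[OF assms]
  show "homog (n + 1) (d n f)" by (rule homog_d) (rule h)+
  show "multiadd (d n f)"
    unfolding d_def by (intro multiadd_add multiadd_sgf multiadd_circ multiadd_mm h)
  show "d n f (u @ (c *s a) # w) = c *s d n f (u @ a # w)" for u c a w
    by (simp add: d_def circ_def ssum_mid h scale_right_distrib scale_ssum scale_sg mm_scale mm_scale2)
  show "d n f (u @ (e \<cdot> a) # w) = d n f (u @ a # w)" for u a w
    by (simp add: d_def circ_def ssum_mid h mm_proj) (simp add: mm_e h)
  show "d n f (u @ e # w) = 0" for u w
  proof -
    have "len u + len w = n" if "f (u @ w) \<noteq> 0"
      using that h(1) unfolding homog_def by (metis length_append of_nat_add)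
    then show ?thesis
      unfolding d_def using circ_mm_e[OF assms, of u w] circ_e_mm[OF assms, of u w]
      by (cases "f (u @ w) = 0"; cases "u = []"; cases "w = []"; simp add: sg_def)
  qed
  show "e \<cdot> d n f as = d n f as" for as
  proof -
    have "e \<cdot> mm (u @ f v # w) = mm (u @ f v # w)" for u v w
      by (metis mm_e h(6))
    then show ?thesis
      by (simp add: d_def circ_def mul_ssum_right mul_sg_right mul_add_right h)
  qed
qed

definition Z :: "int \<Rightarrow> ('v list \<Rightarrow> 'v) \<Rightarrow> bool" where
  "Z n f \<longleftrightarrow> coch n f \<and> d n f = 0"

text \<open>Cochains of degree -1 are zero, so in degree 0 this leaves only the zero
  cochain.\<close>

definition Bd :: "int \<Rightarrow> ('v list \<Rightarrow> 'v) \<Rightarrow> bool" where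
  "Bd n f \<longleftrightarrow> (\<exists>g. coch (n - 1) g \<and> f = d (n - 1) g)"

lemma d_add: "coch n f \<Longrightarrow> coch n g \<Longrightarrow> d n (f + g) = d n f + d n g"
  by (simp add: d_def circ_add1 circ_add2 multiadd_mm sg_add)

lemma d_sg: "d n (sg k f) = sg k (d n f)"
  by (simp add: d_def circ_sg1 circ_sg2 multiadd_mm sg_add sg_sg add.commute)

lemma d_0: "d n 0 = 0"
  by (simp add: d_def circ_0_2 multiadd_mm)

lemma d_fscale: "d n (fscale c f) = fscale c (d n f)"
  by (rule ext) (simp add: d_def circ_def mm_scale scale_right_distrib scale_ssum scale_sg)

lemma Z_add: "Z n f \<Longrightarrow> Z n g \<Longrightarrow> Z n (f + g)"
  and Z_sg: "Z n f \<Longrightarrow> Z n (sg k f)"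
  and Z_0: "Z n 0"
  and Z_fscale: "Z n f \<Longrightarrow> Z n (fscale c f)"
proof -
  show "Z n f \<Longrightarrow> Z n g \<Longrightarrow> Z n (f + g)" by (simp add: Z_def coch_add d_add)
  show "Z n f \<Longrightarrow> Z n (sg k f)" by (simp add: Z_def coch_sg d_sg)
  show "Z n 0" by (simp add: Z_def coch_0 d_0)
  show "Z n f \<Longrightarrow> Z n (fscale c f)" by (simp add: Z_def coch_fscale d_fscale) (simp add: fscale_def
      fun_eq_iff)
qed

lemma Bd_add: "Bd n f \<Longrightarrow> Bd n g \<Longrightarrow> Bd n (f + g)"
  unfolding Bd_def by (metis coch_add d_add)

lemma Bd_sg: "Bd n f \<Longrightarrow> Bd n (sg k f)"
  unfolding Bd_def by (metis coch_sg d_sg)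

lemma Bd_uminus: "Bd n f \<Longrightarrow> Bd n (- f)"
  using Bd_sg[of n f 1] by (simp add: sg_def)

lemma Bd_diff: "Bd n f \<Longrightarrow> Bd n g \<Longrightarrow> Bd n (f - g)"
  using Bd_add[of n f "- g"] Bd_uminus[of n g] by simp

lemma Bd_0: "Bd n 0"
  unfolding Bd_def by (metis coch_0 d_0)

lemma Bd_fscale: "Bd n f \<Longrightarrow> Bd n (fscale c f)"
  unfolding Bd_def by (metis coch_fscale d_fscale)

lemma Bd_Z:
  assumes "Bd n f"
  shows "Z n f"
proof -
  obtain g where g: "coch (n - 1) g" "f = d (n - 1) g" using assms unfolding Bd_def by auto
  then show ?thesis using coch_d[OF g(1)] d_d[OF cochD(2,1)[OF g(1)]] by (simp add: Z_def)
qed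

lemma BdI: "coch m g \<Longrightarrow> f = d m g \<Longrightarrow> n = m + 1 \<Longrightarrow> Bd n f"
  unfolding Bd_def by auto

lemma Z_uminus: "Z n f \<Longrightarrow> Z n (- f)"
  using Z_sg[of n f 1] by (simp add: sg_def)

lemma Z_diff: "Z n f \<Longrightarrow> Z n g \<Longrightarrow> Z n (f - g)"
  using Z_add[of n f "- g"] Z_uminus[of n g] by simp

lemma coch_neg: "n < 0 \<Longrightarrow> coch n f \<Longrightarrow> f = 0"
  by (drule cochD(1)) (force simp: homog_def fun_eq_iff)

lemma coch_cup: "coch p f \<Longrightarrow> coch q g \<Longrightarrow> coch (p + q) (cup p q f g)"
  by (simp add: cup_def coch_conv coch_sg)

lemma coch_bracket: "coch p f \<Longrightarrow> coch q g \<Longrightarrow> coch (p + q - 1) (bracket p q f g)"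
  using coch_circ[of p f q g] coch_circ[of q g p f]
  by (simp add: bracket_def coch_diff coch_sg add.commute)

lemma cup_0 [simp]: "cup p q 0 g = 0" "cup p q f 0 = 0"
  by (simp_all add: cup_def conv_def fun_eq_iff)

lemma bracket_0: "bracket p q 0 g = 0" if "multiadd g" for g
  using that by (simp add: bracket_def circ_0_2)

lemma bracket_0': "bracket p q f 0 = 0" if "multiadd f" for f
  using that by (simp add: bracket_def circ_0_2)

lemma ZD:
  assumes "Z n f"
  shows "coch n f" "d n f = 0" "multiadd f" "homog n f"
  using assms cochD(1,2) unfolding Z_def by blast+

lemma Z_cup:
  assumes "Z p f" "Z q g"
  shows "Z (p + q) (cup p q f g)"
  using ZD[OF assms(1)] ZD[OF assms(2)] by (simp add: Z_def coch_cup d_cup)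

lemma Z_bracket:
  assumes "Z p f" "Z q g"
  shows "Z (p + q - 1) (bracket p q f g)"
  using ZD[OF assms(1)] ZD[OF assms(2)]
  by (simp add: Z_def coch_bracket d_bracket bracket_0 bracket_0')

lemma Bd_cup_left: "Bd p f \<Longrightarrow> Z q g \<Longrightarrow> Bd (p + q) (cup p q f g)"
proof -
  assume "Bd p f" and g: "Z q g"
  then obtain h where h: "coch (p - 1) h" "f = d (p - 1) h" unfolding Bd_def by auto
  then have "d (p - 1 + q) (cup (p - 1) q h g) = cup p q f g"
    using d_cup[of h "p - 1" g q] ZD[OF g] cochD(1,2)[OF h(1)] by simp
  then show ?thesis by (intro BdI[OF coch_cup[OF h(1) ZD(1)[OF g]]]) auto
qed

lemma Bd_cup_right: "Z p f \<Longrightarrow> Bd q g \<Longrightarrow> Bd (p + q) (cup p q f g)"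
proof -
  assume f: "Z p f" and "Bd q g"
  then obtain h where h: "coch (q - 1) h" "g = d (q - 1) h" unfolding Bd_def by auto
  then have "d (p + (q - 1)) (cup p (q - 1) f h) = sg p (cup p q f g)"
    using d_cup[of f p h "q - 1"] ZD[OF f] cochD(1,2)[OF h(1)] by simp
  then have "Bd (p + q) (sg p (cup p q f g))"
    by (intro BdI[OF coch_cup[OF ZD(1)[OF f] h(1)]]) auto
  from Bd_sg[OF this, of p] show ?thesis by (simp add: sg_sg) (simp add: sg_def)
qed

lemma Bd_bracket_left: "Bd p f \<Longrightarrow> Z q g \<Longrightarrow> Bd (p + q - 1) (bracket p q f g)"
proof -
  assume "Bd p f" and g: "Z q g"
  then obtain h where h: "coch (p - 1) h" "f = d (p - 1) h" unfolding Bd_def by auto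
  then have "d (p - 1 + q - 1) (bracket (p - 1) q h g) = bracket p q f g"
    using d_bracket[of h "p - 1" g q] ZD[OF g] cochD(1,2)[OF h(1)] by (simp add: bracket_0')
  then show ?thesis by (intro BdI[OF coch_bracket[OF h(1) ZD(1)[OF g]]]) auto
qed

lemma Bd_bracket_right: "Z p f \<Longrightarrow> Bd q g \<Longrightarrow> Bd (p + q - 1) (bracket p q f g)"
proof -
  assume f: "Z p f" and g: "Bd q g"
  have "bracket p q f g = sg ((p + 1) * (q + 1) + 1) (bracket q p g f)"
    by (cases "even p"; cases "even q"; simp add: bracket_def sg_def)
  then show ?thesis using Bd_sg[OF Bd_bracket_left[OF g f]] by (simp add: add.commute)
qed

lemma cup_add1: "cup p q (f + f') g = cup p q f g + cup p q f' g"
  and cup_add2: "cup p q h (f + f') = cup p q h f + cup p q h f'"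
  and cup_sg1: "cup p q (sg n f) g = sg n (cup p q f g)"
  and cup_sg2: "cup p q h (sg n f) = sg n (cup p q h f)"
  by (simp_all add: cup_def conv_add1 conv_add2 conv_sg1 conv_sg2 sg_add sg_sg add.commute)

lemma cup_fscale: "cup p q (fscale c f) g = fscale c (cup p q f g)"
  "cup p q f (fscale c g) = fscale c (cup p q f g)"
  by (rule ext, simp add: cup_def conv_def mul_scale_left mul_scale_right scale_ssum scale_sg)+

lemma bracket_add1: "multiadd g \<Longrightarrow> bracket p q (f + f') g = bracket p q f g + bracket p q f' g"
  and bracket_add2: "multiadd g \<Longrightarrow> bracket p q g (f + f') = bracket p q g f + bracket p q g f'"
  by (simp_all add: bracket_def circ_add1 circ_add2 sg_add)

lemma circ_fscale: "circ (fscale c f) g = fscale c (circ f g)"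
  "coch n f \<Longrightarrow> circ f (fscale c g) = fscale c (circ f g)"
  by (rule ext, simp add: circ_def scale_ssum scale_sg cochD)+

lemma bracket_fscale: "coch n g \<Longrightarrow> bracket p q (fscale c f) g = fscale c (bracket p q f g)"
  "coch n f \<Longrightarrow> bracket p q f (fscale c g) = fscale c (bracket p q f g)"
  by (simp_all add: bracket_def circ_fscale) (simp_all add: fun_eq_iff scale_right_diff_distrib scale_sg)

end

section \<open>Frobenius algebras\<close>

text \<open>\<open>lam\<close> is a Frobenius form with Nakayama automorphism \<open>nu\<close> and inverse \<open>mu\<close>.\<close>

locale frob = nu_alg scale mul e
  for scale :: "'k::field \<Rightarrow> 'v::ab_group_add \<Rightarrow> 'v" (infixr \<open>*s\<close> 75)
    and mul :: "'v \<Rightarrow> 'v \<Rightarrow> 'v" (infixl \<open>\<cdot>\<close> 70) and e :: 'v +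
  fixes lam :: "'v \<Rightarrow> 'k" and nu mu :: "'v \<Rightarrow> 'v" and riesz :: "('v \<Rightarrow> 'k) \<Rightarrow> 'v"
  assumes lam_add: "lam (x + y) = lam x + lam y"
    and lam_scale: "lam (c *s x) = c * lam x"
    and lam_e: "lam (e \<cdot> x) = lam x"
    and nu_add: "nu (x + y) = nu x + nu y"
    and nu_scale: "nu (c *s x) = c *s nu x"
    and nu_mul: "nu (x \<cdot> y) = nu x \<cdot> nu y"
    and nu_e: "nu e = e"
    and mu_nu [simp]: "mu (nu x) = x"
    and nu_mu [simp]: "nu (mu x) = x"
    and lam_nu: "lam (x \<cdot> y) = lam (y \<cdot> nu x)"
    and nondegenerate: "\<lbrakk>e \<cdot> x = x; e \<cdot> y = y; \<And>a. lam (a \<cdot> x) = lam (a \<cdot> y)\<rbrakk> \<Longrightarrow> x = y"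
    and riesz: "\<lbrakk>\<And>x y. g (x + y) = g x + g y; \<And>c x. g (c *s x) = c * g x; \<And>x. g (e \<cdot> x) = g x\<rbrakk>
      \<Longrightarrow> e \<cdot> riesz g = riesz g \<and> lam (a \<cdot> riesz g) = g a"
begin

lemma lam_0 [simp]: "lam 0 = 0"
  using lam_scale[of 0 0] by simp

lemma lam_uminus: "lam (- x) = - lam x"
  using lam_add[of x "- x"] by (simp add: eq_neg_iff_add_eq_0 add.commute)

lemma lam_sg: "lam (sg n x) = sg n (lam x)"
  by (simp add: sg_def lam_uminus)

lemma lam_ssum: "lam (ssum F as) = ssum (\<lambda>u w. lam (F u w)) as"
  by (rule additive_ssum) (rule lam_add)

lemma lam_nu_eq: "lam (nu x) = lam x"
  using lam_nu[of x e] lam_e[of "nu x"] lam_e[of x] by (simp add: e_central)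

lemma nu_0 [simp]: "nu 0 = 0"
  using nu_add[of 0 0] by simp

lemma nu_mm: "nu (mm y) = mm (map nu y)"
  by (simp add: mm_def nu_mul)

text \<open>The transpose, under the Frobenius form, of Connes' operator twisted by \<open>nu\<close>.\<close>

definition Del :: "('v list \<Rightarrow> 'v) \<Rightarrow> 'v list \<Rightarrow> 'v" where
  "Del f as = riesz (\<lambda>a. ssum (\<lambda>u w. sg ((len u + 1) * len w) (lam (f (w @ nu a # map nu u)))) as)"

text \<open>On cocycles, \<open>H f g\<close> bounds the difference between \<open>circ f g\<close>, half of the bracket, and
  half of the failure of \<open>Del\<close> to be a derivation of the cup product.\<close>

definition H4 :: "('v list \<Rightarrow> 'v) \<Rightarrow> ('v list \<Rightarrow> 'v) \<Rightarrow> 'v \<Rightarrow> 'v list \<Rightarrow> 'k" where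
  "H4 f g a as = ssum (\<lambda>u b. ssum (\<lambda>w1 c. ssum (\<lambda>v w3.
     sg ((len u + 1) * (len w1 + len v + len w3) + (len v + 1) * len w1)
       (lam (f (w1 @ g v # w3 @ nu a # map nu u)))) c) b) as"

definition H :: "('v list \<Rightarrow> 'v) \<Rightarrow> ('v list \<Rightarrow> 'v) \<Rightarrow> 'v list \<Rightarrow> 'v" where
  "H f g as = riesz (\<lambda>a. H4 f g a as)"

lemma scale_k_ssum: "c * ssum F as = ssum (\<lambda>u w. (c :: 'k) * F u w) as"
  by (rule additive_ssum) (rule distrib_left)

lemma scale_k_sg: "(c :: 'k) * sg n x = sg n (c * x)"
  by (simp add: sg_def)

text \<open>The functional in \<open>a\<close> is linear and factors through the projection, as
  \<open>nu\<close> fixes \<open>e\<close>; so \<open>riesz\<close> represents it. From here on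
  \<open>Del\<close> is used only through its pairing with \<open>lam\<close>.\<close>

lemma Del_props:
  assumes "coch n f"
  shows "e \<cdot> Del f as = Del f as"
    "lam (a \<cdot> Del f as) = ssum (\<lambda>u w. sg ((len u + 1) * len w) (lam (f (w @ nu a # map nu u)))) as"
proof -
  note h = cochD[OF assms]
  let ?g = "\<lambda>a. ssum (\<lambda>u w. sg ((len u + 1) * len w) (lam (f (w @ nu a # map nu u)))) as"
  have "e \<cdot> riesz ?g = riesz ?g \<and> lam (a \<cdot> riesz ?g) = ?g a"
    by (rule riesz)
      (simp_all add: nu_add nu_scale nu_mul nu_e h lam_add lam_scale sg_add ssum_add scale_k_ssum
          scale_k_sg)
  then show "e \<cdot> Del f as = Del f as" "lam (a \<cdot> Del f as) = ?g a"
    unfolding Del_def by auto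
qed

lemma H_props:
  assumes "coch p f" "coch q g"
  shows "e \<cdot> H f g as = H f g as" "lam (a \<cdot> H f g as) = H4 f g a as"
proof -
  note h = cochD[OF assms(1)] cochD2[OF assms(1)]
  let ?g = "\<lambda>a. H4 f g a as"
  have "e \<cdot> riesz ?g = riesz ?g \<and> lam (a \<cdot> riesz ?g) = ?g a"
    by (rule riesz) (simp_all add: H4_def nu_add nu_scale nu_mul nu_e h lam_add lam_scale sg_add
       ssum_add[abs_def] scale_k_ssum scale_k_sg)
  then show "e \<cdot> H f g as = H f g as" "lam (a \<cdot> H f g as) = ?g a"
    unfolding H_def by auto
qed

section \<open>The twisted cyclic homotopy formula\<close>

text \<open>Under \<open>lam\<close> a factor can be carried from one end of a product to the other
  at the cost of \<open>nu\<close>. Hence multiplying a represented element \<open>D\<close> by a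
  letter changes the argument of its functional by a twisted cyclic rotation.\<close>

lemma lam_mm_sandwich:
  assumes "\<And>b. lam (b \<cdot> D) = G (nu b)" "G 0 = 0"
  shows "lam (a \<cdot> mm (l @ D # r)) = G (mm (r @ nu a # map nu l))"
proof (cases rule: mm_cases[of l r])
  case 1
  then show ?thesis using assms(2) by simp
next
  case (2 y)
  then show ?thesis using assms(1)[of "a \<cdot> y"] by (simp add: mul_assoc nu_mul)
next
  case (3 y)
  \<comment> \<open>\<open>mu\<close> compensates the twist that \<open>y\<close> picks up between
    the left and the right end.\<close>
  have "lam (a \<cdot> (D \<cdot> y)) = lam ((mu y \<cdot> a) \<cdot> D)"
    using lam_nu[of "mu y" "a \<cdot> D"] by (simp add: mul_assoc)
  with 3 show ?thesis using assms(1)[of "mu y \<cdot> a"] by (simp add: nu_mul)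
next
  case 4
  then show ?thesis using assms(2) by (simp add: mm_append_long)
qed

definition T :: "('v list \<Rightarrow> 'v) \<Rightarrow> 'v list \<Rightarrow> 'v" where
  "T f as = mu (f (map nu as))"

lemma lam_T: "lam (a \<cdot> T f as) = lam (nu a \<cdot> f (map nu as))"
  using lam_nu_eq[of "a \<cdot> T f as"] by (simp add: T_def nu_mul)

text \<open>Only a single letter leaves \<open>mm\<close> with two arguments. Its placements to the
  left and to the right of the value have the same image under \<open>lam\<close> by
  \<open>lam_nu\<close>, and opposite signs.\<close>

lemma lam_mm_cancel:
  assumes "\<And>z. even (E [z] []) \<noteq> even (E [] [z])" "\<And>z. c [z] [] = c [] [z]"
  shows "ssum (\<lambda>w u. sg (E w u) (lam (mm (u @ c w u # map nu w)))) y = 0"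
proof -
  consider "y = []" | z where "y = [z]" | "length y > 1"
    by (cases y; cases "tl y") auto
  then show ?thesis
  proof cases
    case (2 z)
    have "lam (c [] [z] \<cdot> nu z) = lam (z \<cdot> c [] [z])"
      by (rule lam_nu[symmetric])
    then show ?thesis
      using assms[of z] by (auto simp: 2 ssum_simps sg_def)
  next
    case 3
    have "ssum (\<lambda>w u. sg (E w u) (lam (mm (u @ c w u # map nu w)))) y = ssum (\<lambda>w u. 0) y"
      using 3 by (intro ssum_cong) (auto simp: mm_append_long)
    then show ?thesis by simp
  qed (simp add: ssum_simps)
qed

lemmas ssum_match_split = arg_cong2[where f="(+)"] ssum_cong_split sg_parity_nonzero

text \<open>Both operators give sums over twisted cyclic rotations of the argument list. A product
  formed inside \<open>f\<close> occurs in \<open>d (Del f)\<close> and in \<open>Del (d f)\<close>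
  and drops out; a letter multiplied onto the value of \<open>f\<close> cancels with its rotation.
  What remains has \<open>nu a\<close> as outer factor, giving \<open>f\<close> when it stands on
  the right and \<open>T f\<close> when it stands on the left.\<close>

lemma d_Del:
  assumes "coch n f"
  shows "lam (a \<cdot> d (n - 1) (Del f) as)
     - ssum (\<lambda>u w. sg ((len u + 1) * len w) (lam (d n f (w @ nu a # map nu u)))) as
     = sg (n + 1) (lam (a \<cdot> f as) - lam (a \<cdot> T f as))"
proof -
  note h = cochD[OF assms] cochD2[OF assms]
  note D = Del_props[OF assms]
  note f0 = multiadd_0[OF h(2)]
  have mm_len: "even (length y)" if "lam (f (u @ mm y # w)) \<noteq> 0" for u y w
    using that by (cases "length y = 2") (auto simp: mm_def f0)
  have mm_len3: "even (length y)" if "lam (f (u @ b # v @ mm y # w)) \<noteq> 0" for u b v y w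
    using mm_len[of "u @ b # v"] that by simp
  have mm_len2: "odd (length l + length r)" if "lam (f (u @ mm (r @ x # map nu l) # w)) \<noteq> 0" for u l r x w
    using that by (cases "length l + length r = 1") (auto simp: mm_append_long f0)
  have lf: "even n = even (length as)" if "lam (f as) \<noteq> 0" for as
  proof -
    have "f as \<noteq> 0" using that by auto
    then have "len as = n" using h(1) unfolding homog_def by blast
    then show ?thesis by auto
  qed
  have 1: "lam (a \<cdot> mm (l @ Del f v # r)) =
     ssum (\<lambda>u w. sg ((len u + 1) * len w) (lam (f (w @ mm (r @ nu a # map nu l) # map nu u)))) v" for l v r
    by (rule lam_mm_sandwich) (simp_all add: D f0)
  \<comment> \<open>\<open>?P1\<close> comes from multiplying \<open>Del f\<close> by a letter,
    \<open>?P2\<close> and \<open>?P3\<close> from a product inside the segment that stays in place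
    or inside the one rotated behind \<open>nu a\<close>.\<close>
  let ?P1 = "ssum (\<lambda>l q. ssum (\<lambda>u q. ssum (\<lambda>w r. sg ((len u + len w + 1) * len l + (len u + 1) * len w)
      (lam (f (w @ mm (r @ nu a # map nu l) # map nu u)))) q) q) as"
  let ?P2 = "ssum (\<lambda>s q. ssum (\<lambda>t q. ssum (\<lambda>u w. sg (n - 1 + (len u + 1) * (len s + len t) +
      (len s + 1) * (1 + (len t + len w))) (lam (f (t @ mm u # w @ nu a # map nu s)))) q) q) as"
  let ?P3 = "ssum (\<lambda>s q. ssum (\<lambda>t q. ssum (\<lambda>u w. sg (n - 1 + (len t + 1) * len s +
      (2 + (len s + len u)) * len w) (lam (f (w @ nu a # map nu s @ mm (map nu t) # map nu u)))) q) q) as"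
  have P: "lam (a \<cdot> d (n - 1) (Del f) as) = ?P1 + (?P2 + ?P3)"
    unfolding d_def circ_def
    by (simp add: mul_add_right lam_add mul_ssum_right lam_ssum mul_sg_right lam_sg 1 D nu_mm ssum_norm)
  \<comment> \<open>In \<open>?Q1\<close> to \<open>?Q3\<close> the value of \<open>f\<close> is
    multiplied, with \<open>nu a\<close> to the right of it, among its arguments or to the left of
    it. In \<open>?Q4\<close> to \<open>?Q6\<close> a product is fed into \<open>f\<close> before,
    around or after \<open>nu a\<close>.\<close>
  let ?Q1 = "ssum (\<lambda>u w. ssum (\<lambda>s q. ssum (\<lambda>t r. sg ((len u + 1) * len w + (len t + 1) * len s)
       (lam (mm (s @ f t # r @ nu a # map nu u)))) q) w) as"
  let ?Q2 = "ssum (\<lambda>u q. ssum (\<lambda>w p. ssum (\<lambda>s t. sg ((len u + len w + 1) * len p + (2 + (len t + len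
      u)) * len s)
       (lam (mm (s @ f (t @ nu a # map nu u) # map nu w)))) p) q) as"
  let ?Q3 = "ssum (\<lambda>u q. ssum (\<lambda>s q. ssum (\<lambda>w t. sg ((len u + (len s + len w) + 1) * len t + (len s +
      1) * (1 + (len t + len u)))
       (lam (mm (t @ nu a # map nu u @ f (map nu s) # map nu w)))) q) q) as"
  let ?Q4 = "ssum (\<lambda>u w. ssum (\<lambda>s q. ssum (\<lambda>t r. sg ((len u + 1) * len w + (n + (len t + 1) * len s))
       (lam (f (s @ mm t # r @ nu a # map nu u)))) q) w) as"
  let ?Q5 = "ssum (\<lambda>u q. ssum (\<lambda>w p. ssum (\<lambda>s t. sg ((len u + len w + 1) * len p + (n + (2 + (len t +
      len u)) * len s))
       (lam (f (s @ mm (t @ nu a # map nu u) # map nu w)))) p) q) as"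
  let ?Q6 = "ssum (\<lambda>u q. ssum (\<lambda>s q. ssum (\<lambda>w t. sg ((len u + (len s + len w) + 1) * len t + (n + (len
      s + 1) * (1 + (len t + len u))))
       (lam (f (t @ nu a # map nu u @ mm (map nu s) # map nu w)))) q) q) as"
  have Q: "ssum (\<lambda>u w. sg ((len u + 1) * len w) (lam (d n f (w @ nu a # map nu u)))) as
     = ?Q1 + ?Q2 + ?Q3 + (?Q4 + ?Q5 + ?Q6)"
    unfolding d_def circ_def
    by (simp add: lam_add lam_ssum lam_sg ssum_norm ssum_map)
  have 4: "?Q4 = ?P2"
    apply (intro ssum_match_split)
    apply (drule mm_len)
    apply (simp; argo)
    done
  have 5: "?Q5 = ?P1"
    apply (intro ssum_match_split)
    apply (frule mm_len2, drule lf)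
    apply (simp; argo)
    done
  have 6: "?Q6 = ?P3"
    apply (intro ssum_match_split)
    apply (drule mm_len3)
    apply (simp; argo)
    done
  \<comment> \<open>Once the letters on both sides of the value of \<open>f\<close> are gathered in
    one list \<open>y\<close>, the inner sum is an instance of \<open>lam_mm_cancel\<close>.\<close>
  have 2: "?Q2 = 0"
  proof -
    have "?Q2 = ssum (\<lambda>u q. ssum (\<lambda>w p. ssum (\<lambda>s t. sg ((len u + len w + 1) * (len s + len t) + (len t
        + len u) * len s)
       (lam (mm (s @ f (t @ nu a # map nu u) # map nu w)))) p) q) as"
      by (intro ssum_match_split) simp
    also have "\<dots> = ssum (\<lambda>u q. ssum (\<lambda>y t. ssum (\<lambda>w s. sg ((len u + len w + 1) * (len s + len t) +
        (len t + len u) * len s)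
       (lam (mm (s @ f (t @ nu a # map nu u) # map nu w)))) y) q) as"
      by (simp add: ssum_flattens[abs_def])
    also have "\<dots> = ssum (\<lambda>u q. ssum (\<lambda>y t. 0) q) as"
    proof (intro ssum_cong)
      fix u q y t
      show "ssum (\<lambda>w s. sg ((len u + len w + 1) * (len s + len t) + (len t + len u) * len s)
         (lam (mm (s @ f (t @ nu a # map nu u) # map nu w)))) y = 0"
        by (rule lam_mm_cancel[where E="\<lambda>w s. (len u + len w + 1) * (len s + len t) + (len t + len u)
            * len s"
            and c="\<lambda>w s. f (t @ nu a # map nu u)"]) (simp_all, argo)
    qed
    finally show ?thesis by simp
  qed
  have 1: "?Q1 = sg n (lam (a \<cdot> f as))"
  proof -
    have "?Q1 = ssum (\<lambda>s q. ssum (\<lambda>t r. sg (len as + (len t + 1) * len s) (lam (mm (s @ f t # r @ [nu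
        a])))) q) as"
      by (rule trans[OF ssum_only_start]) (auto simp: mm_append_long)
    also have "\<dots> = ssum (\<lambda>t r. sg (len as) (lam (mm (f t # r @ [nu a])))) as"
      by (rule trans[OF ssum_only_start]) (auto simp: mm_append_long)
    also have "\<dots> = sg (len as) (lam (mm (f as # [nu a])))"
      by (rule trans[OF ssum_only_end]) (auto simp: mm_def)
    also have "\<dots> = sg (len as) (lam (a \<cdot> f as))"
      by (simp add: lam_nu[of a])
    finally show ?thesis using h(1) unfolding homog_def by (cases "f as = 0") auto
  qed
  \<comment> \<open>Here the whole list has been rotated and thus passes through \<open>nu\<close>,
    which is the source of \<open>T\<close>.\<close>
  have 3: "?Q3 = sg (n + 1) (lam (a \<cdot> T f as))"
  proof -
    have "?Q3 = ssum (\<lambda>s q. ssum (\<lambda>w t. sg ((len s + len w + 1) * len t + (len s + 1) * (1 + len t))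
       (lam (mm (t @ nu a # f (map nu s) # map nu w)))) q) as"
      by (rule trans[OF ssum_only_start]) (auto simp: mm_append_long)
    also have "\<dots> = ssum (\<lambda>w t. sg ((len as + len w + 1) * len t + (len as + 1) * (1 + len t))
       (lam (mm (t @ nu a # f (map nu as) # map nu w)))) []"
    proof (rule trans[OF ssum_only_end])
      fix u w :: "'v list" assume "w \<noteq> []"
      then show "ssum (\<lambda>wa t. sg ((len u + len wa + 1) * len t + (len u + 1) * (1 + len t))
         (lam (mm (t @ nu a # f (map nu u) # map nu wa)))) w = 0"
        by (cases w) (simp_all add: mm_append_long ssum_simps mm_def)
    qed simp
    also have "\<dots> = sg (len as + 1) (lam (nu a \<cdot> f (map nu as)))"
      by (simp add: ssum_simps)
    finally show ?thesis
      using h(1) unfolding homog_def lam_T by (cases "f (map nu as) = 0") auto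
  qed
  show ?thesis
    unfolding P Q 1 2 3 4 5 6 by (cases "even n") (simp_all add: sg_def)
qed

end

section \<open>The homotopy between circle product and cyclic sums\<close>

abbreviation "ssum3 F as \<equiv> ssum (\<lambda>a q. ssum (\<lambda>b c. F a b c) q) as"
abbreviation "ssum4 F as \<equiv> ssum (\<lambda>a q. ssum (\<lambda>b q. ssum (\<lambda>c d. F a b c d) q) q) as"
abbreviation "ssum5 F as \<equiv> ssum (\<lambda>a q. ssum (\<lambda>b q. ssum (\<lambda>c q. ssum (\<lambda>d e. F a b c d e) q) q) q) as"
abbreviation "ssum6 F as \<equiv> ssum (\<lambda>a q. ssum (\<lambda>b q. ssum (\<lambda>c q. ssum (\<lambda>d q. ssum (\<lambda>e f. F a b c d e f)
    q) q) q) q) as"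

context frob begin

text \<open>The pattern of \<open>d_Del\<close>, with a value of \<open>g\<close> placed before
  \<open>nu a\<close>. Products of two ordinary letters, or of one such letter with
  \<open>g v\<close> or with \<open>nu a\<close>, arise twice and cancel. Three products survive:
  \<open>g v\<close> with \<open>nu a\<close>, giving \<open>conv (Del f) g\<close>; the value of
  \<open>f\<close> with \<open>nu a\<close>, giving \<open>circ f g\<close>; and \<open>g v\<close>
  with the value of \<open>f\<close>, giving one of the two sums in \<open>Del_cup\<close>.\<close>

lemma H_homotopy:
  assumes "coch p f" "coch q g"
  shows "sg p (lam (a \<cdot> d (p + q - 2) (H f g) as) - H4 (d p f) g a as)
     + H4 f (d q g) a as
     + sg (q + 1) (lam (a \<cdot> circ f g as))
     - ssum3 (\<lambda>u v w. sg ((len u + 1) * (len v + len w)) (lam (g v \<cdot> f (w @ nu a # map nu u)))) as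
     + sg (p * q) (lam (a \<cdot> conv (Del f) g as)) = 0"
proof -
  note h = cochD[OF assms(1)] cochD2[OF assms(1)]
  note f0 = multiadd_0[OF h(2)]
  note g0 = multiadd_0[OF cochD(2)[OF assms(2)]]
  note D = Del_props[OF assms(1)]
  note HP = H_props[OF assms]
  note fs = multiadd_ssum[OF h(2)] multiadd_sg[OF h(2)]
  have f02: "f (u @ b # v @ 0 # w) = 0" for u b v w using f0[of "u @ b # v"] by simp
  have pf: "even p = even (length as)" if "lam (f as) \<noteq> 0" for as
  proof -
    have "f as \<noteq> 0" using that by auto
    then have "len as = p" using h(1) unfolding homog_def by blast
    then show ?thesis by auto
  qed
  have pg: "even q = even (length as)" if "g as \<noteq> 0" for as
    using that cochD(1)[OF assms(2)] unfolding homog_def by force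
  have m1: "even (length y)" if "lam (f (u @ mm y # w)) \<noteq> 0" for u y w
    using that by (cases "length y = 2") (auto simp: mm_def f0)
  have m2: "even (length y)" if "lam (f (u @ b # v @ mm y # w)) \<noteq> 0" for u b v y w
    using m1[of "u @ b # v"] that by simp
  have m3: "even (length y)" if "lam (f (u @ b # v @ c # x @ mm y # w)) \<noteq> 0" for u b v c x y w
    using m2[of u b "v @ c # x"] that by simp
  have g1: "even q = even (length v)" if "lam (f (u @ g v # w)) \<noteq> 0" for u v w
    by (rule pg) (use that in \<open>auto simp: f0\<close>)
  have g2: "even q = even (length v)" if "lam (f (u @ b # y @ g v # w)) \<noteq> 0" for u b y v w
    using g1[of "u @ b # y"] that by simp
  have g3: "even (length y)" if "lam (f (u @ g (v @ mm y # x) # w)) \<noteq> 0" for u v y x w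
    using that by (cases "length y = 2") (auto simp: mm_def f0 g0)
  have g4: "even q = even (length v)" if "lam (f (u @ mm (s @ g v # t) # w)) \<noteq> 0" for u v w s t
    by (rule pg) (use that in \<open>auto simp: f0 multiadd_0[OF multiadd_mm]\<close>)
  have 1: "lam (a \<cdot> mm (l @ H f g v # r)) =
     ssum (\<lambda>u b. ssum (\<lambda>w1 c. ssum (\<lambda>v w3.
     sg ((len u + 1) * (len w1 + len v + len w3) + (len v + 1) * len w1)
       (lam (f (w1 @ g v # w3 @ mm (r @ nu a # map nu l) # map nu u)))) c) b) v" for l v r
    by (rule lam_mm_sandwich) (simp_all add: HP H4_def f02)
  \<comment> \<open>The right factor of \<open>Del f\<close> moves in front of \<open>nu a\<close>,
    into the same slot of \<open>f\<close>.\<close>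
  have 2: "lam (a \<cdot> (Del f x \<cdot> b)) = ssum (\<lambda>u w. sg ((len u + 1) * len w) (lam (f (w @ (b \<cdot> nu a) #
      map nu u)))) x" for x b
    using lam_mm_sandwich[of "Del f x" "\<lambda>c. ssum (\<lambda>u w. sg ((len u + 1) * len w) (lam (f (w @ c # map
        nu u)))) x" a "[]" "[b]"]
    by (simp add: D f0)
  let ?A = "ssum6 (\<lambda>l u w1 v w3 r. sg ((len u + (len w1 + (len v + len w3)) + 1) * len l + ((len u +
      1) * (len w1 + len v + len w3) + (len v + 1) * len w1)) (lam (f (w1 @ g v # w3 @ mm (r @ nu a #
      map nu l) # map nu u)))) as"
  let ?B1 = "ssum6 (\<lambda>u w1 v t y w. sg ((len y + 1) * (len u + (len w1 + (len v + len t))) + ((len u +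
      1) * (len w1 + len v + (1 + (len t + len w))) + (len v + 1) * len w1)) (lam (f (w1 @ g v # t @
      mm y # w @ nu a # map nu u)))) as"
  let ?B2 = "ssum6 (\<lambda>u w1 t y z w. sg ((len y + 1) * (len u + (len w1 + len t)) + ((len u + 1) * (len
      w1 + (1 + (len t + len z)) + len w) + (2 + (len t + len z)) * len w1)) (lam (f (w1 @ g (t @ mm y
      # z) # w @ nu a # map nu u)))) as"
  let ?B3 = "ssum6 (\<lambda>u t y z v w. sg ((len y + 1) * (len u + len t) + ((len u + 1) * (1 + (len t + len
      z) + len v + len w) + (len v + 1) * (1 + (len t + len z)))) (lam (f (t @ mm y # z @ g v # w @ nu
      a # map nu u)))) as"
  let ?B4 = "ssum6 (\<lambda>s y t w1 v w. sg ((len y + 1) * len s + ((2 + (len s + len t)) * (len w1 + len v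
      + len w) + (len v + 1) * len w1)) (lam (f (w1 @ g v # w @ nu a # map nu s @ mm (map nu y) # map
      nu t)))) as"
  let ?C1 = "ssum (\<lambda>u q. ssum (\<lambda>s q. ssum (\<lambda>t q. ssum (\<lambda>v w3. ssum (\<lambda>x w. sg ((len u + 1) * (len s +
      len t + len v + len w3) + (len v + 1) * (len s + len t) + (2 + (len t + len x)) * len s) (lam
      (mm (s @ f (t @ g v # x) # w @ nu a # map nu u)))) w3) q) q) q) as"
  let ?C2 = "ssum6 (\<lambda>s t y z v w. sg ((len s + len t + 1) * (len y + len z + len v + len w) + (len v +
      1) * (len y + len z) + (3 + (len z + (len w + len s))) * len y) (lam (mm (y @ f (z @ g v # w @
      nu a # map nu s) # map nu t)))) as"
  let ?C3 = "ssum (\<lambda>s q. ssum (\<lambda>t q. ssum (\<lambda>y q. ssum (\<lambda>z r2. ssum (\<lambda>u w. sg ((len s + len t + 1) *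
      (len y + len z + len r2) + (len z + 1) * len y + (2 + (len w + len s)) * (1 + (len y + len u)))
      (lam (mm (y @ g z # u @ f (w @ nu a # map nu s) # map nu t)))) r2) q) q) q) as"
  let ?E1 = "ssum6 (\<lambda>u s y t v w. sg ((len u + 1) * (len s + (len y + len t) + len v + len w) + (len v
      + 1) * (len s + (len y + len t)) + (len y + 1) * len s) (lam (f (s @ mm y # t @ g v # w @ nu a #
      map nu u)))) as"
  let ?E2 = "ssum (\<lambda>u q. ssum (\<lambda>s q. ssum (\<lambda>t q. ssum (\<lambda>v w3. ssum (\<lambda>x w. sg ((len u + 1) * (len s +
      len t + len v + len w3) + (len v + 1) * (len s + len t) + (2 + (len t + len x)) * len s) (lam (f
      (s @ mm (t @ g v # x) # w @ nu a # map nu u)))) w3) q) q) q) as"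
  let ?E3 = "ssum6 (\<lambda>s t y z v w. sg ((len s + len t + 1) * (len y + len z + len v + len w) + (len v +
      1) * (len y + len z) + (3 + (len z + (len w + len s))) * len y) (lam (f (y @ mm (z @ g v # w @
      nu a # map nu s) # map nu t)))) as"
  let ?E4 = "ssum (\<lambda>u q. ssum (\<lambda>w1 q. ssum (\<lambda>v w3. ssum (\<lambda>x q. ssum (\<lambda>y w. sg ((len u + 1) * (len w1 +
      len v + len w3) + (len v + 1) * len w1 + (len y + 1) * (1 + (len w1 + len x))) (lam (f (w1 @ g v
      # x @ mm y # w @ nu a # map nu u)))) q) w3) q) q) as"
  let ?E5 = "ssum (\<lambda>s q. ssum (\<lambda>t q. ssum (\<lambda>y q. ssum (\<lambda>z r2. ssum (\<lambda>u w. sg ((len s + len t + 1) *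
      (len y + len z + len r2) + (len z + 1) * len y + (2 + (len w + len s)) * (1 + (len y + len u)))
      (lam (f (y @ g z # u @ mm (w @ nu a # map nu s) # map nu t)))) r2) q) q) q) as"
  let ?E6 = "ssum6 (\<lambda>s y t w1 v w. sg ((len s + (len y + len t) + 1) * (len w1 + len v + len w) + (len
      v + 1) * len w1 + (len y + 1) * (2 + (len w1 + (len w + len s)))) (lam (f (w1 @ g v # w @ nu a #
      map nu s @ mm (map nu y) # map nu t)))) as"
  let ?F = "ssum6 (\<lambda>u w1 s v t w. sg ((len u + 1) * (len w1 + (len s + (len v + len t)) + len w) +
      (len s + (len v + len t) + 1) * len w1 + (len v + 1) * len s) (lam (f (w1 @ mm (s @ g v # t) # w
      @ nu a # map nu u)))) as"
  let ?G = "ssum6 (\<lambda>u w1 s v t w. sg ((len u + 1) * (len w1 + (len s + (len v + len t)) + len w) +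
      (len s + (len v + len t) + 1) * len w1 + (len v + 1) * len s) (lam (f (w1 @ g (s @ mm v # t) # w
      @ nu a # map nu u)))) as"
  let ?S3 = "ssum3 (\<lambda>u w v. sg ((len u + 1) * len w) (lam (f (w @ (g v \<cdot> nu a) # map nu u)))) as"
  let ?S2 = "ssum3 (\<lambda>u v w. sg ((len u + 1) * (len v + len w)) (lam (g v \<cdot> f (w @ nu a # map nu u)))) as"
  have eA: "lam (a \<cdot> circ mm (H f g) as) = ?A"
    unfolding circ_def by (simp add: mul_ssum_right lam_ssum mul_sg_right lam_sg 1 ssum_norm)
  have eB: "lam (a \<cdot> circ (H f g) mm as) = ?B1 + ?B2 + ?B3 + ?B4"
    unfolding circ_def by (simp add: mul_ssum_right lam_ssum mul_sg_right lam_sg HP H4_def nu_mm ssum_norm)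
  have eC: "H4 (circ mm f) g a as = ?C1 + ?C2 + ?C3"
    unfolding circ_def by (simp add: lam_add lam_ssum lam_sg H4_def ssum_norm ssum_map mm_append_long)
  have eE: "H4 (circ f mm) g a as = ?E1 + (?E2 + ?E3) + (?E4 + ?E5 + ?E6)"
    unfolding circ_def by (simp add: lam_add lam_ssum lam_sg H4_def ssum_norm ssum_map)
  have eF: "H4 f (circ mm g) a as = ?F"
    unfolding circ_def by (simp add: lam_ssum lam_sg H4_def ssum_norm ssum_map fs)
  have eG: "H4 f (circ g mm) a as = ?G"
    unfolding circ_def by (simp add: lam_ssum lam_sg H4_def ssum_norm ssum_map fs)
  have eS3: "lam (a \<cdot> conv (Del f) g as) = ?S3"
    unfolding conv_def by (simp add: mul_ssum_right lam_ssum 2 ssum_norm)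
  have 5: "?E5 = sg p ?A"
    by ((simp only: sg_ssum sg_sg)?, intro ssum_match_split, frule g1, frule m2, drule pf, (simp; argo))
  have 4: "?E4 = sg q ?B1"
    by ((simp only: sg_ssum sg_sg)?, intro ssum_match_split, frule g1, frule m2, drule pf, (simp; argo))
  have 3: "?E1 = sg q ?B3"
    by ((simp only: sg_ssum sg_sg)?, intro ssum_match_split, frule g2, frule m1, drule pf, (simp; argo))
  have 6: "?E6 = sg q ?B4"
    by ((simp only: sg_ssum sg_sg)?, intro ssum_match_split, frule g1, frule m3, drule pf, (simp; argo))
  have 7: "?G = sg 1 ?B2"
    by ((simp only: sg_ssum sg_sg)?, intro ssum_match_split, frule g1, frule g3, drule pf, (simp; argo))
  have 8: "?E2 = ?F"
    by ((simp only: sg_ssum sg_sg)?, intro ssum_match_split, frule g4, drule pf, (simp; argo))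
  have g5: "even q = even (length v)" if "lam (f (u @ (g v \<cdot> b) # w)) \<noteq> 0" for u v b w
    by (rule pg) (use that in \<open>auto simp: f0\<close>)
  \<comment> \<open>Both arguments of \<open>mm\<close> are taken by \<open>g v\<close> and
    \<open>nu a\<close>, so the three gaps around them are empty.\<close>
  have 9: "?E3 = sg (p * q) ?S3"
  proof -
    have "?E3 = ssum5 (\<lambda>t y z v w. sg ((len t + 1) * (len y + len z + len v + len w) + (len v + 1) *
        (len y + len z)
       + (3 + (len z + len w)) * len y) (lam (f (y @ mm (z @ g v # w @ [nu a]) # map nu t)))) as"
      by (rule trans[OF ssum_only_start]) (auto simp: mm_append_long f0)
    also have "\<dots> = ssum4 (\<lambda>t y v w. sg ((len t + 1) * (len y + len v + len w) + (len v + 1) * len y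
       + (3 + len w) * len y) (lam (f (y @ mm (g v # w @ [nu a]) # map nu t)))) as"
      by (rule ssum_cong, rule ssum_cong, rule trans[OF ssum_only_start]) (auto simp: mm_append_long f0)
    also have "\<dots> = ssum3 (\<lambda>t y v. sg ((len t + 1) * (len y + len v) + (len v + 1) * len y
       + 3 * len y) (lam (f (y @ (g v \<cdot> nu a) # map nu t)))) as"
      by (rule ssum_cong, rule ssum_cong, rule trans[OF ssum_only_end]) (auto simp: mm_def f0)
    also have "\<dots> = sg (p * q) ?S3"
      by (simp only: sg_ssum sg_sg, intro ssum_match_split, frule g5, drule pf, (simp; argo))
    finally show ?thesis .
  qed
  have 10: "sg p ?C1 = sg (q + 1) (lam (a \<cdot> circ f g as))"
  proof -
    have "?C1 = ssum (\<lambda>s q. ssum (\<lambda>t q. ssum (\<lambda>v w3. ssum (\<lambda>x w. sg ((len s + len t + len v + len w3)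
       + (len v + 1) * (len s + len t) + (2 + (len t + len x)) * len s)
       (lam (mm (s @ f (t @ g v # x) # w @ [nu a])))) w3) q) q) as"
      by (rule trans[OF ssum_only_start]) (auto simp: mm_append_long)
    also have "\<dots> = ssum (\<lambda>t q. ssum (\<lambda>v w3. ssum (\<lambda>x w. sg (len t + len v + len w3
       + (len v + 1) * len t) (lam (mm (f (t @ g v # x) # w @ [nu a])))) w3) q) as"
      by (rule trans[OF ssum_only_start]) (auto simp: mm_append_long)
    also have "\<dots> = ssum (\<lambda>t q. ssum (\<lambda>v x. sg (len t + len v + len x
       + (len v + 1) * len t) (lam (a \<cdot> f (t @ g v # x)))) q) as"
      by (rule ssum_cong, rule ssum_cong, rule trans[OF ssum_only_end]) (auto simp: mm_def lam_nu[of a])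
    finally have C1: "?C1 = ssum (\<lambda>t q. ssum (\<lambda>v x. sg (len t + len v + len x
       + (len v + 1) * len t) (lam (a \<cdot> f (t @ g v # x)))) q) as" .
    have pf': "even p = even (length as)" if "lam (a \<cdot> f as) \<noteq> 0" for as
      using that h(1) unfolding homog_def by (metis even_of_nat lam_0 mul_0_right)
    have g1': "even q = even (length v)" if "lam (a \<cdot> f (u @ g v # w)) \<noteq> 0" for u v w
      by (rule pg) (use that in \<open>auto simp: f0\<close>)
    have S1: "lam (a \<cdot> circ f g as) = ssum (\<lambda>t q. ssum (\<lambda>v x. sg ((len v + 1) * len t) (lam (a \<cdot> f (t
        @ g v # x)))) q) as"
      by (simp add: circ_def mul_ssum_right lam_ssum mul_sg_right lam_sg)
    show ?thesis unfolding C1 S1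
      by (simp only: sg_ssum sg_sg, intro ssum_match_split, frule g1', drule pf', (simp; argo))
  qed
  have 11: "sg p ?C3 = - ?S2"
  proof -
    have "?C3 = ssum (\<lambda>s q. ssum (\<lambda>y q. ssum (\<lambda>z r2. ssum (\<lambda>u w. sg ((len s + 1) * (len y + len z + len r2)
       + (len z + 1) * len y + (2 + (len w + len s)) * (1 + (len y + len u)))
       (lam (mm (y @ g z # u @ [f (w @ nu a # map nu s)])))) r2) q) q) as"
      by (rule ssum_cong, rule trans[OF ssum_only_start]) (auto simp: mm_append_long)
    also have "\<dots> = ssum (\<lambda>s q. ssum (\<lambda>z r2. ssum (\<lambda>u w. sg ((len s + 1) * (len z + len r2)
       + (2 + (len w + len s)) * (1 + len u))
       (lam (mm (g z # u @ [f (w @ nu a # map nu s)])))) r2) q) as"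
      by (rule ssum_cong, rule trans[OF ssum_only_start]) (auto simp: mm_append_long)
    also have "\<dots> = ssum (\<lambda>s q. ssum (\<lambda>z w. sg ((len s + 1) * (len z + len w)
       + (2 + (len w + len s))) (lam (g z \<cdot> f (w @ nu a # map nu s)))) q) as"
      by (rule ssum_cong, rule ssum_cong, rule trans[OF ssum_only_start]) (auto simp: mm_def)
    finally have C3: "?C3 = ssum (\<lambda>s q. ssum (\<lambda>z w. sg ((len s + 1) * (len z + len w)
       + (2 + (len w + len s))) (lam (g z \<cdot> f (w @ nu a # map nu s)))) q) as" .
    have pf': "even p = even (length as)" if "lam (b \<cdot> f as) \<noteq> 0" for as b
      using that h(1) unfolding homog_def by (metis even_of_nat lam_0 mul_0_right)
    have neg: "- ?S2 = sg 1 ?S2" by (simp add: sg_def)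
    show ?thesis unfolding C3 neg
      by (simp only: sg_ssum sg_sg, intro ssum_match_split, drule pf', (simp; argo))
  qed
  \<comment> \<open>With \<open>g v\<close> and \<open>nu a\<close> both among the arguments of
    \<open>f\<close>, the outer letter has two placements that cancel.\<close>
  have 12: "?C2 = 0"
  proof -
    have "?C2 = ssum5 (\<lambda>s x z v w. ssum (\<lambda>t y. sg ((len s + len t + 1) * (len y + len z + len v + len w)
       + (len v + 1) * (len y + len z) + (3 + (len z + (len w + len s))) * len y)
       (lam (mm (y @ f (z @ g v # w @ nu a # map nu s) # map nu t)))) x) as"
      by (simp add: ssum_flattens[abs_def])
    also have "\<dots> = ssum5 (\<lambda>s x z v w. 0) as"
    proof (intro ssum_cong)
      fix s x z v w
      show "ssum (\<lambda>t y. sg ((len s + len t + 1) * (len y + len z + len v + len w)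
       + (len v + 1) * (len y + len z) + (3 + (len z + (len w + len s))) * len y)
       (lam (mm (y @ f (z @ g v # w @ nu a # map nu s) # map nu t)))) x = 0"
        by (rule lam_mm_cancel[where E="\<lambda>t y. (len s + len t + 1) * (len y + len z + len v + len w)
           + (len v + 1) * (len y + len z) + (3 + (len z + (len w + len s))) * len y"
           and c="\<lambda>t y. f (z @ g v # w @ nu a # map nu s)"]) (simp_all, argo?)
    qed
    finally show ?thesis by simp
  qed
  have d1: "lam (a \<cdot> d (p + q - 2) (H f g) as) = ?A + sg (p + q) (?B1 + ?B2 + ?B3 + ?B4)"
    unfolding d_def by (simp add: mul_add_right lam_add mul_sg_right lam_sg eA eB) (simp add: sg_def)
  have H4add: "H4 (f1 + f2) g a as = H4 f1 g a as + H4 f2 g a as" "H4 (sg n f1) g a as = sg n (H4 f1 g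
      a as)" for f1 f2 n
    by (simp_all add: H4_def lam_add lam_sg sg_add ssum_add[abs_def] sg_ssum sg_sg add.commute)
  have H4add2: "H4 f (g1 + g2) a as = H4 f g1 a as + H4 f g2 a as" "H4 f (sg n g1) a as = sg n (H4 f
      g1 a as)" for g1 g2 n
    by (simp_all add: H4_def h fs lam_add lam_sg sg_add ssum_add[abs_def] sg_ssum sg_sg add.commute)
  have d2: "H4 (d p f) g a as = ?C1 + ?C2 + ?C3 + sg p (?E1 + (?E2 + ?E3) + (?E4 + ?E5 + ?E6))"
    unfolding d_def H4add eC eE ..
  have d3: "H4 f (d q g) a as = ?F + sg q ?G"
    unfolding d_def H4add2 eF eG ..
  show ?thesis
    unfolding d1 d2 d3 eS3 3 4 5 6 7 8 9 12 sg_add sg_diff 10[symmetric]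
    using 11 by (cases "even p"; cases "even q"; simp add: sg_def)
qed
end

section \<open>The operators \<open>Del\<close>, \<open>H\<close> and \<open>T\<close> on normalized
  cochains\<close>

context frob begin

lemma lam_eqI:
  assumes "\<And>as. e \<cdot> f as = f as" "\<And>as. e \<cdot> g as = g as"
    "\<And>a as. lam (a \<cdot> f as) = lam (a \<cdot> g as)"
  shows "f = g"
  by (rule ext) (rule nondegenerate, rule assms, rule assms, rule assms)

text \<open>By nondegeneracy each condition on a cochain may be checked after pairing with
  \<open>lam\<close>; operations known only through their functionals are recognised as cochains in
  this way.\<close>

lemma coch_lamI:
  assumes e: "\<And>as. e \<cdot> F as = F as" and G: "\<And>a as. lam (a \<cdot> F as) = G a as"
    and hom: "\<And>a as. len as \<noteq> n \<Longrightarrow> G a as = 0"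
    and add: "\<And>a u x y w. G a (u @ (x + y) # w) = G a (u @ x # w) + G a (u @ y # w)"
    and sc: "\<And>a u c x w. G a (u @ (c *s x) # w) = c * G a (u @ x # w)"
    and pr: "\<And>a u x w. G a (u @ (e \<cdot> x) # w) = G a (u @ x # w)"
    and nm: "\<And>a u w. G a (u @ e # w) = 0"
  shows "coch n F"
proof (rule cochI)
  have z: "F as = 0" if "\<And>a. G a as = 0" for as
    by (rule nondegenerate) (simp_all add: e G that)
  show "homog n F" unfolding homog_def using z hom by blast
  show "multiadd F" unfolding multiadd_def
  proof (intro allI)
    fix u x y w
    show "F (u @ (x + y) # w) = F (u @ x # w) + F (u @ y # w)"
      by (rule nondegenerate) (simp_all add: e G mul_add_right lam_add add)
  qed
  show "F (u @ (c *s x) # w) = c *s F (u @ x # w)" for u c x w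
    by (rule nondegenerate) (simp_all add: e G mul_scale_right lam_scale sc)
  show "F (u @ (e \<cdot> x) # w) = F (u @ x # w)" for u x w
    by (rule nondegenerate) (simp_all add: e G pr)
  show "F (u @ e # w) = 0" for u w by (rule z) (rule nm)
qed (rule e)

lemma coch_Del:
  assumes "coch n f"
  shows "coch (n - 1) (Del f)"
proof (rule coch_lamI[OF Del_props[OF assms]])
  note h = cochD[OF assms] cochD2[OF assms]
  have "f (w @ nu a # map nu u) = 0" if "len (u @ w) \<noteq> n - 1" for u w a
    using h(1) that unfolding homog_def by force
  then show "ssum (\<lambda>u w. sg ((len u + 1) * len w) (lam (f (w @ nu a # map nu u)))) as = 0"
    if "len as \<noteq> n - 1" for a as
    using that by (intro trans[OF ssum_cong[where G="\<lambda>_ _. 0"] ssum_zero]) auto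
qed (simp_all add: ssum_mid cochD[OF assms] cochD2[OF assms] nu_add nu_scale nu_mul nu_e lam_add
    lam_scale sg_add
     ssum_add scale_k_ssum scale_k_sg distrib_left add_ac)

lemma coch_H:
  assumes "coch p f" "coch q g"
  shows "coch (p + q - 2) (H f g)"
proof (rule coch_lamI[OF H_props[OF assms]])
  note h = cochD[OF assms(1)] cochD2[OF assms(1)] cochD[OF assms(2)]
  have f02: "f (u @ b # v @ c # x @ e # w) = 0" "f (u @ b # v @ c # x @ (y + z) # w) = f (u @ b # v @
      c # x @ y # w) + f (u @ b # v @ c # x @ z # w)"
     "f (u @ b # v @ c # x @ (k *s y) # w) = k *s f (u @ b # v @ c # x @ y # w)"
     "f (u @ b # v @ c # x @ (e \<cdot> y) # w) = f (u @ b # v @ c # x @ y # w)" for u b v c x w y z k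
    using cochD2[OF assms(1), of u b "v @ c # x"] by simp_all
  note f0 = multiadd_0[OF h(2)]
  have z: "f (w1 @ g v # w3 @ nu a # map nu u) = 0" if "len (u @ w1 @ v @ w3) \<noteq> p + q - 2" for w1 v w3 a u
  proof (rule ccontr)
    assume *: "f (w1 @ g v # w3 @ nu a # map nu u) \<noteq> 0"
    then have "g v \<noteq> 0" using f0 by metis
    then have "len v = q" using cochD(1)[OF assms(2)] unfolding homog_def by blast
    moreover have "len (w1 @ g v # w3 @ nu a # map nu u) = p" using * h(1) unfolding homog_def by blast
    ultimately show False using that by simp
  qed
  show "H4 f g a as = 0" if "len as \<noteq> p + q - 2" for a as
  proof -
    have "H4 f g a as = ssum4 (\<lambda>_ _ _ _. 0) as"
      unfolding H4_def using z that by (intro ssum_cong_split) simp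
    then show ?thesis by simp
  qed
  show "H4 f g a (u @ e # w) = 0" for a u w
    by (simp add: H4_def ssum_mid h f02 nu_e multiadd_0 ssum_zero[abs_def])
  show "H4 f g a (u @ (c *s x) # w) = c * H4 f g a (u @ x # w)" for a u c x w
    by (simp add: H4_def ssum_mid h f02 nu_scale lam_scale scale_k_ssum scale_k_sg distrib_left)
  show "H4 f g a (u @ (e \<cdot> x) # w) = H4 f g a (u @ x # w)" for a u x w
    by (simp add: H4_def ssum_mid h f02 nu_mul nu_e)
  show "H4 f g a (u @ (x + y) # w) = H4 f g a (u @ x # w) + H4 f g a (u @ y # w)" for a u x y w
    by (simp add: H4_def ssum_mid h f02 nu_add lam_add sg_add ssum_add[abs_def] add_ac)
qed

lemma Del_add: "coch n f \<Longrightarrow> coch n g \<Longrightarrow> Del (f + g) = Del f + Del g"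
  by (rule lam_eqI) (simp_all add: Del_props coch_add mul_add_right lam_add sg_add ssum_add Del_props[of n])

lemma Del_sg: "coch n f \<Longrightarrow> Del (sg k f) = sg k (Del f)"
  by (rule lam_eqI) (simp_all add: Del_props[of n] coch_sg mul_sg_right lam_sg sg_ssum sg_sg add.commute)

lemma Del_fscale: "coch n f \<Longrightarrow> Del (fscale c f) = fscale c (Del f)"
  by (rule lam_eqI) (simp_all add: Del_props[of n] coch_fscale mul_scale_right lam_scale scale_k_ssum
      scale_k_sg)

text \<open>Normalization makes this hold term by term: \<open>lam (Del f as)\<close> is the pairing
  with \<open>a = e\<close>, which puts \<open>nu e = e\<close> into a slot of \<open>f\<close>. So
  \<open>lam\<close> vanishes on all values of \<open>Del f\<close>, and the sum defining
  \<open>Del (Del f)\<close> consists of such values.\<close>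

lemma Del_Del: "coch n f \<Longrightarrow> Del (Del f) = 0"
proof (rule lam_eqI)
  assume f: "coch n f"
  note D = Del_props[OF coch_Del[OF f]]
  show "e \<cdot> Del (Del f) as = Del (Del f) as" for as by (rule D)
  have "lam (Del f as) = lam (e \<cdot> Del f as)" for as by (simp add: lam_e)
  also have "\<dots> as = 0" for as
    unfolding Del_props(2)[OF f] by (simp add: nu_e cochD[OF f])
  finally show "lam (a \<cdot> Del (Del f) as) = lam (a \<cdot> 0 as)" for a as
    by (simp add: D)
qed simp

lemma mu_0 [simp]: "mu 0 = 0"
  by (metis mu_nu nu_0)

lemma mu_add: "mu (x + y) = mu x + mu y"
  by (metis mu_nu nu_mu nu_add)

lemma mu_scale: "mu (c *s x) = c *s mu x"
  by (metis mu_nu nu_mu nu_scale)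

lemma mu_mul: "mu (x \<cdot> y) = mu x \<cdot> mu y"
  by (metis mu_nu nu_mu nu_mul)

lemma mu_e: "mu e = e"
  by (metis mu_nu nu_e)

lemma mu_uminus: "mu (- x) = - mu x"
  using mu_add[of "- x" x] by (simp add: eq_neg_iff_add_eq_0)

lemma mu_sg: "mu (sg n x) = sg n (mu x)"
  by (simp add: sg_def mu_uminus)

lemma mu_ssum: "mu (ssum F as) = ssum (\<lambda>u w. mu (F u w)) as"
  by (rule additive_ssum) (rule mu_add)

lemma coch_T:
  assumes "coch n f"
  shows "coch n (T f)"
proof (rule cochI)
  note h = cochD[OF assms]
  show "homog n (T f)" using h(1) unfolding homog_def T_def by (metis length_map mu_0)
  show "multiadd (T f)" unfolding multiadd_def T_def by (simp add: nu_add h mu_add)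
  show "e \<cdot> T f as = T f as" for as
    unfolding T_def by (metis mu_mul mu_e h(6))
qed (simp_all add: T_def nu_scale nu_mul nu_e cochD[OF assms] mu_scale)

lemma T_add: "T (f + g) = T f + T g"
  and T_fscale: "T (fscale c f) = fscale c (T f)"
  and T_sg: "T (sg k f) = sg k (T f)"
  by (auto simp: T_def mu_add mu_scale mu_sg)

lemma mu_mm: "mu (mm x) = mm (map mu x)"
  by (simp add: mm_def mu_mul)

lemma T_d: "T (d n f) = d n (T f)"
proof -
  have *: "map mu (map nu u) = u" for u by (simp add: comp_def)
  have "T (circ mm f) = circ mm (T f)" "T (circ f mm) = circ (T f) mm"
    by (rule ext, simp add: T_def circ_def ssum_map mu_ssum mu_sg mu_mm nu_mm comp_def)+
  then show ?thesis by (simp add: d_def T_add T_sg)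
qed

lemma T_conv: "T (conv f g) = conv (T f) (T g)"
  by (rule ext) (simp add: T_def conv_def ssum_map mu_ssum mu_mul)

lemma T_cup: "T (cup p q f g) = cup p q (T f) (T g)"
  by (simp add: cup_def T_sg T_conv)

lemma T_diff: "T (f - g) = T f - T g"
  using T_add[of "f - g" g] by (simp add: eq_diff_eq)

text \<open>This formula is used twice: on cocycles it makes \<open>f - T f\<close> a boundary, and
  on invariant cochains it lets \<open>Del\<close> commute with \<open>d\<close>.\<close>

lemma d_Del_eq:
  assumes "coch n f"
  shows "d (n - 1) (Del f) = Del (d n f) + sg (n + 1) (f - T f)"
proof (rule lam_eqI)
  note c = coch_d[OF coch_Del[OF assms]] coch_Del[OF coch_d[OF assms]] coch_T[OF assms]
  from c(2) have c2: "coch n (Del (d n f))" by simp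
  show "e \<cdot> d (n - 1) (Del f) as = d (n - 1) (Del f) as" for as by (rule cochD(6)[OF c(1)])
  show "e \<cdot> (Del (d n f) + sg (n + 1) (f - T f)) as = (Del (d n f) + sg (n + 1) (f - T f)) as" for as
    by (rule cochD(6)[OF coch_add[OF c2 coch_sg[OF coch_diff[OF assms c(3)]]]])
  have lam_diff: "lam (x - y) = lam x - lam y" "a \<cdot> (x - y) = a \<cdot> x - a \<cdot> y" for x y a
    using lam_add[of x "- y"] mul_add_right[of a x "- y"] by (simp_all add: lam_uminus mul_minus_right)
  show "lam (a \<cdot> d (n - 1) (Del f) as) = lam (a \<cdot> (Del (d n f) + sg (n + 1) (f - T f)) as)" for a as
    using d_Del[OF assms, of a as] Del_props(2)[OF coch_d[OF assms], of a as]
    by (simp add: mul_add_right lam_add mul_sg_right lam_sg lam_diff diff_eq_eq add.commute)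
qed

lemma Z_Del: "Z n f \<Longrightarrow> T f = f \<Longrightarrow> Z (n - 1) (Del f)"
proof -
  assume f: "Z n f" "T f = f"
  have "Del 0 = 0" using Del_fscale[OF coch_0, of 0] by (simp add: fscale_def zero_fun_def)
  then have "d (n - 1) (Del f) = 0" using d_Del_eq[OF ZD(1)[OF f(1)]] f ZD(2)[OF f(1)] by simp
  then show "Z (n - 1) (Del f)" using coch_Del[OF ZD(1)[OF f(1)]] by (simp add: Z_def)
qed

text \<open>The cut between the two factors falls before or after \<open>nu a\<close>. In the second
  case the right factor is \<open>g\<close> at letters twisted by \<open>nu\<close>; as
  \<open>g\<close> is invariant this is \<open>nu\<close> of its value, and \<open>lam_nu\<close>
  carries it to the left.\<close>

lemma Del_cup:
  assumes "coch p f" "coch q g" "T g = g"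
  shows "lam (a \<cdot> Del (cup p q f g) as)
    = ssum3 (\<lambda>u v w. sg ((len u + 1) * (len v + len w)) (lam (g v \<cdot> f (w @ nu a # map nu u)))) as
    + sg (p * q) (ssum3 (\<lambda>u v w. sg ((len u + 1) * (len v + len w)) (lam (f v \<cdot> g (w @ nu a # map nu
        u)))) as)"
proof -
  have g: "g (map nu u) = nu (g u)" for u
    using assms(3) unfolding T_def by (metis nu_mu)
  have pf: "even p = even (length as)" if "lam (x \<cdot> f as) \<noteq> 0" for as x
    using that cochD(1)[OF assms(1)] unfolding homog_def by (metis even_of_nat lam_0 mul_0_right)
  have pg: "even q = even (length as)" if "lam (g as \<cdot> x) \<noteq> 0" for as x
    using that cochD(1)[OF assms(2)] unfolding homog_def by (metis even_of_nat lam_0 mul_0_left)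
  have "lam (a \<cdot> Del (cup p q f g) as)
    = sg (p * q) (ssum3 (\<lambda>u v w. sg ((len u + 1) * (len v + len w)) (lam (f v \<cdot> g (w @ nu a # map nu
        u)))) as)
    + sg (p * q) (ssum3 (\<lambda>u v w. sg ((len u + len v + 1) * len w) (lam (f (w @ nu a # map nu u) \<cdot> nu
        (g v)))) as)"
    by (subst Del_props(2)[OF coch_cup[OF assms(1,2)]])
      (simp add: cup_def conv_def ssum_norm lam_sg lam_ssum lam_add ssum_map g,
       intro ssum_match_split; (simp; argo))
  also have "ssum3 (\<lambda>u v w. sg ((len u + len v + 1) * len w) (lam (f (w @ nu a # map nu u) \<cdot> nu (g v)))) as
    = ssum3 (\<lambda>u v w. sg ((len u + len v + 1) * len w) (lam (g v \<cdot> f (w @ nu a # map nu u)))) as"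
    by (simp add: lam_nu[symmetric])
  also have "sg (p * q) \<dots> = ssum3 (\<lambda>u v w. sg ((len u + 1) * (len v + len w)) (lam (g v \<cdot> f (w @ nu a
      # map nu u)))) as"
    by (simp only: sg_ssum sg_sg, intro ssum_match_split, frule pg, drule pf, (simp; argo))
  finally show ?thesis by (simp add: add.commute)
qed

text \<open>The sign adapts \<open>Del\<close> to the sign convention of the Batalin-Vilkovisky
  identity.\<close>

definition BV :: "int \<Rightarrow> ('v list \<Rightarrow> 'v) \<Rightarrow> 'v list \<Rightarrow> 'v" where
  "BV n f = sg n (Del f)"

lemma H_homotopy_cocycles:
  assumes "Z p f" "Z q g"
  shows "ssum3 (\<lambda>u v w. sg ((len u + 1) * (len v + len w)) (lam (g v \<cdot> f (w @ nu a # map nu u)))) as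
    = lam (a \<cdot> (sg p (d (p + q - 2) (H f g)) + sg (q + 1) (circ f g) + sg (p * q) (conv (Del f) g)) as)"
proof -
  have "H4 0 g a as = 0" by (simp add: H4_def ssum_zero[abs_def])
  moreover have "H4 f 0 a as = 0"
    by (simp add: H4_def ssum_zero[abs_def] multiadd_0[OF ZD(3)[OF assms(1)]])
  moreover have "S = A + B + C" if "A + B - S + C = 0" for A B C S :: 'k
  proof -
    have "S = A + B + C - (A + B - S + C)" by simp
    then show ?thesis unfolding that by simp
  qed
  ultimately show ?thesis
    using H_homotopy[OF ZD(1)[OF assms(1)] ZD(1)[OF assms(2)], of a as] ZD(2)[OF assms(1)] ZD(2)[OF
        assms(2)]
    by (simp add: mul_add_right lam_add mul_sg_right lam_sg)
qed

text \<open>\<open>Del_cup\<close> splits \<open>Del\<close> of the product into two cyclic sums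
  that differ by exchanging \<open>f\<close> and \<open>g\<close>.
  \<open>H_homotopy_cocycles\<close> turns them into \<open>circ f g\<close> and
  \<open>circ g f\<close>, together the bracket, plus the two product terms of the identity and
  boundaries.\<close>

lemma bracket_BV:
  assumes f: "Z p f" "T f = f" and g: "Z q g" "T g = g"
  shows "Bd (p + q - 1) (bracket p q f g - sg (p + 1)
    (BV (p + q) (cup p q f g) - cup (p - 1) q (BV p f) g - sg p (cup p (q - 1) f (BV q g))))"
proof -
  note cf = ZD(1)[OF f(1)] and cg = ZD(1)[OF g(1)]
  have cH: "coch (p + q - 1) (d (p + q - 2) (H f g))" "coch (p + q - 1) (d (q + p - 2) (H g f))"
    using coch_d[OF coch_H[OF cf cg]] coch_d[OF coch_H[OF cg cf]] by (simp_all add: algebra_simps)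
  have cC: "coch (p + q - 1) (circ f g)" "coch (p + q - 1) (circ g f)"
    using coch_circ[OF cf cg] coch_circ[OF cg cf] by (simp_all add: add.commute)
  have cD: "coch (p + q - 1) (conv (Del f) g)" "coch (p + q - 1) (conv (Del g) f)"
    using coch_conv[OF coch_Del[OF cf] cg] coch_conv[OF coch_Del[OF cg] cf] by (simp_all add: algebra_simps)
  let ?R = "sg p (d (p + q - 2) (H f g)) + sg (q + 1) (circ f g) + sg (p * q) (conv (Del f) g)
    + sg (p * q) (sg q (d (q + p - 2) (H g f)) + sg (p + 1) (circ g f) + sg (q * p) (conv (Del g) f))"
  have "coch (p + q - 1) ?R"
    by (intro coch_add coch_sg cH cC cD)
  then have e: "e \<cdot> ?R as = ?R as" for as by (rule cochD(6))
  have D: "Del (cup p q f g) = ?R"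
    by (rule lam_eqI, rule Del_props(1)[OF coch_cup[OF cf cg]], rule e)
      (simp only: Del_cup[OF cf cg g(2)] H_homotopy_cocycles[OF f(1) g(1)] H_homotopy_cocycles[OF g(1)
          f(1)],
       simp add: mul_add_right lam_add mul_sg_right lam_sg)
  have ZD': "Z (q - 1) (Del g)" by (rule Z_Del[OF g])
  have c1: "conv (Del f) g = sg ((p + 1) * q) (cup (p - 1) q (Del f) g)"
    by (simp add: cup_def sg_sg) (simp add: sg_def)
  \<comment> \<open>The second sum yields \<open>Del g\<close> to the left of \<open>f\<close>.
    Restoring the order costs one more boundary, available because \<open>Del g\<close> is a cocycle
    for invariant \<open>g\<close>.\<close>
  have comm: "cup (q - 1) p (Del g) f - sg ((q - 1) * p) (cup p (q - 1) f (Del g))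
     = sg (q - 1 + 1) (d (q - 1 + p - 1) (circ (Del g) f))"
    by (rule cup_commute) (use ZD[OF ZD'] ZD[OF f(1)] in auto)
  have c2: "conv (Del g) f = sg ((q + 1) * p) (sg ((q + 1) * p) (cup p (q - 1) f (Del g)) + sg q (d (p
      + q - 2) (circ (Del g) f)))"
  proof -
    have "conv (Del g) f = sg ((q + 1) * p) (cup (q - 1) p (Del g) f)"
      by (simp add: cup_def sg_sg) (simp add: sg_def)
    moreover have "cup (q - 1) p (Del g) f = sg ((q + 1) * p) (cup p (q - 1) f (Del g)) + sg q (d (p +
        q - 2) (circ (Del g) f))"
    proof -
      have 1: "sg ((q - 1) * p) X = sg ((q + 1) * p) X" for X :: "'v list \<Rightarrow> 'v" by (rule sg_parity) simp
      have 2: "q - 1 + p - 1 = p + q - 2" "q - 1 + 1 = q" by simp_all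
      show ?thesis using comm unfolding 1 2 diff_eq_eq by (simp add: add.commute)
    qed
    ultimately show ?thesis by simp
  qed
  have B: "Bd (p + q - 1) (d (p + q - 2) (H f g))" "Bd (p + q - 1) (d (q + p - 2) (H g f))"
    "Bd (p + q - 1) (d (p + q - 2) (circ (Del g) f))"
  proof -
    show "Bd (p + q - 1) (d (p + q - 2) (H f g))" by (rule BdI[OF coch_H[OF cf cg]]) auto
    show "Bd (p + q - 1) (d (q + p - 2) (H g f))" by (rule BdI[OF coch_H[OF cg cf]]) auto
    have "coch (p + q - 2) (circ (Del g) f)"
      using coch_circ[OF coch_Del[OF cg] cf] by (simp add: algebra_simps)
    then show "Bd (p + q - 1) (d (p + q - 2) (circ (Del g) f))" by (rule BdI) auto
  qed
  have "bracket p q f g - sg (p + 1) (BV (p + q) (cup p q f g) - cup (p - 1) q (BV p f) g - sg p (cup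
      p (q - 1) f (BV q g)))
    = sg (p + q) (d (p + q - 2) (H f g)) + sg (p * q) (d (q + p - 2) (H g f)) + sg (p * q + p) (d (p +
        q - 2) (circ (Del g) f))"
    unfolding BV_def D c1 c2 cup_sg1 cup_sg2 bracket_def
    by (cases "even p"; cases "even q"; simp add: sg_def)
  with B show ?thesis by (simp only: Bd_add Bd_sg)
qed

end

section \<open>Projection onto the invariants of a diagonal twist\<close>

locale frob_diag = frob scale mul e lam nu mu riesz
  for scale :: "'k::field \<Rightarrow> 'v::ab_group_add \<Rightarrow> 'v" (infixr \<open>*s\<close> 75)
    and mul :: "'v \<Rightarrow> 'v \<Rightarrow> 'v" (infixl \<open>\<cdot>\<close> 70) and e lam nu mu riesz +
  fixes B :: "'b set" and bv :: "'b \<Rightarrow> 'v" and co :: "'b \<Rightarrow> 'v \<Rightarrow> 'k" and ch :: "'b \<Rightarrow> 'k"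
  assumes finite_B: "finite B"
    and expand: "e \<cdot> x = (\<Sum>i\<in>B. co i x *s bv i)"
    and nu_bv: "i \<in> B \<Longrightarrow> nu (bv i) = ch i *s bv i"
    and co_nu: "i \<in> B \<Longrightarrow> co i (nu x) = ch i * co i x"
    and co_add: "co i (x + y) = co i x + co i y"
    and co_scale: "co i (c *s x) = c * co i x"
    and ch_nz: "i \<in> B \<Longrightarrow> ch i \<noteq> 0"
begin

lemma coch_sum:
  assumes "coch n f" "finite S"
  shows "f (u @ (\<Sum>i\<in>S. F i) # w) = (\<Sum>i\<in>S. f (u @ F i # w))"
  using assms(2)
  by (induction S) (simp_all add: cochD[OF assms(1)] multiadd_0)

text \<open>Arguments are expanded in the basis from left to right; \<open>js\<close> collects the
  basis vectors already chosen.\<close>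

lemma coch_eqI_basis:
  assumes f: "coch n f" and g: "coch n g"
    and eq: "\<And>js j. set js \<subseteq> B \<Longrightarrow> j \<in> B \<Longrightarrow> co j (f (map bv js)) = co j (g (map bv js))"
  shows "f = g"
proof
  fix as
  have "f (map bv js @ as) = g (map bv js @ as)" if "set js \<subseteq> B" for js
    using that
  proof (induction as arbitrary: js)
    case Nil
    have "f (map bv js) = e \<cdot> f (map bv js)" by (simp add: cochD[OF f])
    also have "\<dots> = e \<cdot> g (map bv js)" unfolding expand using eq[OF Nil] by simp
    finally show ?case by (simp add: cochD[OF g])
  next
    case (Cons a as)
    have "F (map bv js @ a # as) = (\<Sum>i\<in>B. co i a *s F (map bv (js @ [i]) @ as))" if F: "coch n F" for F
    proof -
      have "F (map bv js @ a # as) = F (map bv js @ (e \<cdot> a) # as)" by (simp add: cochD[OF F])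
      then show ?thesis unfolding expand coch_sum[OF F finite_B] by (simp add: cochD[OF F])
    qed
    note E = this[OF f] this[OF g]
    show ?case unfolding E
      by (intro sum.cong refl arg_cong2[where f="(*s)"] Cons.IH) (use Cons.prems in auto)
  qed
  from this[of "[]"] show "f as = g as" by simp
qed

text \<open>Eigenvalue of \<open>T\<close> on the elementary cochain that sends the basis tuple
  \<open>js\<close> to \<open>bv j\<close>.\<close>

definition weight :: "'b list \<Rightarrow> 'b \<Rightarrow> 'k" where
  "weight js j = prod_list (map ch js) / ch j"

lemma co_T:
  assumes "coch n f" "set js \<subseteq> B" "j \<in> B"
  shows "co j (T f (map bv js)) = weight js j * co j (f (map bv js))"
proof -
  have "f (map bv us @ map nu (map bv js)) = prod_list (map ch js) *s f (map bv us @ map bv js)"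
    if "set js \<subseteq> B" for us
    using that
  proof (induction js arbitrary: us)
    case (Cons i js)
    have "f (map bv us @ map nu (map bv (i # js))) = ch i *s f (map bv us @ bv i # map nu (map bv js))"
      using Cons.prems by (simp add: nu_bv cochD[OF assms(1)])
    also have "\<dots> = ch i *s f (map bv (us @ [i]) @ map nu (map bv js))" by simp
    also have "\<dots> = ch i *s prod_list (map ch js) *s f (map bv (us @ [i]) @ map bv js)"
      using Cons.prems by (subst Cons.IH) auto
    finally show ?case by simp
  qed simp
  from this[OF assms(2), of "[]"]
  have "f (map nu (map bv js)) = prod_list (map ch js) *s f (map bv js)" by simp
  moreover have "co j (mu x) = co j x / ch j" for x
    using co_nu[OF assms(3), of "mu x"] ch_nz[OF assms(3)] by simp
  ultimately show ?thesis by (simp add: T_def co_scale weight_def)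
qed

text \<open>\<open>kill m\<close> removes the \<open>m\<close>-eigenspace of the twist \<open>T\<close> and fixes its invariants.  As \<open>T\<close> is
  homotopic to the identity on cocycles, so is \<open>kill m\<close>.\<close>

definition kill :: "'k \<Rightarrow> ('v list \<Rightarrow> 'v) \<Rightarrow> 'v list \<Rightarrow> 'v" where
  "kill m f = fscale (1 / (1 - m)) (T f - fscale m f)"

lemma coch_kill: "coch n f \<Longrightarrow> coch n (kill m f)"
  by (simp add: kill_def coch_fscale coch_diff coch_T)

lemma d_diff: "coch n f \<Longrightarrow> coch n g \<Longrightarrow> d n (f - g) = d n f - d n g"
  using d_add[of n "f - g" g] by (simp add: coch_diff)

lemma d_kill: "coch n f \<Longrightarrow> d n (kill m f) = kill m (d n f)"
  by (simp add: kill_def d_fscale d_diff coch_T coch_fscale T_d)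

lemma kill_invariant:
  assumes "m \<noteq> 1" "T f = f"
  shows "kill m f = f"
proof
  fix as
  have "kill m f as = (1 / (1 - m)) *s ((1 - m) *s f as)"
    by (simp only: kill_def assms(2) fscale_apply minus_apply scale_left_diff_distrib scale_one)
  then show "kill m f as = f as" using assms(1) by simp
qed

lemma co_kill:
  assumes "coch n f" "set js \<subseteq> B" "j \<in> B"
  shows "co j (kill m f (map bv js)) = (weight js j - m) / (1 - m) * co j (f (map bv js))"
proof -
  have "co j (x - y) = co j x - co j y" for x y
    using co_add[of j "x - y" y] by simp
  then have "co j (kill m f (map bv js)) = (1 / (1 - m)) * (weight js j * co j (f (map bv js)) - m *
      co j (f (map bv js)))"
    by (simp add: kill_def co_scale co_T[OF assms])
  then show ?thesis by (simp add: algebra_simps diff_divide_distrib)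
qed

text \<open>Finitely many weights occur in degree \<open>n\<close>; let \<open>M\<close> list those
  other than 1. For such a weight the factor \<open>kill m\<close> annihilates the coordinate, and
  on coordinates of weight 1 the twist is the identity.\<close>

lemma exists_invariant_projection:
  "\<exists>M. 1 \<notin> set M \<and> (\<forall>f. coch n f \<longrightarrow> T (foldr kill M f) = foldr kill M f)"
proof -
  let ?S = "(\<lambda>(js, j). weight js j) ` ({js. set js \<subseteq> B \<and> length js = nat n} \<times> B) - {1}"
  have "finite ?S"
    by (intro finite_Diff finite_imageI finite_cartesian_product finite_lists_length_eq finite_B)
  from finite_list[OF this] obtain M where M: "set M = ?S" ..
  have cF: "coch n (foldr kill M f)" if "coch n f" for f M
    using that by (induction M) (simp_all add: coch_kill)
  have z: "co j (foldr kill M f (map bv js)) = 0" if "coch n f" "set js \<subseteq> B" "j \<in> B" "weight js j \<in>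
      set M" for f js j M
    using that(4)
  proof (induction M)
    case (Cons m M)
    have "co j (foldr kill (m # M) f (map bv js)) = (weight js j - m) / (1 - m) * co j (foldr kill M f
        (map bv js))"
      using co_kill[OF cF[OF that(1)] that(2,3), of m M] by simp
    then show ?case using Cons by (cases "weight js j = m") simp_all
  qed simp
  have "T (foldr kill M f) = foldr kill M f" if f: "coch n f" for f
  proof (rule coch_eqI_basis[OF coch_T[OF cF[OF f]] cF[OF f]])
    fix js j assume js: "set js \<subseteq> B" and j: "j \<in> B"
    let ?g = "foldr kill M f"
    have T: "co j (T ?g (map bv js)) = weight js j * co j (?g (map bv js))" by (rule co_T[OF cF[OF f] js j])
    show "co j (T ?g (map bv js)) = co j (?g (map bv js))"
    \<comment> \<open>Lists of the wrong length may have weights outside \<open>M\<close>, but there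
      the cochain vanishes.\<close>
    proof (cases "weight js j = 1 \<or> ?g (map bv js) = 0")
      case True
      have "co j 0 = 0" using co_scale[of j 0 0] by simp
      with True T show ?thesis by (metis mult_1 mult_zero_right)
    next
      case False
      then have "len (map bv js) = n" using cochD(1)[OF cF[OF f]] unfolding homog_def by blast
      then have "(js, j) \<in> {js. set js \<subseteq> B \<and> length js = nat n} \<times> B" using js j by auto
      then have "weight js j \<in> set M" unfolding M using False
        by (intro DiffI image_eqI[where x="(js, j)"]) simp_all
      then show ?thesis using z[OF f js j] T by simp
    qed
  qed
  moreover have "1 \<notin> set M" unfolding M by blast
  ultimately show ?thesis by blast
qed

text \<open>Each factor \<open>kill m\<close> changes a cocycle by a multiple of
  \<open>f - T f\<close>, so the projection onto the invariants stays in the class.\<close>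

lemma invariant_representative:
  assumes "Z n f"
  shows "\<exists>g. Z n g \<and> T g = g \<and> Bd n (f - g)"
proof -
  obtain M where M: "1 \<notin> set M" "\<And>f. coch n f \<Longrightarrow> T (foldr kill M f) = foldr kill M f"
    using exists_invariant_projection by blast
  have "Z n (foldr kill M f) \<and> Bd n (f - foldr kill M f)" using M(1)
  proof (induction M)
    case Nil
    have "f - foldr kill [] f = 0" by (rule ext) simp
    then show ?case using assms Bd_0 by (simp add: zero_fun_def)
  next
    case (Cons m M)
    let ?g = "foldr kill M f"
    have "1 \<notin> set M" using Cons.prems by simp
    then have g: "Z n ?g" "Bd n (f - ?g)" using Cons.IH by blast+
    have "kill m 0 = 0" by (rule ext) (simp add: kill_def T_def)
    then have Zq: "Z n (kill m ?g)" using ZD[OF g(1)] by (simp add: Z_def coch_kill d_kill)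
    have "Del 0 = 0" using Del_fscale[OF coch_0, of 0] by (simp add: fscale_def zero_fun_def)
    \<comment> \<open>For a cocycle only the term with \<open>?g - T ?g\<close> is left in the
      homotopy formula.\<close>
    then have "d (n - 1) (Del ?g) = sg (n + 1) (?g - T ?g)"
      using d_Del_eq[OF ZD(1)[OF g(1)]] ZD(2)[OF g(1)] by simp
    then have "Bd n (sg (n + 1) (?g - T ?g))"
      by (intro BdI[OF coch_Del[OF ZD(1)[OF g(1)]]]) auto
    from Bd_sg[OF this, of "n + 1"] have 1: "Bd n (?g - T ?g)" by (simp add: sg_sg) (simp add: sg_def)
    have m: "m \<noteq> 1" using Cons.prems by auto
    have "?g - kill m ?g = fscale (1 / (1 - m)) (?g - T ?g)"
    proof
      fix as
      have "?g as = (1 / (1 - m)) *s ((1 - m) *s ?g as)" using m by simp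
      then have "?g as = (1 / (1 - m)) *s (?g as - m *s ?g as)" by (simp only: scale_left_diff_distrib
          scale_one)
      then have "?g as - kill m ?g as = (1 / (1 - m)) *s (?g as - m *s ?g as) - (1 / (1 - m)) *s (T ?g
          as - m *s ?g as)"
        by (simp add: kill_def)
      also have "\<dots> = (1 / (1 - m)) *s (?g as - T ?g as)"
        by (simp add: scale_right_diff_distrib[symmetric])
      finally show "(?g - kill m ?g) as = fscale (1 / (1 - m)) (?g - T ?g) as" by simp
    qed
    then have "Bd n (?g - kill m ?g)" using Bd_fscale[OF 1] by simp
    moreover have "f - kill m ?g = (f - ?g) + (?g - kill m ?g)" by simp
    ultimately have "Bd n (f - kill m ?g)" using Bd_add[OF g(2)] by metis
    with Zq show ?case unfolding foldr.simps comp_def by blast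
  qed
  then show ?thesis using M(2)[OF ZD(1)[OF assms]] by blast
qed

text \<open>The projection commutes with \<open>d\<close> and fixes the invariant \<open>f\<close>,
  so it may be applied to any primitive of \<open>f\<close>.\<close>

lemma invariant_coboundary:
  assumes "T f = f" "Bd n f"
  shows "\<exists>g. coch (n - 1) g \<and> T g = g \<and> f = d (n - 1) g"
proof -
  obtain g where g: "coch (n - 1) g" "f = d (n - 1) g" using assms(2) unfolding Bd_def by auto
  obtain M where M: "1 \<notin> set M" "\<And>f. coch (n - 1) f \<Longrightarrow> T (foldr kill M f) = foldr kill M f"
    using exists_invariant_projection by blast
  have "coch (n - 1) (foldr kill M g) \<and> d (n - 1) (foldr kill M g) = f" using M(1)
    by (induction M) (use g assms(1) in \<open>auto simp: coch_kill d_kill kill_invariant\<close>)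
  then show ?thesis using M(2)[OF g(1)] by blast
qed

text \<open>An arbitrary primitive \<open>g\<close> would leave the term \<open>g - T g\<close> of
  the homotopy formula; for an invariant one \<open>Del\<close> and \<open>d\<close> can be
  interchanged.\<close>

lemma Del_Bd:
  assumes "T f = f" "Bd n f"
  shows "Bd (n - 1) (Del f)"
proof -
  obtain g where g: "coch (n - 1) g" "T g = g" "f = d (n - 1) g" using invariant_coboundary[OF assms]
      by blast
  then have "Del f = d (n - 1 - 1) (Del g)" using d_Del_eq[OF g(1)] by simp
  then show ?thesis by (intro BdI[OF coch_Del[OF g(1)]]) auto
qed

end

section \<open>Transfer between cochains on lists and on tuples\<close>

lemma ssum_index: "ssum F as = (\<Sum>i\<le>length as. F (take i as) (drop i as))"
proof (induction as arbitrary: F)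
  case (Cons a as)
  show ?case
    by (simp only: ssum_simps Cons.IH length_Cons sum.atMost_Suc_shift take_0 drop_0 take_Suc_Cons
        drop_Suc_Cons)
qed (simp add: ssum_simps)

lemma ssum_take:
  assumes "\<And>v w. length v \<noteq> m \<Longrightarrow> F v w = 0"
  shows "ssum F as = (if m \<le> length as then F (take m as) (drop m as) else 0)"
proof -
  have "ssum F as = (\<Sum>i\<le>length as. if i = m then F (take m as) (drop m as) else 0)"
    unfolding ssum_index by (rule sum.cong) (auto simp: assms)
  then show ?thesis by simp
qed

lemma circ_index:
  assumes "multiadd f" "homog (int m) g"
  shows "circ f g as = (\<Sum>i\<le>length as. if i + m \<le> length as
     then sg ((int m + 1) * int i) (f (take i as @ g (take m (drop i as)) # drop (i + m) as)) else 0)"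
proof -
  have g: "g v = 0" if "length v \<noteq> m" for v
    using assms(2) that unfolding homog_def by auto
  show ?thesis
    unfolding circ_def
  proof (rule trans[OF ssum_index], rule sum.cong, rule refl)
    fix i assume "i \<in> {..length as}"
    then have i: "i \<le> length as" by simp
    show "ssum (\<lambda>v w. sg ((len v + 1) * len (take i as)) (f (take i as @ g v # w))) (drop i as)
      = (if i + m \<le> length as
         then sg ((int m + 1) * int i) (f (take i as @ g (take m (drop i as)) # drop (i + m) as)) else 0)"
      by (subst ssum_take[where m=m]) (use i in \<open>auto simp: g multiadd_0[OF assms(1)] min_def add.commute\<close>)
  qed
qed

text \<open>In the applications \<open>n\<close> is the degree of \<open>f\<close>. A list of length
  \<open>n + m - 1\<close> leaves exactly \<open>n\<close> places for a block of length
  \<open>m\<close>; the index starts from 1 as in \<open>circ_cochain\<close>.\<close>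

lemma circ_index':
  assumes "multiadd f" "homog (int m) g" "length as + 1 = n + m"
  shows "circ f g as = (\<Sum>i\<in>{1..n}.
     sg ((int m + 1) * (int i - 1)) (f (take (i - 1) as @ g (take m (drop (i - 1) as)) # drop (i - 1 +
         m) as)))"
proof -
  have "circ f g as = (\<Sum>i\<le>length as. if i < n
     then sg ((int m + 1) * int i) (f (take i as @ g (take m (drop i as)) # drop (i + m) as)) else 0)"
    unfolding circ_index[OF assms(1,2)] using assms(3) by (intro sum.cong) auto
  also have "\<dots> = (\<Sum>i\<in>{..<n}. sg ((int m + 1) * int i) (f (take i as @ g (take m (drop i as)) # drop (i
      + m) as)))"
  proof -
    have "{..length as} \<inter> {i. i < n} = {..<n} \<or> (m = 0 \<and> {..length as} \<inter> {i. i < n} = {..<n})"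
      using assms(3) by auto
    then have "{..length as} \<inter> {i. i < n} = {..<n}" by blast
    then show ?thesis by (simp add: sum.If_cases Collect_conv_if)
  qed
  also have "\<dots> = (\<Sum>i\<in>{1..n}.
     sg ((int m + 1) * (int i - 1)) (f (take (i - 1) as @ g (take m (drop (i - 1) as)) # drop (i - 1 +
         m) as)))"
    by (rule sum.reindex_bij_witness[of _ "\<lambda>i. i - 1" Suc]) (auto simp: of_nat_diff)
  finally show ?thesis .
qed

lemma sg_sum: "sg n (sum f S) = (\<Sum>i\<in>S. sg n (f i))"
  by (simp add: sg_def sum_negf)

context nu_alg
begin

text \<open>Next to the value of \<open>g\<close>, \<open>mm\<close> has room for one letter, the
  last or the first of the list.\<close>

lemma circ_mm_ends:
  assumes "vs \<noteq> []"
  shows "circ mm g vs = g (butlast vs) \<cdot> last vs + sg (len vs) (hd vs \<cdot> g (tl vs))"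
proof (cases vs)
  case (Cons a tl)
  have "circ mm g vs = ssum (\<lambda>v w. mm (g v # w)) vs
      + ssum (\<lambda>u b. ssum (\<lambda>v w. sg ((len v + 1) * (1 + len u)) (mm (a # u @ g v # w))) b) tl"
    unfolding circ_def Cons by (subst ssum_simps(2)) (simp add: sg_def[of 0])
  also have "ssum (\<lambda>v w. mm (g v # w)) vs = g (butlast vs) \<cdot> last vs"
  proof (cases vs rule: rev_cases)
    case (snoc us z)
    have "ssum (\<lambda>v w. mm (g v # w)) (us @ z # []) = mm [g us, z]"
      unfolding ssum_mid by (subst ssum_only_end) (auto simp: mm_def ssum_simps)
    then show ?thesis by (simp add: snoc)
  qed (simp add: Cons)
  also have "ssum (\<lambda>u b. ssum (\<lambda>v w. sg ((len v + 1) * (1 + len u)) (mm (a # u @ g v # w))) b) tl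
     = ssum (\<lambda>v w. sg (len v + 1) (mm (a # g v # w))) tl"
    by (rule trans[OF ssum_only_start]) (auto simp: mm_def ssum_zero[abs_def])
  also have "\<dots> = sg (len vs) (a \<cdot> g tl)"
    by (rule trans[OF ssum_only_end]) (auto simp: mm_def Cons add.commute)
  finally show ?thesis by (simp add: Cons)
qed (use assms in simp)

lemma circ_mm_index:
  assumes "multiadd g" "length vs = r + 1"
  shows "circ g mm vs = (\<Sum>i\<in>{1..r}.
     sg (int i + 1) (g (take (i - 1) vs @ [vs ! (i - 1) \<cdot> vs ! i] @ drop (i + 1) vs)))"
proof -
  have hm: "homog (int 2) mm" using homog_mm by simp
  show ?thesis
    unfolding circ_index'[OF assms(1) hm, of vs r, simplified assms(2), simplified]
  proof (rule sum.cong)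
    fix i assume i: "i \<in> {1..r}"
    have "mm (take 2 (drop (i - Suc 0) vs)) = vs ! (i - 1) \<cdot> vs ! i"
    proof -
      obtain j where j: "i = Suc j" "j < r" using i by (cases i) auto
      have "drop j vs = vs ! j # vs ! Suc j # drop (Suc (Suc j)) vs"
        using j assms(2) by (simp add: Cons_nth_drop_Suc)
      then show ?thesis using j by (simp add: numeral_2_eq_2)
    qed
    then show "sg (3 * int i - 3) (g (take (i - Suc 0) vs @ mm (take 2 (drop (i - Suc 0) vs)) # drop
        (Suc i) vs))
      = sg (int i + 1) (g (take (i - 1) vs @ [vs ! (i - 1) \<cdot> vs ! i] @ drop (i + 1) vs))"
      by (simp add: sg_def)
  qed simp
qed

lemma neg_one_power_scale: "(- 1) ^ k *s x = sg (int k) x"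
  by (cases "even k") (simp_all add: sg_def)

lemma neg_one_powi_scale: "(- 1) powi k *s x = sg k x"
  by (cases "even k") (simp_all add: sg_def power_int_minus_left)

end

section \<open>Transfer of cochain operations to an algebra with a carrier set\<close>

text \<open>\<open>phi\<close> embeds \<open>A\<close> as the image of the projection, with
  \<open>psi\<close> as retraction. For the scalar action on \<open>A\<close> only closure is
  assumed; its laws are pulled back along the injective \<open>phi\<close>.\<close>

locale alg_transfer = nu_alg scale mul e + ring A
  for scale :: "'k::field \<Rightarrow> 'v::ab_group_add \<Rightarrow> 'v" (infixr \<open>*s\<close> 75)
    and mul :: "'v \<Rightarrow> 'v \<Rightarrow> 'v" (infixl \<open>\<cdot>\<close> 70) and e :: 'v
    and A :: "('k, 'a) module" (structure) +
  fixes phi :: "'a \<Rightarrow> 'v" and psi :: "'v \<Rightarrow> 'a"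
  assumes smult_closed [simp]: "x \<in> carrier A \<Longrightarrow> c \<odot>\<^bsub>A\<^esub> x \<in> carrier A"
    and psi_closed [simp]: "psi v \<in> carrier A"
    and phi_psi: "phi (psi v) = e \<cdot> v"
    and psi_phi [simp]: "x \<in> carrier A \<Longrightarrow> psi (phi x) = x"
    and phi_add: "\<lbrakk>x \<in> carrier A; y \<in> carrier A\<rbrakk> \<Longrightarrow> phi (x \<oplus>\<^bsub>A\<^esub> y) = phi x + phi y"
    and phi_mult: "\<lbrakk>x \<in> carrier A; y \<in> carrier A\<rbrakk> \<Longrightarrow> phi (x \<otimes>\<^bsub>A\<^esub> y) = phi x \<cdot> phi y"
    and phi_smult: "x \<in> carrier A \<Longrightarrow> phi (c \<odot>\<^bsub>A\<^esub> x) = c *s phi x"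
    and phi_one: "phi \<one>\<^bsub>A\<^esub> = e"
begin

lemma e_phi [simp]: "x \<in> carrier A \<Longrightarrow> e \<cdot> phi x = phi x"
  using phi_psi[of "phi x"] by simp

lemma phi_inj: "x \<in> carrier A \<Longrightarrow> y \<in> carrier A \<Longrightarrow> phi x = phi y \<Longrightarrow> x = y"
  by (metis psi_phi)

lemma phi_zero [simp]: "phi \<zero>\<^bsub>A\<^esub> = 0"
  using phi_add[of "\<zero>\<^bsub>A\<^esub>" "\<zero>\<^bsub>A\<^esub>"] by simp

lemma phi_minus: "x \<in> carrier A \<Longrightarrow> y \<in> carrier A \<Longrightarrow> phi (x \<ominus>\<^bsub>A\<^esub> y) = phi x - phi y"
proof -
  assume x: "x \<in> carrier A" and y: "y \<in> carrier A"
  have "phi (\<ominus>\<^bsub>A\<^esub> y) + phi y = 0" using phi_add[of "\<ominus>\<^bsub>A\<^esub> y" y] y by (simp add: l_neg)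
  then have "phi (\<ominus>\<^bsub>A\<^esub> y) = - phi y" by (rule group_add_class.eq_neg_iff_add_eq_0[THEN iffD2])
  then show ?thesis using x y by (simp add: a_minus_def phi_add)
qed

lemma phi_finsum: "finite S \<Longrightarrow> f \<in> S \<rightarrow> carrier A \<Longrightarrow> phi (finsum A f S) = (\<Sum>i\<in>S. phi (f i))"
  by (induction S rule: finite_induct) (simp_all add: phi_add Pi_def)

lemma psi_add: "psi (x + y) = psi x \<oplus>\<^bsub>A\<^esub> psi y"
  by (rule phi_inj) (simp_all add: phi_add phi_psi mul_add_right)

lemma psi_scale: "psi (c *s x) = c \<odot>\<^bsub>A\<^esub> psi x"
  by (rule phi_inj) (simp_all add: phi_smult phi_psi mul_scale_right)

lemma psi_e: "psi e = \<one>\<^bsub>A\<^esub>"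
  by (metis phi_one psi_phi one_closed)

lemma psi_mul: "psi (x \<cdot> y) = psi x \<otimes>\<^bsub>A\<^esub> psi y"
proof (rule phi_inj)
  have "(e \<cdot> x) \<cdot> (e \<cdot> y) = e \<cdot> (x \<cdot> y)" by (metis mul_assoc e_central e_idem)
  then show "phi (psi (x \<cdot> y)) = phi (psi x \<otimes>\<^bsub>A\<^esub> psi y)" by (simp add: phi_mult phi_psi)
qed simp_all

lemma psi_proj: "psi (e \<cdot> x) = psi x"
  by (metis phi_psi psi_phi psi_closed)

lemma psi_0 [simp]: "psi 0 = \<zero>\<^bsub>A\<^esub>"
  by (metis phi_zero psi_phi zero_closed)

text \<open>\<open>psi\<close> is defined on the whole ambient type, so \<open>up\<close> extends a cochain of \<open>A\<close> along the projection
  onto the image of \<open>phi\<close>.\<close>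

definition up :: "nat \<Rightarrow> ('a list \<Rightarrow> 'a) \<Rightarrow> 'v list \<Rightarrow> 'v" where
  "up r f = (\<lambda>vs. if length vs = r then phi (f (map psi vs)) else 0)"

definition down :: "nat \<Rightarrow> ('v list \<Rightarrow> 'v) \<Rightarrow> 'a list \<Rightarrow> 'a" where
  "down r g = (\<lambda>as\<in>tuples A r. psi (g (map phi as)))"

lemma tuples_psi [simp]: "length vs = r \<Longrightarrow> map psi vs \<in> tuples A r"
  by (auto simp: tuples_def)

lemma cochains_closed: "f \<in> cochains A r \<Longrightarrow> as \<in> tuples A r \<Longrightarrow> f as \<in> carrier A"
  unfolding cochains_def by (auto dest: PiE_mem)

lemma cochains_slot:
  assumes "f \<in> cochains A r" "length u + length w + 1 = r" "set u \<subseteq> carrier A" "set w \<subseteq> carrier A"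
  shows "\<lbrakk>x \<in> carrier A; y \<in> carrier A\<rbrakk> \<Longrightarrow> f (u @ (x \<oplus>\<^bsub>A\<^esub> y) # w) = f (u @ x # w) \<oplus>\<^bsub>A\<^esub> f (u @ y # w)"
    "x \<in> carrier A \<Longrightarrow> f (u @ (c \<odot>\<^bsub>A\<^esub> x) # w) = c \<odot>\<^bsub>A\<^esub> f (u @ x # w)"
    "f (u @ (c \<odot>\<^bsub>A\<^esub> \<one>\<^bsub>A\<^esub>) # w) = \<zero>\<^bsub>A\<^esub>"
proof -
  \<comment> \<open>The unit fills the slot of a sample tuple, to be overwritten by the list
    update.\<close>
  have "u @ \<one>\<^bsub>A\<^esub> # w \<in> tuples A r" "length u < r" using assms by (auto simp: tuples_def)
  then have *: "(\<forall>y\<in>carrier A. \<forall>z\<in>carrier A.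
           f ((u @ \<one>\<^bsub>A\<^esub> # w)[length u := y \<oplus>\<^bsub>A\<^esub> z]) = f ((u @ \<one>\<^bsub>A\<^esub> # w)[length u := y]) \<oplus>\<^bsub>A\<^esub> f ((u @
               \<one>\<^bsub>A\<^esub> # w)[length u := z])) \<and>
        (\<forall>c. \<forall>y\<in>carrier A. f ((u @ \<one>\<^bsub>A\<^esub> # w)[length u := c \<odot>\<^bsub>A\<^esub> y]) = c \<odot>\<^bsub>A\<^esub> f ((u @ \<one>\<^bsub>A\<^esub> # w)[length
            u := y])) \<and>
        (\<forall>c. f ((u @ \<one>\<^bsub>A\<^esub> # w)[length u := c \<odot>\<^bsub>A\<^esub> \<one>\<^bsub>A\<^esub>]) = \<zero>\<^bsub>A\<^esub>)"
    using assms(1) unfolding cochains_def by blast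
  have upd: "(u @ \<one>\<^bsub>A\<^esub> # w)[length u := y] = u @ y # w" for y by simp
  note * = *[unfolded upd]
  show "\<lbrakk>x \<in> carrier A; y \<in> carrier A\<rbrakk> \<Longrightarrow> f (u @ (x \<oplus>\<^bsub>A\<^esub> y) # w) = f (u @ x # w) \<oplus>\<^bsub>A\<^esub> f (u @ y # w)"
    "x \<in> carrier A \<Longrightarrow> f (u @ (c \<odot>\<^bsub>A\<^esub> x) # w) = c \<odot>\<^bsub>A\<^esub> f (u @ x # w)"
    "f (u @ (c \<odot>\<^bsub>A\<^esub> \<one>\<^bsub>A\<^esub>) # w) = \<zero>\<^bsub>A\<^esub>"
    using * by blast+
qed

lemma set_psi: "set (map psi u) \<subseteq> carrier A" by auto

lemma smult_one: "x \<in> carrier A \<Longrightarrow> 1 \<odot>\<^bsub>A\<^esub> x = x"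
  by (rule phi_inj) (simp_all add: phi_smult)

lemma coch_up:
  assumes "f \<in> cochains A r"
  shows "coch (int r) (up r f)"
proof (rule cochI)
  have cl: "length vs = r \<Longrightarrow> f (map psi vs) \<in> carrier A" for vs
    using cochains_closed[OF assms] by simp
  have cl': "f (map psi u @ psi x # map psi w) \<in> carrier A" if "Suc (length u + length w) = r" for u w x
    using cl[of "u @ x # w"] that by simp
  have slot: "f (map psi u @ (x \<oplus>\<^bsub>A\<^esub> y) # map psi w) = f (map psi u @ x # map psi w) \<oplus>\<^bsub>A\<^esub> f (map psi u
      @ y # map psi w)"
    "f (map psi u @ (c \<odot>\<^bsub>A\<^esub> x) # map psi w) = c \<odot>\<^bsub>A\<^esub> f (map psi u @ x # map psi w)"
    "f (map psi u @ \<one>\<^bsub>A\<^esub> # map psi w) = \<zero>\<^bsub>A\<^esub>"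
    if "Suc (length u + length w) = r" "x \<in> carrier A" "y \<in> carrier A" for u w x y c
    using cochains_slot[OF assms _ set_psi[of u] set_psi[of w]] cochains_slot(3)[OF assms _ set_psi[of
        u] set_psi[of w], of 1] that
    by (simp_all add: smult_one)
  show "homog (int r) (up r f)" unfolding homog_def up_def by auto
  show "multiadd (up r f)" unfolding multiadd_def up_def by (simp add: psi_add slot phi_add cl')
  show "up r f (u @ (c *s x) # w) = c *s up r f (u @ x # w)" for u c x w
    unfolding up_def using slot(2)[of u w, OF _ psi_closed psi_closed] by (simp add: psi_scale
        phi_smult cl')
  show "up r f (u @ (e \<cdot> x) # w) = up r f (u @ x # w)" for u x w
    unfolding up_def by (simp add: psi_proj)
  show "up r f (u @ e # w) = 0" for u w
    unfolding up_def using slot(3)[of u w, OF _ one_closed one_closed] by (simp add: psi_e)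
  show "e \<cdot> up r f as = up r f as" for as
    unfolding up_def by (simp add: cl)
qed

lemma down_up: "f \<in> cochains A r \<Longrightarrow> down r (up r f) = f"
proof
  fix as assume f: "f \<in> cochains A r"
  show "down r (up r f) as = f as"
  proof (cases "as \<in> tuples A r")
    case True
    then have as: "length as = r" "\<And>x. x \<in> set as \<Longrightarrow> x \<in> carrier A" unfolding tuples_def by blast+
    have "map psi (map phi as) = as" unfolding map_map by (rule map_idI) (simp add: as(2))
    note this as(1)
    then show ?thesis using cochains_closed[OF f True] True by (simp add: down_def up_def)
  next
    case False
    then have "f as = undefined" using f unfolding cochains_def by (blast dest: PiE_arb)
    then show ?thesis using False by (simp add: down_def)
  qed
qed

lemma coch_map_proj:
  assumes "coch n g"
  shows "g (us @ map (\<lambda>x. e \<cdot> x) vs) = g (us @ vs)"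
proof (induction vs arbitrary: us)
  case (Cons v vs)
  then show ?case using Cons.IH[of "us @ [v]"] by (simp add: cochD[OF assms])
qed simp

lemma up_down:
  assumes "coch (int r) g"
  shows "up r (down r g) = g"
proof
  fix vs
  show "up r (down r g) vs = g vs"
  proof (cases "length vs = r")
    case True
    have "g (map phi (map psi vs)) = g vs"
      using coch_map_proj[OF assms, of "[]" vs] by (simp add: phi_psi comp_def)
    then show ?thesis using True by (simp add: up_def down_def phi_psi cochD[OF assms])
  next
    case False
    then show ?thesis using cochD(1)[OF assms] unfolding homog_def up_def by auto
  qed
qed

lemma cochains_down:
  assumes "coch (int r) g"
  shows "down r g \<in> cochains A r"
  unfolding cochains_def
proof (intro CollectI conjI ballI allI impI)
  show "down r g \<in> tuples A r \<rightarrow>\<^sub>E carrier A" by (auto simp: down_def)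
  fix as i assume as: "as \<in> tuples A r" and i: "i < r"
  have l: "i < length as" using as i by (simp add: tuples_def)
  have upd: "as[i := x] = take i as @ x # drop (Suc i) as" for x by (rule upd_conv_take_nth_drop[OF l])
  have t: "take i as @ x # drop (Suc i) as \<in> tuples A r" if "x \<in> carrier A" for x
    using as l that by (auto simp: tuples_def dest: in_set_takeD in_set_dropD)
  {
    fix x y assume xy: "x \<in> carrier A" "y \<in> carrier A"
    show "down r g (as[i := x \<oplus>\<^bsub>A\<^esub> y]) = down r g (as[i := x]) \<oplus>\<^bsub>A\<^esub> down r g (as[i := y])"
      unfolding upd using xy by (simp add: down_def t phi_add cochD[OF assms] psi_add)
  next
    fix c x assume x: "x \<in> carrier A"
    show "down r g (as[i := c \<odot>\<^bsub>A\<^esub> x]) = c \<odot>\<^bsub>A\<^esub> down r g (as[i := x])"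
      unfolding upd using x by (simp add: down_def t phi_smult cochD[OF assms] psi_scale)
  next
    fix c
    show "down r g (as[i := c \<odot>\<^bsub>A\<^esub> \<one>\<^bsub>A\<^esub>]) = \<zero>\<^bsub>A\<^esub>"
      unfolding upd by (simp add: down_def t phi_smult phi_one cochD[OF assms])
  }
qed

lemma up_add: "f \<in> cochains A r \<Longrightarrow> g \<in> cochains A r \<Longrightarrow> up r (f \<oplus>\<^bsub>cochain_space A r\<^esub> g) = up r f + up r g"
  by (rule ext) (simp add: up_def cochain_space_def phi_add cochains_closed)

lemma up_smult: "f \<in> cochains A r \<Longrightarrow> up r (c \<odot>\<^bsub>cochain_space A r\<^esub> f) = fscale c (up r f)"
  by (rule ext) (simp add: up_def cochain_space_def phi_smult cochains_closed)

lemma up_zero: "up r \<zero>\<^bsub>cochain_space A r\<^esub> = 0"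
  by (rule ext) (simp add: up_def cochain_space_def)

text \<open>The two outer terms are those of \<open>circ_mm_ends\<close> and the inner ones those of
  \<open>circ_mm_index\<close>. The exponents \<open>r + 1 - i\<close> and \<open>r + i + 1\<close>
  have the same parity.\<close>

lemma up_differential:
  assumes "f \<in> cochains A r"
  shows "up (r + 1) (differential A r f) = d (int r) (up r f)"
proof
  fix vs
  note c = coch_up[OF assms]
  note h = cochD[OF c]
  show "up (r + 1) (differential A r f) vs = d (int r) (up r f) vs"
  proof (cases "length vs = r + 1")
    case False
    then have "d (int r) (up r f) vs = 0" using cochD(1)[OF coch_d[OF c]] unfolding homog_def by auto
    then show ?thesis using False by (simp add: up_def)
  next
    case True
    let ?as = "map psi vs"
    have ne: "vs \<noteq> []" using True by auto
    have cl: "f (map psi us) \<in> carrier A" if "length us = r" for us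
      using cochains_closed[OF assms] that by simp
    have F: "f (take (i - 1) ?as @ [?as ! (i - 1) \<otimes>\<^bsub>A\<^esub> ?as ! i] @ drop (i + 1) ?as)
       = f (map psi (take (i - 1) vs @ [vs ! (i - 1) \<cdot> vs ! i] @ drop (i + 1) vs))"
      and L: "length (take (i - 1) vs @ [vs ! (i - 1) \<cdot> vs ! i] @ drop (i + 1) vs) = r" if "i \<in>
          {1..r}" for i
      using that True by (auto simp: take_map drop_map psi_mul)
    have up': "phi (f (map psi us)) = up r f us" if "length us = r" for us
      using that by (simp add: up_def)
    have "phi (differential A r f ?as) =
       (- 1) ^ (r + 1) *s (hd vs \<cdot> up r f (tl vs))
       + (\<Sum>i\<in>{1..r}. (- 1) ^ (r + 1 - i) *s up r f (take (i - 1) vs @ [vs ! (i - 1) \<cdot> vs ! i] @ drop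
           (i + 1) vs))
       + up r f (butlast vs) \<cdot> last vs"
    proof -
      have 1: "hd ?as \<otimes>\<^bsub>A\<^esub> f (tl ?as) \<in> carrier A" "f (butlast ?as) \<otimes>\<^bsub>A\<^esub> last ?as \<in> carrier A"
        using True ne by (simp_all add: map_tl[symmetric] map_butlast[symmetric] hd_map last_map cl)
      have 2: "(\<lambda>i. (- 1) ^ (r + 1 - i) \<odot>\<^bsub>A\<^esub> f (take (i - 1) ?as @ [?as ! (i - 1) \<otimes>\<^bsub>A\<^esub> ?as ! i] @ drop
          (i + 1) ?as))
         \<in> {1..r} \<rightarrow> carrier A"
        using F L cl by (intro Pi_I smult_closed) metis
      \<comment> \<open>\<open>phi (psi v)\<close> is \<open>e\<close> times \<open>v\<close>; the
        additional \<open>e\<close> is absorbed by the value of the cochain.\<close>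
      have e1: "(e \<cdot> x) \<cdot> up r f us = x \<cdot> up r f us" "up r f us \<cdot> (e \<cdot> x) = up r f us \<cdot> x" for x us
        by (metis mul_e_cancel h(6))+
      have 3: "phi (hd ?as \<otimes>\<^bsub>A\<^esub> f (tl ?as)) = hd vs \<cdot> up r f (tl vs)"
        "phi (f (butlast ?as) \<otimes>\<^bsub>A\<^esub> last ?as) = up r f (butlast vs) \<cdot> last vs"
        using True ne by (simp_all add: map_tl[symmetric] map_butlast[symmetric] hd_map last_map cl
            phi_mult phi_psi up' e1)
      have 4: "phi ((- 1) ^ (r + 1 - i) \<odot>\<^bsub>A\<^esub> f (take (i - 1) ?as @ [?as ! (i - 1) \<otimes>\<^bsub>A\<^esub> ?as ! i] @ drop
          (i + 1) ?as))
         = (- 1) ^ (r + 1 - i) *s up r f (take (i - 1) vs @ [vs ! (i - 1) \<cdot> vs ! i] @ drop (i + 1)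
             vs)" if "i \<in> {1..r}" for i
        unfolding F[OF that] by (subst phi_smult) (simp_all only: cl[OF L[OF that]] up'[OF L[OF that]])
      have D: "differential A r f ?as = (- 1) ^ (r + 1) \<odot>\<^bsub>A\<^esub> (hd ?as \<otimes>\<^bsub>A\<^esub> f (tl ?as))
         \<oplus>\<^bsub>A\<^esub> (\<Oplus>\<^bsub>A\<^esub>i\<in>{1..r}. (- 1) ^ (r + 1 - i) \<odot>\<^bsub>A\<^esub>
             f (take (i - 1) ?as @ [?as ! (i - 1) \<otimes>\<^bsub>A\<^esub> ?as ! i] @ drop (i + 1) ?as))
         \<oplus>\<^bsub>A\<^esub> f (butlast ?as) \<otimes>\<^bsub>A\<^esub> last ?as"
        using True by (simp add: differential_def)
      show ?thesis
        unfolding D phi_add[OF a_closed[OF smult_closed[OF 1(1)] finsum_closed[OF 2]] 1(2)]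
            phi_add[OF smult_closed[OF 1(1)] finsum_closed[OF 2]]
            phi_finsum[OF finite_atLeastAtMost 2] phi_smult[OF 1(1)] 3
        using 4 by simp
    qed
    also have "\<dots> = d (int r) (up r f) vs"
      unfolding d_def plus_fun_apply sg_fun circ_mm_ends[OF ne] circ_mm_index[OF h(2) True]
          neg_one_power_scale
      by (simp add: True sg_sum sg_sg, intro sum.cong refl sg_parity) (simp, argo)
    finally show ?thesis using True by (simp add: up_def)
  qed
qed

lemma map_psi_phi:
  assumes "as \<in> tuples A r"
  shows "map psi (map phi as) = as" "length (map phi as) = r"
proof -
  have as: "length as = r" "\<And>x. x \<in> set as \<Longrightarrow> x \<in> carrier A" using assms unfolding tuples_def by blast+
  show "map psi (map phi as) = as" unfolding map_map by (rule map_idI) (simp add: as(2))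
  show "length (map phi as) = r" using as by simp
qed

lemma eq_down:
  assumes "F \<in> tuples A r \<rightarrow>\<^sub>E carrier A"
  shows "F = down r (up r F)"
proof
  fix as
  show "F as = down r (up r F) as"
  proof (cases "as \<in> tuples A r")
    case True
    then show ?thesis
      using PiE_mem[OF assms True] by (simp only: down_def up_def restrict_apply' map_psi_phi if_True
          psi_phi simp_thms)
  next
    case False
    then show ?thesis using PiE_arb[OF assms False] by (simp add: down_def)
  qed
qed

text \<open>Multilinearity of an operation on tuples is read off from its transfer, for which it is
  already established.\<close>

lemma cochain_if_coch_up:
  assumes "F \<in> tuples A r \<rightarrow>\<^sub>E carrier A" "coch (int r) (up r F)"
  shows "F \<in> cochains A r"
  using cochains_down[OF assms(2)] eq_down[OF assms(1)] by simp

lemma tuples_take_drop: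
  assumes "as \<in> tuples A r"
  shows "k \<le> r \<Longrightarrow> take k as \<in> tuples A k" "k \<le> r \<Longrightarrow> drop k as \<in> tuples A (r - k)"
  using assms set_take_subset[of k as] set_drop_subset[of k as] by (auto simp: tuples_def)

lemma up_cup:
  assumes f: "f \<in> cochains A p" and g: "g \<in> cochains A q"
  shows "cup_cochain A p q f g \<in> cochains A (p + q)"
    "up (p + q) (cup_cochain A p q f g) = cup (int p) (int q) (up p f) (up q g)"
proof -
  note c = coch_cup[OF coch_up[OF f] coch_up[OF g]]
  show *: "up (p + q) (cup_cochain A p q f g) = cup (int p) (int q) (up p f) (up q g)"
  proof
    fix vs
    show "up (p + q) (cup_cochain A p q f g) vs = cup (int p) (int q) (up p f) (up q g) vs"
    proof (cases "length vs = p + q")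
      case False
      then have "cup (int p) (int q) (up p f) (up q g) vs = 0"
        using cochD(1)[OF c] unfolding homog_def by auto
      then show ?thesis using False by (simp add: up_def)
    next
      case True
      have cl: "f (map psi (take p vs)) \<in> carrier A" "g (map psi (drop p vs)) \<in> carrier A"
        using True cochains_closed[OF f tuples_psi] cochains_closed[OF g tuples_psi] by simp_all
      have "conv (up p f) (up q g) vs = up p f (take p vs) \<cdot> up q g (drop p vs)"
        unfolding conv_def by (subst ssum_take[where m=p]) (use True in \<open>auto simp: up_def\<close>)
      moreover have "up (p + q) (cup_cochain A p q f g) vs = sg (int (p * q)) (up p f (take p vs) \<cdot> up
          q g (drop p vs))"
        using True cl by (simp add: up_def cup_cochain_def phi_smult phi_mult take_map drop_map
            neg_one_power_scale)
      ultimately show ?thesis by (simp add: cup_def)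
    qed
  qed
  show "cup_cochain A p q f g \<in> cochains A (p + q)"
  proof (rule cochain_if_coch_up)
    show "cup_cochain A p q f g \<in> tuples A (p + q) \<rightarrow>\<^sub>E carrier A"
    proof
      fix as assume "as \<in> tuples A (p + q)"
      then show "cup_cochain A p q f g as \<in> carrier A"
        using cochains_closed[OF f tuples_take_drop(1)[of as "p + q" p]] cochains_closed[OF g, of
            "drop p as"] tuples_take_drop(2)[of as "p + q" p]
        by (simp add: cup_cochain_def)
    qed (simp add: cup_cochain_def)
    show "coch (int (p + q)) (up (p + q) (cup_cochain A p q f g))"
      unfolding * using c by simp
  qed
qed

lemma insert_at_closed:
  assumes f: "f \<in> cochains A n" and g: "g \<in> cochains A m" and as: "as \<in> tuples A (n + m - 1)" and i:
      "i \<in> {1..n}"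
  shows "insert_at i m f g as \<in> carrier A"
proof -
  have l: "length as = n + m - 1" "set as \<subseteq> carrier A" using as by (auto simp: tuples_def)
  have 1: "take m (drop (i - 1) as) \<in> tuples A m"
    using l i set_take_subset[of m "drop (i - 1) as"] set_drop_subset[of "i - 1" as] by (auto simp:
        tuples_def)
  have "take (i - 1) as @ [g (take m (drop (i - 1) as))] @ drop (i - 1 + m) as \<in> tuples A n"
    using l i cochains_closed[OF g 1] set_take_subset[of "i - 1" as] set_drop_subset[of "i - 1 + m" as]
    by (auto simp: tuples_def)
  then show ?thesis unfolding insert_at_def by (rule cochains_closed[OF f])
qed

lemma circ_closed:
  assumes f: "f \<in> cochains A n" and g: "g \<in> cochains A m" and as: "as \<in> tuples A (n + m - 1)"
  shows "circ_cochain A n m f g as \<in> carrier A"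
  using as insert_at_closed[OF f g as] by (auto simp: circ_cochain_def intro!: finsum_closed)

lemma phi_circ:
  assumes f: "f \<in> cochains A n" and g: "g \<in> cochains A m" and vs: "length vs + 1 = n + m"
  shows "phi (circ_cochain A n m f g (map psi vs)) = circ (up n f) (up m g) vs"
proof -
  have t: "map psi vs \<in> tuples A (n + m - 1)" by (rule tuples_psi) (use vs in simp)
  note c = coch_up[OF f] coch_up[OF g]
  have "phi (circ_cochain A n m f g (map psi vs)) =
     (\<Sum>i\<in>{1..n}. phi ((- 1) powi ((int m - 1) * (int i - 1)) \<odot>\<^bsub>A\<^esub> insert_at i m f g (map psi vs)))"
    using t insert_at_closed[OF f g t] by (simp add: circ_cochain_def phi_finsum Pi_def)
  also have "\<dots> = (\<Sum>i\<in>{1..n}. sg ((int m + 1) * (int i - 1))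
     (up n f (take (i - 1) vs @ up m g (take m (drop (i - 1) vs)) # drop (i - 1 + m) vs)))"
  proof (rule sum.cong, rule refl)
    fix i assume i: "i \<in> {1..n}"
    have l: "length (take m (drop (i - 1) vs)) = m" using i vs by auto
    have gc: "g (map psi (take m (drop (i - 1) vs))) \<in> carrier A"
      using cochains_closed[OF g tuples_psi[OF l]] .
    have "insert_at i m f g (map psi vs)
      = f (map psi (take (i - 1) vs @ up m g (take m (drop (i - 1) vs)) # drop (i - 1 + m) vs))"
      using l gc by (simp add: insert_at_def up_def take_map drop_map)
    moreover have "length (take (i - 1) vs @ up m g (take m (drop (i - 1) vs)) # drop (i - 1 + m) vs) = n"
      using i vs by auto
    ultimately have "phi (insert_at i m f g (map psi vs))
      = up n f (take (i - 1) vs @ up m g (take m (drop (i - 1) vs)) # drop (i - 1 + m) vs)"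
      by (simp add: up_def)
    then show "phi ((- 1) powi ((int m - 1) * (int i - 1)) \<odot>\<^bsub>A\<^esub> insert_at i m f g (map psi vs))
      = sg ((int m + 1) * (int i - 1)) (up n f (take (i - 1) vs @ up m g (take m (drop (i - 1) vs)) #
          drop (i - 1 + m) vs))"
      by (simp only: phi_smult[OF insert_at_closed[OF f g t i]] neg_one_powi_scale) (rule sg_parity, simp)
  qed
  also have "\<dots> = circ (up n f) (up m g) vs"
    by (rule circ_index'[symmetric, OF cochD(2)[OF c(1)] cochD(1)[OF c(2)] vs])
  finally show ?thesis .
qed

text \<open>The bound on \<open>n + m\<close> excludes two elements of degree 0, whose bracket has
  degree -1 while \<open>n + m - 1\<close> truncates to 0.\<close>

lemma up_bracket:
  assumes f: "f \<in> cochains A n" and g: "g \<in> cochains A m" and nm: "n + m \<ge> 1"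
  shows "bracket_cochain A n m f g \<in> cochains A (n + m - 1)"
    "up (n + m - 1) (bracket_cochain A n m f g) = bracket (int n) (int m) (up n f) (up m g)"
proof -
  have c: "coch (int (n + m - 1)) (bracket (int n) (int m) (up n f) (up m g))"
    using coch_bracket[OF coch_up[OF f] coch_up[OF g]] nm by (simp add: of_nat_diff)
  have cl: "circ_cochain A n m f g as \<in> carrier A" "circ_cochain A m n g f as \<in> carrier A"
    if "as \<in> tuples A (n + m - 1)" for as
    using that circ_closed[OF f g] circ_closed[OF g f] by (simp_all add: add.commute)
  show *: "up (n + m - 1) (bracket_cochain A n m f g) = bracket (int n) (int m) (up n f) (up m g)"
  proof
    fix vs
    show "up (n + m - 1) (bracket_cochain A n m f g) vs = bracket (int n) (int m) (up n f) (up m g) vs"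
    proof (cases "length vs = n + m - 1")
      case False
      then have "bracket (int n) (int m) (up n f) (up m g) vs = 0"
        using cochD(1)[OF c] unfolding homog_def by auto
      then show ?thesis using False by (simp add: up_def)
    next
      case True
      have t: "map psi vs \<in> tuples A (n + m - 1)" using True by simp
      have l: "length vs + 1 = n + m" "length vs + 1 = m + n" using True nm by auto
      have "up (n + m - 1) (bracket_cochain A n m f g) vs = circ (up n f) (up m g) vs
         - (- 1) powi ((int n - 1) * (int m - 1)) *s circ (up m g) (up n f) vs"
        using True t cl[OF t] phi_circ[OF f g l(1)] phi_circ[OF g f l(2)]
        by (simp add: up_def bracket_cochain_def phi_minus phi_smult)
      also have "(- 1) powi ((int n - 1) * (int m - 1)) *s circ (up m g) (up n f) vs
        = sg ((int n + 1) * (int m + 1)) (circ (up m g) (up n f) vs)"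
        unfolding neg_one_powi_scale by (rule sg_parity) simp
      finally show ?thesis by (simp add: bracket_def)
    qed
  qed
  show "bracket_cochain A n m f g \<in> cochains A (n + m - 1)"
  proof (rule cochain_if_coch_up)
    show "bracket_cochain A n m f g \<in> tuples A (n + m - 1) \<rightarrow>\<^sub>E carrier A"
      using cl by (intro PiE_I) (simp_all add: bracket_cochain_def)
    show "coch (int (n + m - 1)) (up (n + m - 1) (bracket_cochain A n m f g))"
      unfolding * by (rule c)
  qed
qed

end

context nu_alg
begin

text \<open>The homotopy in \<open>poisson\<close> has to be a normalized cochain for its image
  under \<open>d\<close> to count as a boundary.\<close>

lemma coch_br:
  assumes "coch p x" "coch q y" "coch r z"
  shows "coch (p + q + r - 2) (br x y z)"
proof (rule cochI)
  note h = cochD[OF assms(1)] cochD[OF assms(2)] cochD[OF assms(3)] cochD2[OF assms(1)]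
  have h3: "x (u @ b # v @ c # t @ e # w) = 0" "x (u @ b # v @ c # t @ (a + a') # w) = x (u @ b # v @
      c # t @ a # w) + x (u @ b # v @ c # t @ a' # w)"
     "x (u @ b # v @ c # t @ (k *s a) # w) = k *s x (u @ b # v @ c # t @ a # w)"
     "x (u @ b # v @ c # t @ (e \<cdot> a) # w) = x (u @ b # v @ c # t @ a # w)"
     "x (u @ b # v @ 0 # w) = 0" for u b v c t w a a' k
    using cochD2[OF assms(1), of u b "v @ c # t"] multiadd_0[OF h(2), of "u @ b # v"] by simp_all
  show "homog (p + q + r - 2) (br x y z)"
    unfolding homog_def
  proof (intro allI impI, rule ccontr)
    fix as assume *: "br x y z as \<noteq> 0" "len as \<noteq> p + q + r - 2"
    have "x (u @ y v # w @ z t # s) = 0" if "as = u @ v @ w @ t @ s" for u v w t s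
    proof (rule ccontr)
      assume **: "x (u @ y v # w @ z t # s) \<noteq> 0"
      then have "y v \<noteq> 0" "z t \<noteq> 0" using multiadd_0[OF h(2)] h3(5) by metis+
      then have "len v = q" "len t = r" "len (u @ y v # w @ z t # s) = p"
        using ** cochD(1)[OF assms(1)] cochD(1)[OF assms(2)] cochD(1)[OF assms(3)] unfolding homog_def
            by blast+
      then show False using that * by simp
    qed
    then have "br x y z as = ssum5 (\<lambda>_ _ _ _ _. 0) as"
      unfolding brace2_def by (intro ssum_cong_split) simp
    then show False using * by simp
  qed
  show "multiadd (br x y z)"
    unfolding multiadd_def by (simp add: brace2_def ssum_mid h h3 sg_add ssum_add[abs_def] add_ac)
  show "br x y z (u @ (c *s a) # w) = c *s br x y z (u @ a # w)" for u c a w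
    by (simp add: brace2_def ssum_mid h h3 scale_right_distrib scale_ssum scale_sg)
  show "br x y z (u @ (e \<cdot> a) # w) = br x y z (u @ a # w)" for u a w
    by (simp add: brace2_def ssum_mid h h3)
  show "br x y z (u @ e # w) = 0" for u w
    by (simp add: brace2_def ssum_mid h h3 multiadd_0 ssum_zero[abs_def])
  show "e \<cdot> br x y z as = br x y z as" for as
    by (simp add: brace2_def mul_ssum_right mul_sg_right h)
qed

end

section \<open>Cohomology classes and their operations\<close>

context alg_transfer
begin

lemma cochains_add_closed:
  assumes "f \<in> cochains A r" "g \<in> cochains A r"
  shows "f \<oplus>\<^bsub>cochain_space A r\<^esub> g \<in> cochains A r"
proof (rule cochain_if_coch_up)
  show "f \<oplus>\<^bsub>cochain_space A r\<^esub> g \<in> tuples A r \<rightarrow>\<^sub>E carrier A"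
    using cochains_closed[OF assms(1)] cochains_closed[OF assms(2)]
    by (intro PiE_I) (simp_all add: cochain_space_def)
  show "coch (int r) (up r (f \<oplus>\<^bsub>cochain_space A r\<^esub> g))"
    unfolding up_add[OF assms] by (intro coch_add coch_up assms)
qed

lemma cochains_smult_closed:
  assumes "f \<in> cochains A r"
  shows "c \<odot>\<^bsub>cochain_space A r\<^esub> f \<in> cochains A r"
proof (rule cochain_if_coch_up)
  show "c \<odot>\<^bsub>cochain_space A r\<^esub> f \<in> tuples A r \<rightarrow>\<^sub>E carrier A"
    using cochains_closed[OF assms] by (intro PiE_I) (simp_all add: cochain_space_def)
  show "coch (int r) (up r (c \<odot>\<^bsub>cochain_space A r\<^esub> f))"
    unfolding up_smult[OF assms] by (intro coch_fscale coch_up assms)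
qed

lemma up_inj: "f \<in> cochains A r \<Longrightarrow> g \<in> cochains A r \<Longrightarrow> up r f = up r g \<Longrightarrow> f = g"
  by (metis down_up)

lemma cochains_zero_closed: "\<zero>\<^bsub>cochain_space A r\<^esub> \<in> cochains A r"
proof (rule cochain_if_coch_up)
  show "\<zero>\<^bsub>cochain_space A r\<^esub> \<in> tuples A r \<rightarrow>\<^sub>E carrier A"
    by (intro PiE_I) (simp_all add: cochain_space_def)
qed (simp add: up_zero coch_0)

lemma differential_closed:
  assumes f: "f \<in> cochains A r"
  shows "differential A r f \<in> cochains A (r + 1)"
proof (rule cochain_if_coch_up)
  show "differential A r f \<in> tuples A (r + 1) \<rightarrow>\<^sub>E carrier A"
  proof (intro PiE_I)
    fix as assume as: "as \<in> tuples A (r + 1)"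
    then have l: "length as = r + 1" "set as \<subseteq> carrier A" by (auto simp: tuples_def)
    then have ne: "as \<noteq> []" by auto
    have "tl as \<in> tuples A r" "butlast as \<in> tuples A r"
      using l by (auto simp: tuples_def dest: in_set_butlastD list.set_sel(2)[OF ne])
    moreover have "take (i - 1) as @ [as ! (i - 1) \<otimes>\<^bsub>A\<^esub> as ! i] @ drop (i + 1) as \<in> tuples A r" if "i
        \<in> {1..r}" for i
    proof -
      have "as ! (i - 1) \<in> carrier A" "as ! i \<in> carrier A"
        using l that by (auto intro!: subsetD[OF l(2)] nth_mem)
      then show ?thesis
        using l that set_take_subset[of "i - 1" as] set_drop_subset[of "i + 1" as] by (auto simp:
            tuples_def)
    qed
    moreover have "hd as \<in> carrier A" "last as \<in> carrier A"
      using l ne by (auto intro!: subsetD[OF l(2)])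
    ultimately show "differential A r f as \<in> carrier A"
      using as unfolding differential_def restrict_apply'[OF as]
      by (intro a_closed m_closed smult_closed finsum_closed Pi_I cochains_closed[OF f])
  qed (simp add: differential_def)
  show "coch (int (r + 1)) (up (r + 1) (differential A r f))"
    unfolding up_differential[OF f] using coch_d[OF coch_up[OF f]] by (simp add: add.commute)
qed

lemma coboundaries_iff: "h \<in> coboundaries A r \<longleftrightarrow> h \<in> cochains A r \<and> Bd (int r) (up r h)"
proof (cases r)
  case 0
  have "h = \<zero>\<^bsub>cochain_space A 0\<^esub>" if h: "h \<in> cochains A 0" "Bd 0 (up 0 h)"
  proof -
    \<comment> \<open>Degree 0 is separate in \<open>coboundaries\<close>; on the other side the
      primitive has degree -1 and is zero.\<close>
    obtain g where "coch (- 1) g" "up 0 h = d (- 1) g" using h(2) unfolding Bd_def by auto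
    then have "up 0 h = 0" using coch_neg[of "- 1" g] d_0 by simp
    then show ?thesis by (intro up_inj[OF h(1) cochains_zero_closed]) (simp add: up_zero)
  qed
  then show ?thesis using cochains_zero_closed[of 0] Bd_0[of 0] by (auto simp: 0 up_zero)
next
  case (Suc s)
  have "h \<in> differential A s ` cochains A s" if h: "h \<in> cochains A r" "Bd (int r) (up r h)"
  proof -
    obtain g where g: "coch (int s) g" "up r h = d (int s) g" using h(2) Suc unfolding Bd_def by auto
    have "up r (differential A s (down s g)) = up r h"
      using up_differential[OF cochains_down[OF g(1)]] up_down[OF g(1)] g(2) Suc by simp
    then have "h = differential A s (down s g)"
      using differential_closed[OF cochains_down[OF g(1)]] Suc by (intro up_inj[OF h(1)]) simp_all
    then show ?thesis using cochains_down[OF g(1)] by blast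
  qed
  moreover have "h \<in> cochains A r \<and> Bd (int r) (up r h)" if h: "h \<in> differential A s ` cochains A s"
  proof -
    obtain f where f: "f \<in> cochains A s" "h = differential A s f" using h by blast
    have "Bd (int s + 1) (d (int s) (up s f))" by (rule BdI[OF coch_up[OF f(1)]]) auto
    then show ?thesis using differential_closed[OF f(1)] up_differential[OF f(1)] f(2) Suc by (simp
        add: add.commute)
  qed
  ultimately show ?thesis using Suc by auto
qed

lemma cocycles_iff: "f \<in> cocycles A r \<longleftrightarrow> f \<in> cochains A r \<and> Z (int r) (up r f)"
proof -
  have "differential A r f = \<zero>\<^bsub>cochain_space A (r + 1)\<^esub> \<longleftrightarrow> d (int r) (up r f) = 0" if "f \<in> cochains A r"
    using up_differential[OF that] up_zero up_inj[OF differential_closed[OF that]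
        cochains_zero_closed] by metis
  then show ?thesis unfolding cocycles_def Z_def using coch_up by blast
qed

text \<open>The class as a set of cochains of \<open>A\<close>, named by a representative in the
  ambient space. The value \<open>{}\<close> in negative degrees is the single element of
  \<open>HH\<close> there.\<close>

definition cls :: "int \<Rightarrow> ('v list \<Rightarrow> 'v) \<Rightarrow> ('a list \<Rightarrow> 'a) set" where
  "cls n g = (if n < 0 then {} else {f \<in> cochains A (nat n). Bd n (up (nat n) f - g)})"

lemma cls_eqI: "Bd n (f - g) \<Longrightarrow> cls n f = cls n g"
proof -
  assume B: "Bd n (f - g)"
  have "Bd n (x - f) \<longleftrightarrow> Bd n (x - g)" for x
    using Bd_add[OF _ B, of "x - f"] Bd_diff[OF _ B, of "x - g"] by (auto simp: algebra_simps)
  then show ?thesis by (simp add: cls_def)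
qed

lemma down_cls: "0 \<le> n \<Longrightarrow> coch n g \<Longrightarrow> down (nat n) g \<in> cls n g"
  using cochains_down[of "nat n" g] up_down[of "nat n" g] by (simp add: cls_def Bd_0)

lemma cls_eqD:
  assumes "coch n f" "coch n g" "cls n f = cls n g"
  shows "Bd n (f - g)"
proof (cases "n < 0")
  case True
  then have "f = 0" "g = 0" using assms coch_neg by blast+
  then show ?thesis by (simp add: Bd_0)
next
  case False
  then have "down (nat n) f \<in> cls n g" using down_cls[of n f] assms by auto
  then show ?thesis using False up_down[of "nat n" f] assms by (simp add: cls_def)
qed

lemma cohomology_class_cls:
  assumes f: "f \<in> cochains A r"
  shows "cohomology_class A r f = cls (int r) (up r f)"
proof (intro equalityI subsetI)
  fix x assume "x \<in> cohomology_class A r f"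
  then obtain h where h: "h \<in> coboundaries A r" "x = h \<oplus>\<^bsub>cochain_space A r\<^esub> f"
    unfolding cohomology_class_def a_r_coset_def' by blast
  then have "h \<in> cochains A r" "Bd (int r) (up r h)" by (simp_all add: coboundaries_iff)
  then show "x \<in> cls (int r) (up r f)" unfolding h(2) cls_def by (simp add: cochains_add_closed f up_add)
next
  fix x assume "x \<in> cls (int r) (up r f)"
  then have x: "x \<in> cochains A r" "Bd (int r) (up r x - up r f)" by (simp_all add: cls_def)
  let ?h = "down r (up r x - up r f)"
  have c: "coch (int r) (up r x - up r f)" by (intro coch_diff coch_up x f)
  have "?h \<in> coboundaries A r" using x(2) by (simp add: coboundaries_iff cochains_down[OF c] up_down[OF c])
  moreover have "x = ?h \<oplus>\<^bsub>cochain_space A r\<^esub> f"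
    by (rule up_inj[OF x(1) cochains_add_closed[OF cochains_down[OF c] f]])
      (simp add: up_add[OF cochains_down[OF c] f] up_down[OF c])
  ultimately show "x \<in> cohomology_class A r f" unfolding cohomology_class_def a_r_coset_def' by blast
qed

lemma cls_neg: "n < 0 \<Longrightarrow> cls n g = {}"
  by (simp add: cls_def)

lemma HH_carrier: "carrier (HH A n) = cls n ` Collect (Z n)"
proof (cases "n < 0")
  case True
  then show ?thesis using Z_0[of n] by (auto simp: HH_def cls_neg)
next
  case False
  have "cohomology_class A (nat n) ` cocycles A (nat n) = cls n ` Collect (Z n)"
  proof (intro equalityI subsetI)
    fix X assume "X \<in> cohomology_class A (nat n) ` cocycles A (nat n)"
    then obtain f where "f \<in> cocycles A (nat n)" "X = cohomology_class A (nat n) f" by blast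
    then show "X \<in> cls n ` Collect (Z n)"
      using False by (simp add: cocycles_iff cohomology_class_cls)
  next
    fix X assume "X \<in> cls n ` Collect (Z n)"
    then obtain g where g: "Z n g" "X = cls n g" by blast
    have c: "coch (int (nat n)) g" using ZD(1)[OF g(1)] False by simp
    have "X = cohomology_class A (nat n) (down (nat n) g)" "down (nat n) g \<in> cocycles A (nat n)"
      using g False by (simp_all add: cohomology_class_cls[OF cochains_down[OF c]] up_down[OF c]
          cocycles_iff cochains_down[OF c])
    then show "X \<in> cohomology_class A (nat n) ` cocycles A (nat n)" by blast
  qed
  then show ?thesis using False by (simp add: HH_def)
qed

lemma HH_zero: "\<zero>\<^bsub>HH A n\<^esub> = cls n 0"
  by (cases "n < 0") (auto simp: HH_def cls_def coboundaries_iff)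

lemma HH_add:
  assumes "coch n f" "coch n g"
  shows "cls n f \<oplus>\<^bsub>HH A n\<^esub> cls n g = cls n (f + g)"
proof (cases "n < 0")
  case False
  then obtain r where r: "n = int r" by (metis nonneg_int_cases not_less)
  have "cls n f <+>\<^bsub>cochain_space A r\<^esub> cls n g = cls n (f + g)"
  proof (intro equalityI subsetI)
    fix x assume "x \<in> cls n f <+>\<^bsub>cochain_space A r\<^esub> cls n g"
    then obtain h k where hk: "h \<in> cls n f" "k \<in> cls n g" "x = h \<oplus>\<^bsub>cochain_space A r\<^esub> k"
      unfolding set_add_def' by blast
    then have c: "h \<in> cochains A r" "k \<in> cochains A r" "Bd n (up r h - f)" "Bd n (up r k - g)"
      by (simp_all add: cls_def r)
    have "up r x - (f + g) = (up r h - f) + (up r k - g)"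
      unfolding hk(3) up_add[OF c(1,2)] by simp
    with Bd_add[OF c(3,4)] have "Bd n (up r x - (f + g))" by (simp only:)
    moreover have "x \<in> cochains A r" unfolding hk(3) by (rule cochains_add_closed[OF c(1,2)])
    ultimately show "x \<in> cls n (f + g)" by (simp add: cls_def r)
  next
    fix x assume "x \<in> cls n (f + g)"
    then have x: "x \<in> cochains A r" "Bd n (up r x - (f + g))" by (simp_all add: cls_def r)
    have cf: "coch (int r) f" and c: "coch (int r) (up r x - f)"
      using assms coch_diff[OF coch_up[OF x(1)], of f] by (simp_all add: r)
    have "down r f \<in> cls n f" using down_cls[of n f] assms r by simp
    moreover have "down r (up r x - f) \<in> cls n g"
      using x(2) by (simp add: cls_def r cochains_down[OF c] up_down[OF c] algebra_simps)
    moreover have "x = down r f \<oplus>\<^bsub>cochain_space A r\<^esub> down r (up r x - f)"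
      by (rule up_inj[OF x(1) cochains_add_closed[OF cochains_down[OF cf] cochains_down[OF c]]])
        (simp add: up_add[OF cochains_down[OF cf] cochains_down[OF c]] up_down[OF cf] up_down[OF c])
    ultimately show "x \<in> cls n f <+>\<^bsub>cochain_space A r\<^esub> cls n g" unfolding set_add_def' by blast
  qed
  then show ?thesis using r by (simp add: HH_def)
qed (simp add: HH_def cls_neg)

lemma HH_smult:
  assumes "coch n f"
  shows "c \<odot>\<^bsub>HH A n\<^esub> cls n f = cls n (fscale c f)"
proof (cases "n < 0")
  case False
  then obtain r where r: "n = int r" by (metis nonneg_int_cases not_less)
  have "cohomology_class A r (c \<odot>\<^bsub>cochain_space A r\<^esub> h) = cls n (fscale c f)" if "h \<in> cls n f" for h
  proof -
    have h: "h \<in> cochains A r" "Bd n (up r h - f)" using that by (simp_all add: cls_def r)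
    have "fscale c (up r h) - fscale c f = fscale c (up r h - f)"
      by (rule ext) (simp add: scale_right_diff_distrib)
    then show ?thesis
      using Bd_fscale[OF h(2), of c]
      unfolding cohomology_class_cls[OF cochains_smult_closed[OF h(1)]] up_smult[OF h(1)] r
      by (intro cls_eqI) simp
  qed
  moreover have "cls n f \<noteq> {}" using down_cls[of n f] assms False by auto
  ultimately have "(\<Union>h\<in>cls n f. cohomology_class A r (c \<odot>\<^bsub>cochain_space A r\<^esub> h)) = cls n (fscale c f)"
      by auto
  then show ?thesis using r by (simp add: HH_def)
qed (simp add: HH_def cls_neg)

text \<open>\<open>HH_cup\<close> is a union over all pairs of representatives. Each pair gives the
  same class and there is at least one pair, so the union collapses to that class.\<close>

lemma HH_cup_cls:
  assumes f: "Z p f" and g: "Z q g"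
  shows "HH_cup A p q (cls p f) (cls q g) = cls (p + q) (cup p q f g)"
proof (cases "p < 0 \<or> q < 0")
  case True
  then have "f = 0 \<or> g = 0" using coch_neg ZD(1) f g by blast
  then have "cup p q f g = 0" by auto
  then show ?thesis using True by (simp add: HH_cup_def HH_zero)
next
  case False
  then obtain r s where r: "p = int r" "q = int s" by (metis nonneg_int_cases not_less)
  have "cohomology_class A (r + s) (cup_cochain A r s h k) = cls (p + q) (cup p q f g)"
    if "h \<in> cls p f" "k \<in> cls q g" for h k
  proof -
    have h: "h \<in> cochains A r" "Bd p (up r h - f)" and k: "k \<in> cochains A s" "Bd q (up s k - g)"
      using that by (simp_all add: cls_def r)
    have zh: "Z p (up r h)" using Z_add[OF f Bd_Z[OF h(2)]] by simp
    \<comment> \<open>One factor is changed at a time, so each difference is a product of a cocycle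
      and a boundary.\<close>
    have "cup p q (up r h) (up s k) - cup p q f g = cup p q (up r h - f) g + cup p q (up r h) (up s k - g)"
      using cup_add1[of p q f "up r h - f" g] cup_add2[of p q "up r h" g "up s k - g"] by (simp add:
          algebra_simps)
    then have "Bd (p + q) (cup p q (up r h) (up s k) - cup p q f g)"
      using Bd_add[OF Bd_cup_left[OF h(2) g] Bd_cup_right[OF zh k(2)]] by simp
    then have "cls (p + q) (cup p q (up r h) (up s k)) = cls (p + q) (cup p q f g)" by (rule cls_eqI)
    then show ?thesis
      unfolding cohomology_class_cls[OF up_cup(1)[OF h(1) k(1)]] up_cup(2)[OF h(1) k(1)]
      by (simp add: r)
  qed
  moreover have "cls p f \<noteq> {}" "cls q g \<noteq> {}"
    using down_cls[of p f] down_cls[of q g] ZD(1)[OF f] ZD(1)[OF g] False by auto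
  ultimately have "(\<Union>h\<in>cls p f. \<Union>k\<in>cls q g. cohomology_class A (r + s) (cup_cochain A r s h k)) = cls
      (p + q) (cup p q f g)"
    by auto
  then show ?thesis using r by (simp add: HH_cup_def nat_add_distrib)
qed

lemma HH_bracket_cls:
  assumes f: "Z p f" and g: "Z q g"
  shows "HH_bracket A p q (cls p f) (cls q g) = cls (p + q - 1) (bracket p q f g)"
proof (cases "p < 0 \<or> q < 0 \<or> p + q - 1 < 0")
  case True
  \<comment> \<open>If both degrees are 0, the target is the zero space in degree -1; otherwise one
    argument is zero.\<close>
  have "bracket p q f g = 0" if "p < 0 \<or> q < 0"
    using that coch_neg[OF _ ZD(1)[OF f]] coch_neg[OF _ ZD(1)[OF g]] bracket_0[OF ZD(3)[OF g]]
        bracket_0'[OF ZD(3)[OF f]] by auto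
  then show ?thesis using True by (auto simp: HH_bracket_def HH_zero cls_neg)
next
  case False
  then obtain r s where r: "p = int r" "q = int s" by (metis nonneg_int_cases not_less)
  have rs: "r + s \<ge> 1" using False r by simp
  have n: "nat (p + q - 1) = r + s - 1" "int (r + s - 1) = p + q - 1" using rs by (simp_all add: r)
  have "cohomology_class A (r + s - 1) (bracket_cochain A r s h k) = cls (p + q - 1) (bracket p q f g)"
    if "h \<in> cls p f" "k \<in> cls q g" for h k
  proof -
    have h: "h \<in> cochains A r" "Bd p (up r h - f)" and k: "k \<in> cochains A s" "Bd q (up s k - g)"
      using that by (simp_all add: cls_def r)
    have zh: "Z p (up r h)" using Z_add[OF f Bd_Z[OF h(2)]] by simp
    have "bracket p q (up r h) (up s k) - bracket p q f g = bracket p q (up r h - f) g + bracket p q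
        (up r h) (up s k - g)"
      using bracket_add1[OF ZD(3)[OF g], of p q f "up r h - f"] bracket_add2[OF ZD(3)[OF zh], of p q g
          "up s k - g"]
      by (simp add: algebra_simps)
    then have "Bd (p + q - 1) (bracket p q (up r h) (up s k) - bracket p q f g)"
      using Bd_add[OF Bd_bracket_left[OF h(2) g] Bd_bracket_right[OF zh k(2)]] by simp
    then have "cls (p + q - 1) (bracket p q (up r h) (up s k)) = cls (p + q - 1) (bracket p q f g)" by
        (rule cls_eqI)
    then show ?thesis
      unfolding cohomology_class_cls[OF up_bracket(1)[OF h(1) k(1) rs]] up_bracket(2)[OF h(1) k(1) rs] n(2)
      by (simp add: r)
  qed
  moreover have "cls p f \<noteq> {}" "cls q g \<noteq> {}"
    using down_cls[of p f] down_cls[of q g] ZD(1)[OF f] ZD(1)[OF g] False by auto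
  ultimately have "(\<Union>h\<in>cls p f. \<Union>k\<in>cls q g. cohomology_class A (r + s - 1) (bracket_cochain A r s h
      k)) = cls (p + q - 1) (bracket p q f g)"
    by auto
  then show ?thesis using False r n by (simp add: HH_bracket_def)
qed

definition one_cochain :: "'v list \<Rightarrow> 'v" where
  "one_cochain as = (if as = [] then e else 0)"

lemma coch_one_cochain: "coch 0 one_cochain"
  by (rule cochI) (auto simp: homog_def one_cochain_def multiadd_def e_idem)

lemma Z_one_cochain: "Z 0 one_cochain"
proof -
  have "d 0 one_cochain vs = 0" for vs
  proof (cases "length vs = 1")
    case True
    then obtain v where v: "vs = [v]" by (auto simp: length_Suc_conv)
    show ?thesis
      by (simp add: d_def v circ_mm_ends circ_def ssum_simps one_cochain_def e_central) (simp add: sg_def)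
  next
    case False
    then show ?thesis using cochD(1)[OF coch_d[OF coch_one_cochain]] unfolding homog_def by auto
  qed
  then show ?thesis by (simp add: Z_def coch_one_cochain fun_eq_iff)
qed

lemma HH_one_cls: "HH_one A = cls 0 one_cochain"
proof -
  have u: "up 0 (\<lambda>as\<in>tuples A 0. \<one>\<^bsub>A\<^esub>) = one_cochain"
    by (rule ext) (auto simp: up_def one_cochain_def phi_one tuples_def)
  have "(\<lambda>as\<in>tuples A 0. \<one>\<^bsub>A\<^esub>) \<in> cochains A 0"
    by (rule cochain_if_coch_up) (auto simp: u coch_one_cochain)
  then show ?thesis using cohomology_class_cls u by (simp add: HH_one_def)
qed

lemma conv_one_cochain: "coch n f \<Longrightarrow> conv one_cochain f = f" "coch n f \<Longrightarrow> conv f one_cochain = f"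
proof -
  assume f: "coch n f"
  have "conv one_cochain f as = e \<cdot> f as" for as
    unfolding conv_def by (subst ssum_only_start) (auto simp: one_cochain_def)
  moreover have "conv f one_cochain as = f as \<cdot> e" for as
    unfolding conv_def by (subst ssum_only_end) (auto simp: one_cochain_def)
  ultimately show "conv one_cochain f = f" "conv f one_cochain = f" by (auto simp: cochD[OF f] e_central)
qed

lemma fscale_sg: "fscale ((- 1) powi k) f = sg k f"
  by (rule ext) (simp add: neg_one_powi_scale)

lemma HH_module: "Module.module (cring_class_ops :: 'k ring) (HH A n)"
proof (rule moduleI)
  show "cring (cring_class_ops :: 'k ring)" by (rule cring_class)
  show "abelian_group (HH A n)"
  proof (rule abelian_groupI)
    show "\<zero>\<^bsub>HH A n\<^esub> \<in> carrier (HH A n)" using Z_0 by (auto simp: HH_carrier HH_zero)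
    fix X assume "X \<in> carrier (HH A n)"
    then obtain f where f: "Z n f" "X = cls n f" by (auto simp: HH_carrier)
    show "\<zero>\<^bsub>HH A n\<^esub> \<oplus>\<^bsub>HH A n\<^esub> X = X" using f by (simp add: HH_zero HH_add ZD coch_0)
    have "cls n (- f) \<oplus>\<^bsub>HH A n\<^esub> X = \<zero>\<^bsub>HH A n\<^esub>"
      using f by (simp add: HH_zero HH_add ZD coch_uminus)
    then show "\<exists>Y\<in>carrier (HH A n). Y \<oplus>\<^bsub>HH A n\<^esub> X = \<zero>\<^bsub>HH A n\<^esub>"
      using Z_uminus[OF f(1)] by (auto simp: HH_carrier)
  qed (auto simp: HH_carrier HH_add ZD coch_add Z_add add_ac)
  fix a b :: 'k and X assume "X \<in> carrier (HH A n)"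
  then obtain f where f: "Z n f" "X = cls n f" by (auto simp: HH_carrier)
  show "a \<odot>\<^bsub>HH A n\<^esub> X \<in> carrier (HH A n)"
    using f Z_fscale[OF f(1)] by (auto simp: HH_carrier HH_smult ZD)
  have "fscale (a + b) f = fscale a f + fscale b f" by (rule ext) (simp add: scale_left_distrib)
  then show "(a \<oplus>\<^bsub>cring_class_ops\<^esub> b) \<odot>\<^bsub>HH A n\<^esub> X = a \<odot>\<^bsub>HH A n\<^esub> X \<oplus>\<^bsub>HH A n\<^esub> b \<odot>\<^bsub>HH A n\<^esub> X"
    using f by (simp add: plus_class HH_smult HH_add ZD coch_fscale)
  have "fscale (a * b) f = fscale a (fscale b f)" by (rule ext) simp
  then show "(a \<otimes>\<^bsub>cring_class_ops\<^esub> b) \<odot>\<^bsub>HH A n\<^esub> X = a \<odot>\<^bsub>HH A n\<^esub> (b \<odot>\<^bsub>HH A n\<^esub> X)"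
    using f by (simp add: times_class HH_smult ZD coch_fscale)
  have "fscale 1 f = f" by (rule ext) simp
  then show "\<one>\<^bsub>cring_class_ops\<^esub> \<odot>\<^bsub>HH A n\<^esub> X = X"
    using f by (simp add: one_class HH_smult ZD)
  fix Y assume "Y \<in> carrier (HH A n)"
  then obtain g where g: "Z n g" "Y = cls n g" by (auto simp: HH_carrier)
  have "fscale a (f + g) = fscale a f + fscale a g" by (rule ext) (simp add: scale_right_distrib)
  then show "a \<odot>\<^bsub>HH A n\<^esub> (X \<oplus>\<^bsub>HH A n\<^esub> Y) = a \<odot>\<^bsub>HH A n\<^esub> X \<oplus>\<^bsub>HH A n\<^esub> a \<odot>\<^bsub>HH A n\<^esub> Y"
    using f g by (simp add: HH_smult HH_add ZD coch_fscale coch_add)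
qed

lemma HH_uminus: "Z n f \<Longrightarrow> \<ominus>\<^bsub>HH A n\<^esub> cls n f = cls n (- f)"
proof -
  assume f: "Z n f"
  interpret M: Module.module "cring_class_ops :: 'k ring" "HH A n" by (rule HH_module)
  show ?thesis
    by (rule M.minus_equality) (use f Z_uminus[OF f] in \<open>auto simp: HH_carrier HH_zero HH_add ZD
        coch_uminus\<close>)
qed

lemma HH_minus: "Z n f \<Longrightarrow> Z n g \<Longrightarrow> cls n f \<ominus>\<^bsub>HH A n\<^esub> cls n g = cls n (f - g)"
  by (simp add: a_minus_def HH_uminus HH_add ZD coch_uminus)

text \<open>Associativity, antisymmetry and the Jacobi identity hold strictly on representatives;
  commutativity and the Poisson rule hold up to the boundaries of \<open>circ f g\<close> and
  \<open>br f g h\<close>.\<close>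

lemma gerstenhaber_HH: "gerstenhaber_algebra (HH A) (HH_cup A) (HH_one A) (HH_bracket A)"
proof
  show "graded_vector_space (HH A)" by (simp add: graded_vector_space_def HH_module)
  show "graded_bilinear (HH A) 0 (HH_cup A)"
    unfolding graded_bilinear_def
    by (auto simp: HH_carrier HH_cup_cls HH_add HH_smult Z_cup Z_add Z_fscale ZD coch_cup cup_add1
        cup_add2 cup_fscale)
  show "HH_one A \<in> carrier (HH A 0)" using Z_one_cochain by (auto simp: HH_carrier HH_one_cls)
  show "graded_bilinear (HH A) (- 1) (HH_bracket A)"
    unfolding graded_bilinear_def
    by (auto simp: HH_carrier HH_bracket_cls HH_add HH_smult Z_bracket Z_add Z_fscale ZD coch_bracket
        bracket_add1 bracket_add2
        bracket_fscale[OF ZD(1)])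
next
  fix X p assume "X \<in> carrier (HH A p)"
  then obtain f where f: "Z p f" "X = cls p f" by (auto simp: HH_carrier)
  show "HH_cup A 0 p (HH_one A) X = X \<and> HH_cup A p 0 X (HH_one A) = X"
    using f by (simp add: HH_one_cls HH_cup_cls Z_one_cochain cup_def conv_one_cochain[OF ZD(1)[OF
        f(1)]]) (simp add: sg_def)
  fix Y q assume "Y \<in> carrier (HH A q)"
  then obtain g where g: "Z q g" "Y = cls q g" by (auto simp: HH_carrier)
  have "Bd (p + q) (cup p q f g - sg (p * q) (cup q p g f))"
    unfolding cup_commute[OF ZD(3)[OF f(1)] ZD(3)[OF g(1)] ZD(4)[OF f(1)] ZD(4)[OF g(1)] ZD(2)[OF
        f(1)] ZD(2)[OF g(1)]]
    by (intro Bd_sg BdI[OF coch_circ[OF ZD(1)[OF f(1)] ZD(1)[OF g(1)]]]) auto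
  then show "HH_cup A p q X Y = (- 1) powi (p * q) \<odot>\<^bsub>HH A (p + q)\<^esub> HH_cup A q p Y X"
    using cls_eqI Z_cup[OF g(1) f(1)] f g
    by (simp add: HH_cup_cls add.commute[of q p] HH_smult ZD fscale_sg)
  have "bracket p q f g = - sg ((p - 1) * (q - 1)) (bracket q p g f)"
    by (cases "even p"; cases "even q"; simp add: bracket_def sg_def)
  then show "HH_bracket A p q X Y =
      \<ominus>\<^bsub>HH A (p + q - 1)\<^esub> ((- 1) powi ((p - 1) * (q - 1)) \<odot>\<^bsub>HH A (p + q - 1)\<^esub> HH_bracket A q p Y X)"
    using Z_bracket[OF g(1) f(1)] f g
    by (simp add: HH_bracket_cls add.commute[of q p] HH_smult ZD fscale_sg HH_uminus Z_sg)
  fix W r assume "W \<in> carrier (HH A r)"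
  then obtain h where h: "Z r h" "W = cls r h" by (auto simp: HH_carrier)
  note z = f(1) g(1) h(1)
  show "HH_cup A (p + q) r (HH_cup A p q X Y) W = HH_cup A p (q + r) X (HH_cup A q r Y W)"
    unfolding f(2) g(2) h(2) HH_cup_cls[OF z(1,2)] HH_cup_cls[OF z(2,3)] HH_cup_cls[OF Z_cup[OF
        z(1,2)] z(3)]
      HH_cup_cls[OF z(1) Z_cup[OF z(2,3)]] cup_assoc add.assoc ..
  have deg: "p + q - 1 + r - 1 = p + q + r - 2" "q + r - 1 + p - 1 = p + q + r - 2" "r + p - 1 + q - 1
      = p + q + r - 2"
    by simp_all
  note B = Z_bracket[OF Z_bracket[OF z(1,2)] z(3), unfolded deg] Z_bracket[OF Z_bracket[OF z(2,3)]
      z(1), unfolded deg]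
    Z_bracket[OF Z_bracket[OF z(3,1)] z(2), unfolded deg]
  have J: "sg ((p - 1) * (r - 1)) (bracket (p + q - 1) r (bracket p q f g) h)
    + sg ((q - 1) * (p - 1)) (bracket (q + r - 1) p (bracket q r g h) f)
    + sg ((r - 1) * (q - 1)) (bracket (r + p - 1) q (bracket r p h f) g) = 0"
    using bracket_jacobi[OF ZD(3)[OF z(1)] ZD(3)[OF z(2)] ZD(3)[OF z(3)] ZD(4)[OF z(1)] ZD(4)[OF z(2)]
        ZD(4)[OF z(3)]]
    by (simp add: sg_def)
  show "(- 1) powi ((p - 1) * (r - 1)) \<odot>\<^bsub>HH A (p + q + r - 2)\<^esub>
             HH_bracket A (p + q - 1) r (HH_bracket A p q X Y) W
         \<oplus>\<^bsub>HH A (p + q + r - 2)\<^esub> (- 1) powi ((q - 1) * (p - 1)) \<odot>\<^bsub>HH A (p + q + r - 2)\<^esub>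
             HH_bracket A (q + r - 1) p (HH_bracket A q r Y W) X
         \<oplus>\<^bsub>HH A (p + q + r - 2)\<^esub> (- 1) powi ((r - 1) * (q - 1)) \<odot>\<^bsub>HH A (p + q + r - 2)\<^esub>
             HH_bracket A (r + p - 1) q (HH_bracket A r p W X) Y
         = \<zero>\<^bsub>HH A (p + q + r - 2)\<^esub>"
    unfolding f(2) g(2) h(2) HH_bracket_cls[OF z(1,2)] HH_bracket_cls[OF z(2,3)] HH_bracket_cls[OF z(3,1)]
      HH_bracket_cls[OF Z_bracket[OF z(1,2)] z(3)] HH_bracket_cls[OF Z_bracket[OF z(2,3)] z(1)]
      HH_bracket_cls[OF Z_bracket[OF z(3,1)] z(2)] deg
      HH_smult[OF ZD(1)[OF B(1)]] HH_smult[OF ZD(1)[OF B(2)]] HH_smult[OF ZD(1)[OF B(3)]] fscale_sg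
    by (simp add: HH_add ZD B coch_sg coch_add J HH_zero)
  have deg2: "p + (q + r) - 1 = p + q + r - 1" "p + q - 1 + r = p + q + r - 1" "q + (p + r - 1) = p +
      q + r - 1"
    by simp_all
  note C = Z_bracket[OF z(1) Z_cup[OF z(2,3)], unfolded deg2] Z_cup[OF Z_bracket[OF z(1,2)] z(3),
      unfolded deg2]
    Z_cup[OF z(2) Z_bracket[OF z(1,3)], unfolded deg2]
  have "coch (p + q + r - 2) (br f g h)" by (intro coch_br ZD(1) z)
  then have P: "Bd (p + q + r - 1) (bracket p (q + r) f (cup q r g h) -
     (cup (p + q - 1) r (bracket p q f g) h + sg ((p - 1) * q) (cup q (p + r - 1) g (bracket p r f h))))"
    using poisson[OF ZD(3)[OF z(1)] ZD(3)[OF z(2)] ZD(3)[OF z(3)] ZD(4)[OF z(1)] ZD(4)[OF z(2)]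
        ZD(4)[OF z(3)]
      ZD(2)[OF z(1)] ZD(2)[OF z(2)] ZD(2)[OF z(3)]]
    by (simp add: diff_diff_eq) (intro Bd_sg BdI, auto)
  show "HH_bracket A p (q + r) X (HH_cup A q r Y W) =
           HH_cup A (p + q - 1) r (HH_bracket A p q X Y) W
           \<oplus>\<^bsub>HH A (p + q + r - 1)\<^esub> (- 1) powi ((p - 1) * q) \<odot>\<^bsub>HH A (p + q + r - 1)\<^esub>
             HH_cup A q (p + r - 1) Y (HH_bracket A p r X W)"
    unfolding f(2) g(2) h(2) HH_bracket_cls[OF z(1,2)] HH_bracket_cls[OF z(1,3)] HH_cup_cls[OF z(2,3)]
      HH_bracket_cls[OF z(1) Z_cup[OF z(2,3)]] HH_cup_cls[OF Z_bracket[OF z(1,2)] z(3)]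
      HH_cup_cls[OF z(2) Z_bracket[OF z(1,3)]] deg2 HH_smult[OF ZD(1)[OF C(3)]] fscale_sg
      HH_add[OF ZD(1)[OF C(2)] coch_sg[OF ZD(1)[OF C(3)]]]
    by (rule cls_eqI) (rule P)
qed

end

section \<open>The Batalin-Vilkovisky operator on cohomology\<close>

locale frob_transfer = frob_diag scale mul e lam nu mu riesz B bv co ch + alg_transfer scale mul e A phi psi
  for scale :: "'k::field \<Rightarrow> 'v::ab_group_add \<Rightarrow> 'v" (infixr \<open>*s\<close> 75)
    and mul :: "'v \<Rightarrow> 'v \<Rightarrow> 'v" (infixl \<open>\<cdot>\<close> 70) and e lam nu mu riesz
    and B :: "'b set" and bv co ch and A :: "('k, 'a) module" (structure) and phi psi
begin

text \<open>The choice is restricted to invariant representatives because \<open>BV\<close> of an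
  arbitrary cocycle need not be a cocycle.\<close>

definition Delta :: "int \<Rightarrow> ('a list \<Rightarrow> 'a) set \<Rightarrow> ('a list \<Rightarrow> 'a) set" where
  "Delta n X = cls (n - 1) (BV n (SOME f. Z n f \<and> T f = f \<and> X = cls n f))"

text \<open>Two invariant representatives differ by an invariant boundary, which
  \<open>Del_Bd\<close> sends to a boundary.\<close>

lemma Delta_cls:
  assumes "Z n f" "T f = f"
  shows "Delta n (cls n f) = cls (n - 1) (BV n f)"
proof -
  define g where "g = (SOME g. Z n g \<and> T g = g \<and> cls n f = cls n g)"
  have "Z n g \<and> T g = g \<and> cls n f = cls n g"
    unfolding g_def by (rule someI[of _ f]) (use assms in simp)
  then have g: "Z n g" "T g = g" "cls n f = cls n g" by auto
  have "Bd n (g - f)" by (rule cls_eqD) (use g assms ZD in auto)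
  then have "Bd (n - 1) (Del (g - f))" using g assms by (intro Del_Bd) (simp add: T_diff)
  moreover have "Del (g - f) = Del g - Del f"
    using Del_add[OF coch_diff[OF ZD(1)[OF g(1)] ZD(1)[OF assms(1)]] ZD(1)[OF assms(1)]] by simp
  ultimately have "Bd (n - 1) (BV n g - BV n f)" by (simp add: BV_def Bd_sg flip: sg_diff)
  then show ?thesis unfolding Delta_def g_def[symmetric] by (rule cls_eqI)
qed

lemma inv_class:
  assumes "X \<in> carrier (HH A n)"
  obtains f where "Z n f" "T f = f" "X = cls n f"
  using assms invariant_representative cls_eqI unfolding HH_carrier by blast

text \<open>Applying \<open>nu\<close> to all letters does not change \<open>lam\<close> of an
  invariant cochain, as \<open>lam\<close> is itself invariant under \<open>nu\<close>. So
  \<open>Del f\<close> is again an admissible representative and \<open>Delta\<close> can be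
  iterated.\<close>

lemma T_Del:
  assumes "coch n f" "T f = f"
  shows "T (Del f) = Del f"
proof (rule lam_eqI)
  note D = Del_props[OF assms(1)]
  have f: "f (map nu u) = nu (f u)" for u
    using assms(2) unfolding T_def by (metis nu_mu)
  show "e \<cdot> T (Del f) as = T (Del f) as" for as by (rule cochD(6)[OF coch_T[OF coch_Del[OF assms(1)]]])
  show "lam (a \<cdot> T (Del f) as) = lam (a \<cdot> Del f as)" for a as
  proof -
    have "lam (f (map nu w @ nu (nu a) # map nu (map nu u))) = lam (f (w @ nu a # map nu u))" for u w
      using f[of "w @ nu a # map nu u"] by (simp add: lam_nu_eq)
    then show ?thesis unfolding lam_T D(2) by (simp add: ssum_map)
  qed
qed (rule Del_props(1)[OF assms(1)])

lemma T_BV: "coch n f \<Longrightarrow> T f = f \<Longrightarrow> T (BV n f) = BV n f"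
  by (simp add: BV_def T_sg T_Del)

lemma Z_BV: "Z n f \<Longrightarrow> T f = f \<Longrightarrow> Z (n - 1) (BV n f)"
  by (simp add: BV_def Z_sg Z_Del)

theorem HH_batalin_vilkovisky: "batalin_vilkovisky_algebra (HH A) (HH_cup A) (HH_one A) (HH_bracket A)"
  unfolding batalin_vilkovisky_algebra_def
proof (intro conjI exI[of _ Delta] allI ballI gerstenhaber_HH)
  show "graded_linear (HH A) (- 1) Delta"
    unfolding graded_linear_def
  proof (intro allI conjI ballI)
    fix p
    show "Delta p \<in> carrier (HH A p) \<rightarrow> carrier (HH A (p + - 1))"
    proof
      fix X assume "X \<in> carrier (HH A p)"
      then obtain f where "Z p f" "T f = f" "X = cls p f" by (rule inv_class)
      then show "Delta p X \<in> carrier (HH A (p + - 1))" using Z_BV by (auto simp: Delta_cls HH_carrier)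
    qed
    fix X assume "X \<in> carrier (HH A p)"
    then obtain f where f: "Z p f" "T f = f" "X = cls p f" by (rule inv_class)
    {
      fix Y assume "Y \<in> carrier (HH A p)"
      then obtain g where g: "Z p g" "T g = g" "Y = cls p g" by (rule inv_class)
      have "BV p (f + g) = BV p f + BV p g" by (simp add: BV_def Del_add[OF ZD(1)[OF f(1)] ZD(1)[OF
          g(1)]] sg_add)
      then show "Delta p (X \<oplus>\<^bsub>HH A p\<^esub> Y) = Delta p X \<oplus>\<^bsub>HH A (p + - 1)\<^esub> Delta p Y"
        using f g ZD(1)[OF Z_BV[OF f(1,2)]] ZD(1)[OF Z_BV[OF g(1,2)]]
        by (simp add: HH_add ZD Delta_cls Z_add T_add)
    next
      fix c
      have "BV p (fscale c f) = fscale c (BV p f)"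
        by (rule ext) (simp add: BV_def Del_fscale[OF ZD(1)[OF f(1)]] scale_sg)
      then show "Delta p (c \<odot>\<^bsub>HH A p\<^esub> X) = c \<odot>\<^bsub>HH A (p + - 1)\<^esub> Delta p X"
        using f ZD(1)[OF Z_BV[OF f(1,2)]] by (simp add: HH_smult ZD Delta_cls Z_fscale T_fscale)
    }
  qed
  show "Delta (p - 1) (Delta p X) = \<zero>\<^bsub>HH A (p - 2)\<^esub>" if X: "X \<in> carrier (HH A p)" for p X
  proof -
    obtain f where f: "Z p f" "T f = f" "X = cls p f" using X by (rule inv_class)
    have "BV (p - 1) (BV p f) = 0"
      by (simp add: BV_def Del_sg[OF coch_Del[OF ZD(1)[OF f(1)]]] Del_Del[OF ZD(1)[OF f(1)]] fun_eq_iff)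
    then show ?thesis
      using f by (simp add: Delta_cls Z_BV T_BV[OF ZD(1)[OF f(1)]] HH_zero)
  qed
  \<comment> \<open>The target has degree -1, where every class is the empty set, whichever
    representative is chosen.\<close>
  show "Delta 0 (HH_one A) = \<zero>\<^bsub>HH A (- 1)\<^esub>"
    by (simp add: Delta_def HH_zero cls_neg)
  fix p q X Y assume "X \<in> carrier (HH A p)" "Y \<in> carrier (HH A q)"
  then obtain f g where f: "Z p f" "T f = f" "X = cls p f" and g: "Z q g" "T g = g" "Y = cls q g"
    by (metis inv_class)
  note zf = Z_BV[OF f(1,2)] and zg = Z_BV[OF g(1,2)]
  have deg: "p - 1 + q = p + q - 1" "p + (q - 1) = p + q - 1" by simp_all
  note C = Z_BV[OF Z_cup[OF f(1) g(1)]] Z_cup[OF zf g(1), unfolded deg] Z_cup[OF f(1) zg, unfolded deg]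
  have Tc: "T (cup p q f g) = cup p q f g" by (simp add: T_cup f g)
  show "HH_bracket A p q X Y = (- 1) powi (p + 1) \<odot>\<^bsub>HH A (p + q - 1)\<^esub>
             (Delta (p + q) (HH_cup A p q X Y)
              \<ominus>\<^bsub>HH A (p + q - 1)\<^esub> HH_cup A (p - 1) q (Delta p X) Y
              \<ominus>\<^bsub>HH A (p + q - 1)\<^esub> (- 1) powi p \<odot>\<^bsub>HH A (p + q - 1)\<^esub> HH_cup A p (q - 1) X (Delta q Y))"
    unfolding f(3) g(3) HH_bracket_cls[OF f(1) g(1)] HH_cup_cls[OF f(1) g(1)] Delta_cls[OF f(1,2)]
        Delta_cls[OF g(1,2)]
      HH_cup_cls[OF zf g(1)] HH_cup_cls[OF f(1) zg] Delta_cls[OF Z_cup[OF f(1) g(1)] Tc] deg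
      HH_smult[OF ZD(1)[OF C(3)]] fscale_sg HH_minus[OF C(1)[OF Tc] C(2)]
      HH_minus[OF Z_diff[OF C(1)[OF Tc] C(2)] Z_sg[OF C(3)]]
      HH_smult[OF ZD(1)[OF Z_diff[OF Z_diff[OF C(1)[OF Tc] C(2)] Z_sg[OF C(3)]]]]
    by (rule cls_eqI) (rule bracket_BV[OF f(1,2) g(1,2)])
qed

end

section \<open>Multiplication of ordered monomials\<close>

definition scl :: "'k::times \<Rightarrow> ('a \<Rightarrow> 'k) \<Rightarrow> 'a \<Rightarrow> 'k" where
  "scl c x = (\<lambda>w. c * x w)"

section \<open>Bicharacter and truncated multiplication of exponent vectors\<close>

locale qci_data =
  fixes N :: nat and q :: "nat \<Rightarrow> nat \<Rightarrow> 'k::field" and a :: "nat \<Rightarrow> nat"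
  assumes a_pos: "j \<in> {1..N} \<Longrightarrow> a j \<ge> 1"
    and q_nz: "\<lbrakk>i \<in> {1..N}; j \<in> {1..N}\<rbrakk> \<Longrightarrow> q i j \<noteq> 0"
    and q_diag: "i \<in> {1..N} \<Longrightarrow> q i i = 1"
    and q_inv: "\<lbrakk>i \<in> {1..N}; j \<in> {1..N}\<rbrakk> \<Longrightarrow> q i j * q j i = 1"
begin

text \<open>Exponent of the socle monomial. Exponent vectors are total functions; the value 0
  outside the variables keeps \<open>box\<close>, the exponents of the nonzero ordered monomials,
  finite.\<close>

definition top_exp :: "nat \<Rightarrow> nat" where
  "top_exp i = (if i \<in> {1..N} then a i else 0)"

definition box :: "(nat \<Rightarrow> nat) set" where
  "box = {u. u \<le> top_exp}"

text \<open>Reordering the product of the monomials with exponents \<open>u\<close> and \<open>v\<close> multiplies it by \<open>chi u v\<close>.\<close>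

definition chi :: "(nat \<Rightarrow> nat) \<Rightarrow> (nat \<Rightarrow> nat) \<Rightarrow> 'k" where
  "chi u v = (\<Prod>i\<in>{1..N}. \<Prod>j\<in>{1..<i}. q i j ^ (u i * v j))"

lemma finite_below: "w \<in> box \<Longrightarrow> finite {u. u \<le> w}"
proof -
  assume w: "w \<in> box"
  have "{u. u \<le> w} \<subseteq> {f. \<forall>x. (x \<in> {1..N} \<longrightarrow> f x \<in> {..Max (a ` {1..N})}) \<and> (x \<notin> {1..N} \<longrightarrow> f x = 0)}"
  proof (intro subsetI CollectI allI conjI impI)
    fix u x assume "u \<in> {u. u \<le> w}"
    then have "u \<le> top_exp" using w order_trans[of u w top_exp] unfolding box_def by blast
    then have u: "u x \<le> top_exp x" by (rule le_funD)
    show "u x \<in> {..Max (a ` {1..N})}" if x: "x \<in> {1..N}"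
    proof -
      have "u x \<le> a x" using u x by (simp add: top_exp_def)
      also have "a x \<le> Max (a ` {1..N})" using x by (intro Max_ge) auto
      finally show ?thesis unfolding atMost_iff .
    qed
    show "u x = 0" if "x \<notin> {1..N}" using u that by (auto simp: top_exp_def split: if_splits)
  qed
  then show ?thesis by (rule finite_subset) (rule finite_set_of_finite_funs; simp)
qed

lemma top_box: "top_exp \<in> box" by (simp add: box_def)

lemma finite_box: "finite box"
  using finite_below[OF top_box] unfolding box_def .

lemma box_down: "w \<in> box \<Longrightarrow> u \<le> w \<Longrightarrow> u \<in> box"
  unfolding box_def using order_trans by blast

lemma zero_box: "0 \<in> box" by (simp add: box_def le_fun_def)

lemma le_add_diff: "u \<le> w \<Longrightarrow> u + (w - u) = (w :: nat \<Rightarrow> nat)"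
  by (rule ext) (simp add: le_fun_def)

lemma fun_diff_le: "w - u \<le> (w :: nat \<Rightarrow> nat)"
  by (simp add: le_fun_def)

lemma fun_diff_diff: "u \<le> w \<Longrightarrow> w - (w - u) = (u :: nat \<Rightarrow> nat)"
proof
  fix x assume "u \<le> w"
  from le_funD[OF this, of x] show "(w - (w - u)) x = u x" by simp
qed

lemma fun_diff_eq_iff: "u \<le> w \<and> w - u = v \<longleftrightarrow> w = u + (v :: nat \<Rightarrow> nat)"
proof
  assume "u \<le> w \<and> w - u = v"
  then show "w = u + v" using le_add_diff[of u w] by simp
next
  assume w: "w = u + v"
  have "u \<le> w" unfolding w by (simp add: le_fun_def)
  moreover have "w - u = v" unfolding w by (rule ext) simp
  ultimately show "u \<le> w \<and> w - u = v" by simp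
qed

lemma chi_add_left: "chi (u + u') v = chi u v * chi u' v"
  by (simp add: chi_def distrib_right power_add prod.distrib)

lemma chi_add_right: "chi u (v + v') = chi u v * chi u v'"
  by (simp add: chi_def distrib_left power_add prod.distrib)

lemma chi_0 [simp]: "chi 0 v = 1" "chi u 0 = 1"
  by (simp_all add: chi_def)

lemma chi_nz: "chi u v \<noteq> 0"
  using q_nz by (auto simp: chi_def)

text \<open>Multiplication of coefficient functions of ordered monomials; coefficients outside of \<open>box\<close>
  are projected away.\<close>

definition mul :: "((nat \<Rightarrow> nat) \<Rightarrow> 'k) \<Rightarrow> ((nat \<Rightarrow> nat) \<Rightarrow> 'k) \<Rightarrow> (nat \<Rightarrow> nat) \<Rightarrow> 'k" where
  "mul x y w = (if w \<in> box then \<Sum>u\<in>{u. u \<le> w}. chi u (w - u) * x u * y (w - u) else 0)"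

definition bas :: "(nat \<Rightarrow> nat) \<Rightarrow> (nat \<Rightarrow> nat) \<Rightarrow> 'k" where
  "bas u = (\<lambda>w. if w = u then 1 else 0)"

abbreviation "unit \<equiv> bas 0"

text \<open>Multiplicativity of \<open>chi\<close> in both arguments is the cocycle condition. The
  pairs \<open>(s, u)\<close> with \<open>u\<close> below \<open>s\<close> are traded for
  \<open>(u, s - u)\<close>, the exponents of the first two factors.\<close>

lemma mul_assoc: "mul (mul x y) z = mul x (mul y z)"
proof
  fix w
  show "mul (mul x y) z w = mul x (mul y z) w"
  proof (cases "w \<in> box")
    case w: True
    have f: "finite {u. u \<le> v}" if "v \<le> w" for v using finite_below[OF box_down[OF w that]] .
    have "mul (mul x y) z w = (\<Sum>s\<in>{s. s \<le> w}. \<Sum>u\<in>{u. u \<le> s}. chi s (w - s) * (chi u (s - u) * x u * y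
        (s - u)) * z (w - s))"
      using w by (auto simp: mul_def[of _ z] mul_def[of x y] box_down sum_distrib_left
          sum_distrib_right intro!: sum.cong)
    also have "\<dots> = (\<Sum>(s,u)\<in>Sigma {s. s \<le> w} (\<lambda>s. {u. u \<le> s}). chi s (w - s) * (chi u (s - u) * x u * y
        (s - u)) * z (w - s))"
      by (rule sum.Sigma) (use f in auto)
    also have "\<dots> = (\<Sum>(u,v)\<in>Sigma {u. u \<le> w} (\<lambda>u. {v. v \<le> w - u}). chi u (w - u) * x u * (chi v (w - u
        - v) * y v * z (w - u - v)))"
    proof (rule sum.reindex_bij_witness[of _ "\<lambda>(u, v). (u + v, u)" "\<lambda>(s, u). (u, s - u)"])
      fix p assume p: "p \<in> Sigma {s. s \<le> w} (\<lambda>s. {u. u \<le> s})"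
      obtain s u where su: "p = (s, u)" "s \<le> w" "u \<le> s" using p by auto
      have le: "u \<le> w" "s - u \<le> w - u"
        using su(2,3) order_trans[OF su(3,2)] by (simp_all add: le_fun_def diff_le_mono)
      have e: "w - u - (s - u) = w - s" "w - u = (s - u) + (w - s)"
        using su by (auto simp: fun_eq_iff le_fun_def)
      have e2: "chi s (w - s) = chi u (w - s) * chi (s - u) (w - s)"
        by (metis le_add_diff[OF su(3)] chi_add_left)
      show "(case case p of (s, u) \<Rightarrow> (u, s - u) of (u, v) \<Rightarrow> (u + v, u)) = p"
        using su by (simp add: le_add_diff)
      show "(case p of (s, u) \<Rightarrow> (u, s - u)) \<in> Sigma {u. u \<le> w} (\<lambda>u. {v. v \<le> w - u})"
        using su le by simp
      show "(case case p of (s, u) \<Rightarrow> (u, s - u) of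
          (u, v) \<Rightarrow> chi u (w - u) * x u * (chi v (w - u - v) * y v * z (w - u - v)))
        = (case p of (s, u) \<Rightarrow> chi s (w - s) * (chi u (s - u) * x u * y (s - u)) * z (w - s))"
        unfolding su prod.case e(1) e2 by (subst e(2)) (simp add: chi_add_right mult_ac)
    next
      fix p assume p: "p \<in> Sigma {u. u \<le> w} (\<lambda>u. {v. v \<le> w - u})"
      obtain u v where uv: "p = (u, v)" "u \<le> w" "v \<le> w - u" using p by auto
      have "u x + v x \<le> w x" for x
        using le_funD[OF uv(2), of x] le_funD[OF uv(3), of x] by simp
      then have "u + v \<le> w" "u \<le> u + v"
        by (simp_all add: le_fun_def)
      then show "(case p of (u, v) \<Rightarrow> (u + v, u)) \<in> Sigma {s. s \<le> w} (\<lambda>s. {u. u \<le> s})" using uv by simp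
      show "(case case p of (u, v) \<Rightarrow> (u + v, u) of (s, u) \<Rightarrow> (u, s - u)) = p"
        using uv by (auto simp: fun_eq_iff)
    qed
    also have "\<dots> = (\<Sum>u\<in>{u. u \<le> w}. \<Sum>v\<in>{v. v \<le> w - u}. chi u (w - u) * x u * (chi v (w - u - v) * y v *
        z (w - u - v)))"
    proof (rule sum.Sigma[symmetric])
      have "w - u \<le> w" for u by (simp add: le_fun_def)
      then show "\<forall>u\<in>{u. u \<le> w}. finite {v. v \<le> w - u}" using f by blast
    qed (use f in auto)
    also have "\<dots> = mul x (mul y z) w"
    proof -
      have "w - u \<in> box" for u by (rule box_down[OF w]) (simp add: le_fun_def)
      then show ?thesis using w by (simp add: mul_def[of x] mul_def[of y z] sum_distrib_left)
    qed
    finally show ?thesis .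
  qed (simp add: mul_def)
qed

lemma bas_mul: "mul (bas u) x w = (if w \<in> box \<and> u \<le> w then chi u (w - u) * x (w - u) else 0)"
proof (cases "w \<in> box")
  case True
  have "(\<Sum>v\<in>{v. v \<le> w}. chi v (w - v) * bas u v * x (w - v))
    = (\<Sum>v\<in>{v. v \<le> w}. if v = u then chi u (w - u) * x (w - u) else 0)"
    by (rule sum.cong) (auto simp: bas_def)
  then show ?thesis using True finite_below[OF True] by (simp add: mul_def)
qed (simp add: mul_def)

lemma mul_bas: "mul x (bas u) w = (if w \<in> box \<and> u \<le> w then chi (w - u) u * x (w - u) else 0)"
proof (cases "w \<in> box")
  case True
  have "(\<Sum>v\<in>{v. v \<le> w}. chi v (w - v) * x v * bas u (w - v))
    = (\<Sum>v\<in>{v. v \<le> w}. if v = w - u then (if u \<le> w then chi (w - u) u * x (w - u) else 0) else 0)"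
  proof (rule sum.cong[OF refl])
    fix v assume "v \<in> {v. v \<le> w}"
    then have v: "v \<le> w" by simp
    show "chi v (w - v) * x v * bas u (w - v) = (if v = w - u then (if u \<le> w then chi (w - u) u * x (w
        - u) else 0) else 0)"
    proof (cases "w - v = u")
      case True
      then have "u \<le> w" "v = w - u" using fun_diff_le[of w v] fun_diff_diff[OF v] by simp_all
      moreover have "w - (w - u) = u" using \<open>u \<le> w\<close> by (rule fun_diff_diff)
      ultimately show ?thesis by (simp add: bas_def)
    next
      case False
      have "\<not> (v = w - u \<and> u \<le> w)" using False fun_diff_diff by blast
      then show ?thesis using False by (auto simp: bas_def)
    qed
  qed
  moreover have "w - u \<le> w" by (simp add: le_fun_def)
  ultimately show ?thesis using True finite_below[OF True] by (simp add: mul_def)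
qed (simp add: mul_def)

lemma unit_mul: "mul unit x = (\<lambda>w. if w \<in> box then x w else 0)"
  by (rule ext) (auto simp: bas_mul le_fun_def)

lemma mul_unit: "mul x unit = (\<lambda>w. if w \<in> box then x w else 0)"
  by (rule ext) (auto simp: mul_bas le_fun_def)

lemma bas_bas: "mul (bas u) (bas v) = (if u + v \<in> box then scl (chi u v) (bas (u + v)) else 0)"
proof
  fix w
  have "mul (bas u) (bas v) w = (if w \<in> box \<and> u \<le> w then chi u (w - u) * bas v (w - u) else 0)"
    by (rule bas_mul)
  also have "\<dots> = (if u + v \<in> box then scl (chi u v) (bas (u + v)) else 0) w"
  proof (cases "w = u + v")
    case True
    then have "u \<le> w" "w - u = v" using fun_diff_eq_iff[of u w v] by blast+
    then show ?thesis using True by (simp add: bas_def scl_def)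
  next
    case False
    then have "\<not> (u \<le> w \<and> w - u = v)" using fun_diff_eq_iff[of u w v] by blast
    then show ?thesis using False by (auto simp: bas_def scl_def)
  qed
  finally show "mul (bas u) (bas v) w = (if u + v \<in> box then scl (chi u v) (bas (u + v)) else 0) w" .
qed

section \<open>The Frobenius form and its Nakayama automorphism\<close>

text \<open>For \<open>u + v = top_exp\<close> the two orders of the product differ by
  \<open>chi u v / chi v u\<close>, and replacing \<open>v\<close> by \<open>top_exp\<close>
  multiplies both values by \<open>chi u u\<close>. In this form the eigenvalue is multiplicative in
  \<open>u\<close> and makes sense outside \<open>box\<close>.\<close>

definition nak :: "(nat \<Rightarrow> nat) \<Rightarrow> 'k" where
  "nak u = chi u top_exp / chi top_exp u"

lemma nak_nz: "nak u \<noteq> 0" by (simp add: nak_def chi_nz)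

lemma nak_add: "nak (u + v) = nak u * nak v"
  by (simp add: nak_def chi_add_left chi_add_right)

lemma nak_0: "nak 0 = 1" by (simp add: nak_def)

definition nu where "nu x = (\<lambda>w. nak w * x w)"
definition mu where "mu x = (\<lambda>w. x w / nak w :: 'k)"
definition lam :: "((nat \<Rightarrow> nat) \<Rightarrow> 'k) \<Rightarrow> 'k" where "lam x = x top_exp"
text \<open>Pairing with the complementary monomial \<open>bas (top_exp - w)\<close> picks out the
  coefficient at \<open>w\<close>, up to the factor \<open>chi (top_exp - w) w\<close>.\<close>

definition riesz :: "(((nat \<Rightarrow> nat) \<Rightarrow> 'k) \<Rightarrow> 'k) \<Rightarrow> (nat \<Rightarrow> nat) \<Rightarrow> 'k" where
  "riesz g = (\<lambda>w. if w \<in> box then g (bas (top_exp - w)) / chi (top_exp - w) w else 0)"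

lemma box_expand: "mul unit x = (\<Sum>u\<in>box. scl (x u) (bas u))"
proof
  fix w
  have "(\<Sum>u\<in>box. scl (x u) (bas u)) w = (\<Sum>u\<in>box. scl (x u) (bas u) w)"
    by (induction rule: infinite_finite_induct[of _ box]) (simp_all add: finite_box)
  also have "\<dots> = (\<Sum>u\<in>box. if u = w then x w else 0)"
    by (rule sum.cong) (auto simp: scl_def bas_def)
  finally show "mul unit x w = (\<Sum>u\<in>box. scl (x u) (bas u)) w"
    by (simp add: unit_mul finite_box)
qed

lemma lam_mul: "lam (mul x y) = (\<Sum>u\<in>box. chi u (top_exp - u) * x u * y (top_exp - u))"
  by (simp add: lam_def mul_def top_box box_def)

lemma chi_top: "u \<in> box \<Longrightarrow> chi u (top_exp - u) = chi (top_exp - u) u * nak u"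
proof -
  assume "u \<in> box"
  then have "u + (top_exp - u) = top_exp" by (simp add: box_def le_add_diff)
  then have "chi u top_exp = chi u u * chi u (top_exp - u)" "chi top_exp u = chi u u * chi (top_exp - u) u"
    by (metis chi_add_right, metis chi_add_left)
  then show ?thesis by (simp add: nak_def chi_nz)
qed

lemma comp_box: "u \<in> box \<Longrightarrow> top_exp - u \<in> box" "u \<in> box \<Longrightarrow> top_exp - (top_exp - u) = u"
  unfolding box_def using fun_diff_le[of top_exp u] fun_diff_diff[of u top_exp] by auto

sublocale frob_diag scl mul unit lam nu mu riesz box bas "\<lambda>i x. x i" nak
proof unfold_locales
  fix x y z :: "(nat \<Rightarrow> nat) \<Rightarrow> 'k" and c c' :: 'k
  show "scl c (x + y) = scl c x + scl c y" "scl (c + c') x = scl c x + scl c' x" "scl c (scl c' x) =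
      scl (c * c') x" "scl 1 x = x"
    by (simp_all add: scl_def fun_eq_iff algebra_simps)
  show "mul (x + y) z = mul x z + mul y z" "mul x (y + z) = mul x y + mul x z"
    by (simp_all add: mul_def fun_eq_iff algebra_simps sum.distrib)
  show "mul (scl c x) z = scl c (mul x z)" "mul x (scl c z) = scl c (mul x z)"
    by (simp_all add: mul_def scl_def fun_eq_iff sum_distrib_left mult_ac)
  show "mul (mul x y) z = mul x (mul y z)" by (rule mul_assoc)
  show "mul x unit = mul unit x" by (simp only: unit_mul mul_unit)
  show "mul unit unit = unit" unfolding unit_mul by (rule ext) (simp add: bas_def zero_box)
  show "lam (x + y) = lam x + lam y" "lam (scl c x) = c * lam x" by (simp_all add: lam_def scl_def)
  show "lam (mul unit x) = lam x" by (simp add: lam_def unit_mul top_box)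
  show "nu (x + y) = nu x + nu y" "nu (scl c x) = scl c (nu x)"
    by (simp_all add: nu_def scl_def fun_eq_iff algebra_simps)
  show "nu (mul x y) = mul (nu x) (nu y)"
  proof
    fix w
    have "nak w = nak u * nak (w - u)" if "u \<le> w" for u by (metis le_add_diff[OF that] nak_add)
    then show "nu (mul x y) w = mul (nu x) (nu y) w"
      by (auto simp: nu_def mul_def sum_distrib_left mult_ac intro!: sum.cong)
  qed
  show "nu unit = unit" unfolding nu_def by (rule ext) (simp add: bas_def nak_0)
  show "mu (nu x) = x" "nu (mu x) = x" by (simp_all add: mu_def nu_def nak_nz)
  \<comment> \<open>Complementary exponents exchange roles; by \<open>chi_top\<close> the two orders
    differ by \<open>nak u\<close>.\<close>
  show "lam (mul x y) = lam (mul y (nu x))"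
    unfolding lam_mul
    by (rule sum.reindex_bij_witness[of _ "\<lambda>u. top_exp - u" "\<lambda>u. top_exp - u"])
      (auto simp: comp_box nu_def chi_top mult_ac)
  show "x = y" if "mul unit x = x" "mul unit y = y" and eq: "\<And>a. lam (mul a x) = lam (mul a y)"
  proof
    fix w
    show "x w = y w"
    proof (cases "w \<in> box")
      case True
      \<comment> \<open>The complementary monomial tests the coefficient at
        \<open>w\<close>.\<close>
      have "lam (mul (bas (top_exp - w)) z) = chi (top_exp - w) w * z w" for z
        unfolding lam_def bas_mul comp_box(2)[OF True] using top_box fun_diff_le by simp
      then show ?thesis using eq[of "bas (top_exp - w)"] by (simp add: chi_nz)
    next
      case False
      then have "mul unit x w = 0" "mul unit y w = 0" by (simp_all add: unit_mul)
      then show ?thesis using that by simp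
    qed
  qed
  show "mul unit (riesz g) = riesz g \<and> lam (mul b (riesz g)) = g b"
    if g: "\<And>x y. g (x + y) = g x + g y" "\<And>c x. g (scl c x) = c * g x" "\<And>x. g (mul unit x) = g x" for g b
  proof
    show "mul unit (riesz g) = riesz g" by (auto simp: unit_mul riesz_def)
    have g0: "g 0 = 0" using g(2)[of 0 0] by (simp add: scl_def zero_fun_def)
    have gs: "g (\<Sum>u\<in>S. F u) = (\<Sum>u\<in>S. g (F u))" for F and S :: "(nat \<Rightarrow> nat) set"
      by (induction S rule: infinite_finite_induct) (simp_all only: sum.infinite sum.empty sum.insert
          not_False_eq_True g0 g(1))
    have "lam (mul b (riesz g)) = (\<Sum>u\<in>box. b u * g (bas u))"
      unfolding lam_mul by (rule sum.cong) (auto simp: riesz_def comp_box chi_nz)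
    also have "\<dots> = g (mul unit b)" by (simp add: box_expand gs g(2))
    finally show "lam (mul b (riesz g)) = g b" by (simp add: g(3))
  qed
  show "finite box" by (rule finite_box)
  show "mul unit x = (\<Sum>i\<in>box. scl (x i) (bas i))" by (rule box_expand)
  fix i
  show "nu (bas i) = scl (nak i) (bas i)" unfolding nu_def scl_def by (rule ext) (simp add: bas_def)
  show "nu x i = nak i * x i" "(x + y) i = x i + y i" "scl c x i = c * x i" by (simp_all add: nu_def
      scl_def)
  show "nak i \<noteq> 0" by (rule nak_nz)
qed

end

section \<open>The free algebra\<close>

text \<open>Written as a deconcatenation sum so that \<open>ssum_flatten1\<close> gives
  associativity; \<open>free_algebra_simps\<close> matches it with the indexed sum.\<close>

definition fmult :: "('a list \<Rightarrow> 'k::field) \<Rightarrow> ('a list \<Rightarrow> 'k) \<Rightarrow> 'a list \<Rightarrow> 'k" where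
  "fmult f g = (\<lambda>w. ssum (\<lambda>u v. f u * g v) w)"

definition mon :: "'a list \<Rightarrow> 'a list \<Rightarrow> 'k::field" where
  "mon w = (\<lambda>v. if v = w then 1 else 0)"

lemma scl_simps: "scl c (x + y) = scl c x + scl c y" "scl c (x - y) = scl c x - scl c y"
    "scl c (scl c' x) = scl (c * c') x" "scl 1 x = x" "scl 0 x = 0" "scl c 0 = 0"
  for c :: "'k::field"
  by (simp_all add: scl_def fun_eq_iff algebra_simps)

lemma fmult_add_left: "fmult (f + f') g = fmult f g + fmult f' g"
  and fmult_add_right: "fmult f (g + g') = fmult f g + fmult f g'"
  and fmult_diff_right: "fmult f (g - g') = fmult f g - fmult f g'"
  and fmult_diff_left: "fmult (f - f') g = fmult f g - fmult f' g"
  by (simp_all add: fmult_def fun_eq_iff algebra_simps ssum_add ssum_diff)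

lemma fmult_scl_left: "fmult (scl c f) g = scl c (fmult f g)"
  and fmult_scl_right: "fmult f (scl c g) = scl c (fmult f g)"
  and fmult_0: "fmult 0 g = 0" "fmult f 0 = 0"
  by (simp_all add: fmult_def scl_def fun_eq_iff algebra_simps additive_ssum[of "(*) c" for c])

lemma fmult_assoc:
  fixes f :: "'a list \<Rightarrow> 'k::field"
  shows "fmult (fmult f g) k = fmult f (fmult g k)"
proof -
  have "ssum F as * c = ssum (\<lambda>u w. F u w * c) as" "c * ssum F as = ssum (\<lambda>u w. c * F u w) as"
    for F :: "'a list \<Rightarrow> 'a list \<Rightarrow> 'k::field" and c as
    by (rule additive_ssum, simp add: algebra_simps)+
  then show ?thesis by (simp add: fmult_def ssum_flatten1 mult.assoc)
qed

lemma fmult_mon_mon: "fmult (mon u) (mon v) = (mon (u @ v) :: 'a list \<Rightarrow> 'k::field)"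
proof
  fix w
  have "fmult (mon u) (mon v) w = (\<Sum>l\<le>length w. if l = length u then mon (u @ v) w else (0::'k))"
    unfolding fmult_def ssum_index
  proof (rule sum.cong[OF refl])
    fix l assume "l \<in> {..length w}"
    then have "take l w = u \<and> drop l w = v \<longleftrightarrow> l = length u \<and> w = u @ v"
      by (metis append_take_drop_id append_eq_conv_conj length_take min.absorb2 atMost_iff)
    then show "mon u (take l w) * mon v (drop l w) = (if l = length u then mon (u @ v) w else (0::'k))"
      unfolding mon_def by (cases "take l w = u"; cases "drop l w = v"; simp)
  qed
  also have "\<dots> = mon (u @ v) w" by (simp add: mon_def)
  finally show "fmult (mon u) (mon v) w = (mon (u @ v) w :: 'k)" .
qed

lemma fmult_mon_Nil: "fmult (mon []) f = f" "fmult f (mon []) = f"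
proof -
  have "fmult (mon []) f w = f w" for w
    by (cases w) (simp_all add: fmult_def ssum_simps mon_def)
  moreover have "fmult f (mon []) w = f w" for w
    by (induction w arbitrary: f rule: rev_induct)
      (simp_all add: fmult_def mon_def ssum_simps ssum_mid[where w="[]"])
  ultimately show "fmult (mon []) f = f" "fmult f (mon []) = f" by auto
qed

context
  fixes N :: nat and F :: "('k::field, nat list \<Rightarrow> 'k) module" (structure)
  defines "F \<equiv> free_algebra N"
begin

lemma free_algebra_simps:
  "f \<otimes> g = fmult f g" "f \<oplus> g = f + g" "\<one> = mon []" "\<zero> = 0" "c \<odot> f = scl c f"
  by (auto simp: F_def free_algebra_def fmult_def ssum_index mon_def scl_def fun_eq_iff)

lemma carrier_iff: "f \<in> carrier F \<longleftrightarrow> finite {w. f w \<noteq> 0} \<and> (\<forall>w. f w \<noteq> 0 \<longrightarrow> set w \<subseteq> {1..N})"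
  by (simp add: F_def free_algebra_def)

lemma carrier_mon [simp]: "mon w \<in> carrier F \<longleftrightarrow> set w \<subseteq> {1..N}"
  by (auto simp: carrier_iff mon_def)

lemma carrier_0 [simp]: "0 \<in> carrier F"
  by (simp add: carrier_iff)

lemma carrier_scl [simp]: "f \<in> carrier F \<Longrightarrow> scl c f \<in> carrier F"
  unfolding carrier_iff by (auto simp: scl_def intro: rev_finite_subset)

lemma carrier_add [simp]: "f \<in> carrier F \<Longrightarrow> g \<in> carrier F \<Longrightarrow> f + g \<in> carrier F"
proof -
  assume *: "f \<in> carrier F" "g \<in> carrier F"
  have "{w. (f + g) w \<noteq> 0} \<subseteq> {w. f w \<noteq> 0} \<union> {w. g w \<noteq> 0}" by auto
  then show ?thesis using * unfolding carrier_iff by (auto intro: rev_finite_subset)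
qed

lemma carrier_neg [simp]: "f \<in> carrier F \<Longrightarrow> - f \<in> carrier F"
  unfolding carrier_iff by simp

lemma carrier_diff: "f \<in> carrier F \<Longrightarrow> g \<in> carrier F \<Longrightarrow> f - g \<in> carrier F"
  using carrier_add[of f "- g"] by simp

lemma carrier_induct [consumes 1, case_names zero add]:
  assumes f: "f \<in> carrier F" and "P 0"
    and step: "\<And>c w f. set w \<subseteq> {1..N} \<Longrightarrow> f \<in> carrier F \<Longrightarrow> P f \<Longrightarrow> P (scl c (mon w) + f)"
  shows "P f"
proof -
  have "P f" if "finite S" "{w. f w \<noteq> 0} \<subseteq> S" "f \<in> carrier F" for f S
    using that
  proof (induction S arbitrary: f rule: finite_induct)
    case empty
    then have "f = 0" by auto
    then show ?case using \<open>P 0\<close> by (simp only:)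
  next
    case (insert w S)
    let ?g = "f(w := 0)"
    have g: "?g \<in> carrier F" using insert.prems(2) unfolding carrier_iff
      by (auto elim: rev_finite_subset)
    have "P ?g"
    proof (rule insert.IH[OF _ g])
      show "{v. ?g v \<noteq> 0} \<subseteq> S" using insert.prems(1) by auto
    qed
    have e: "f = scl (f w) (mon w) + ?g" by (auto simp: scl_def mon_def)
    show ?case
    proof (cases "f w = 0")
      case True
      then have "?g = f" by auto
      with \<open>P ?g\<close> show ?thesis by simp
    next
      case False
      then have "set w \<subseteq> {1..N}" using insert.prems(2) unfolding carrier_iff by blast
      from step[OF this g \<open>P ?g\<close>] show ?thesis by (subst e)
    qed
  qed
  then show ?thesis using f unfolding carrier_iff by blast
qed

lemma carrier_fmult [simp]: "f \<in> carrier F \<Longrightarrow> g \<in> carrier F \<Longrightarrow> fmult f g \<in> carrier F"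
proof (induction f rule: carrier_induct)
  case (add c w f)
  from \<open>g \<in> carrier F\<close> have "fmult (mon w) g \<in> carrier F"
  proof (induction g rule: carrier_induct)
    case (add c' v g)
    have "mon (w @ v) \<in> carrier F" using \<open>set v \<subseteq> {1..N}\<close> \<open>set w \<subseteq> {1..N}\<close> by simp
    then show ?case using add by (simp only: fmult_add_right fmult_scl_right fmult_mon_mon carrier_add
        carrier_scl)
  qed (simp only: fmult_0 carrier_0)
  then show ?case using add by (simp only: fmult_add_left fmult_scl_left carrier_add carrier_scl)
qed (simp only: fmult_0 carrier_0)

lemma ring_free_algebra: "ring F"
proof (rule ringI)
  show "abelian_group F"
  proof (rule abelian_groupI)
    fix x assume "x \<in> carrier F"
    then show "\<exists>y\<in>carrier F. y \<oplus> x = \<zero>"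
      by (intro bexI[of _ "- x"]) (simp_all add: free_algebra_simps)
  qed (simp_all add: free_algebra_simps add_ac)
  show "Group.monoid F"
    by (rule monoidI) (simp_all add: free_algebra_simps fmult_assoc fmult_mon_Nil)
qed (simp_all add: free_algebra_simps fmult_add_left fmult_add_right)

lemma free_algebra_minus: "x \<in> carrier F \<Longrightarrow> \<ominus> x = - x"
proof -
  interpret F: ring F by (rule ring_free_algebra)
  show "x \<in> carrier F \<Longrightarrow> \<ominus> x = - x"
    by (rule F.minus_equality) (simp_all add: free_algebra_simps)
qed

lemma free_algebra_diff: "y \<in> carrier F \<Longrightarrow> x \<ominus> y = x - y"
  by (simp add: a_minus_def free_algebra_minus free_algebra_simps)

lemma free_gen_mon: "free_gen i = mon [i]"
  by (simp add: free_gen_def mon_def fun_eq_iff)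

lemma mon_power: "mon [i] [^] n = mon (replicate n i)"
proof (induction n)
  case (Suc n)
  then show ?case by (simp only: nat_pow_Suc free_algebra_simps fmult_mon_mon replicate_append_same
      replicate_Suc)
qed (simp add: nat_pow_0 free_algebra_simps)

end

section \<open>Presentation by ordered monomials\<close>

text \<open>As simplification rules these would be used in eta-contracted form and would replace sums of
  functions by abstractions.\<close>

declare plus_fun_apply [simp del] minus_apply [simp del] uminus_apply [simp del]

definition word :: "nat \<Rightarrow> (nat \<Rightarrow> nat) \<Rightarrow> nat list" where
  "word N u = concat (map (\<lambda>i. replicate (u i) i) [1..<Suc N])"

lemma set_blocks: "set (concat (map (\<lambda>i. replicate (u i) i) js)) \<subseteq> set js"
  by (induction js) auto

lemma sorted_blocks: "sorted js \<Longrightarrow> sorted (concat (map (\<lambda>i. replicate (u i) (i::nat)) js))"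
  by (induction js) (use set_blocks in \<open>fastforce simp: sorted_append\<close>)+

lemma count_replicate: "count_list (replicate n x) y = (if x = y then n else 0)"
  by (induction n) auto

lemma count_blocks:
  "distinct js \<Longrightarrow> count_list (concat (map (\<lambda>i. replicate (u i) i) js)) j = (if j \<in> set js then u j else 0)"
  by (induction js) (auto simp: count_replicate)

lemma set_word: "set (word N u) \<subseteq> {1..N}"
  using set_blocks[of u "[1..<Suc N]"] by (auto simp: word_def)

lemma prod_list_blocks:
  "prod_list (map f (concat (map (\<lambda>j. replicate (u j) j) js))) = prod_list (map (\<lambda>j. f j ^ u j ::
      'k::field) js)"
  by (induction js) (simp_all add: map_concat prod_list_replicate)

section \<open>Evaluation of words in the monomial model\<close>

context qci_data
begin

abbreviation F :: "('k, nat list \<Rightarrow> 'k) module" where "F \<equiv> free_algebra N"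
abbreviation I where "I \<equiv> Idl\<^bsub>F\<^esub> (qci_relations N q a)"

interpretation F: ring F by (rule ring_free_algebra)

definition unit_exp :: "nat \<Rightarrow> nat \<Rightarrow> nat" where "unit_exp i = (\<lambda>j. if j = i then 1 else 0)"

lemma unit_exp_box: "i \<in> {1..N} \<Longrightarrow> unit_exp i \<in> box"
  using a_pos by (auto simp: box_def le_fun_def unit_exp_def top_exp_def)

lemma chi_unit_exp: "i \<in> {1..N} \<Longrightarrow> chi (unit_exp i) v = (\<Prod>j\<in>{1..<i}. q i j ^ v j)"
proof -
  assume i: "i \<in> {1..N}"
  have "chi (unit_exp i) v = (\<Prod>k\<in>{1..N}. if k = i then \<Prod>j\<in>{1..<i}. q i j ^ v j else 1)"
    unfolding chi_def by (rule prod.cong) (auto simp: unit_exp_def)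
  then show ?thesis using i by simp
qed

lemma chi_unit_exp_unit_exp: "i \<in> {1..N} \<Longrightarrow> chi (unit_exp i) (unit_exp j) = (if j \<in> {1..<i} then q i j
    else 1)"
proof -
  assume i: "i \<in> {1..N}"
  have "chi (unit_exp i) (unit_exp j) = (\<Prod>k\<in>{1..<i}. if k = j then q i j else 1)"
    unfolding chi_unit_exp[OF i] by (intro prod.cong) (auto simp: unit_exp_def)
  then show ?thesis by simp
qed

text \<open>The defining relation inside the model. If \<open>i\<close> is the larger index,
  \<open>q i j\<close> is the value on the left; if \<open>j\<close> is, the value on the right is
  \<open>q j i\<close> and \<open>q_inv\<close> applies.\<close>

lemma chi_unit_exp_commute: "i \<in> {1..N} \<Longrightarrow> j \<in> {1..N} \<Longrightarrow> chi (unit_exp i) (unit_exp j) = q i j * chi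
    (unit_exp j) (unit_exp i)"
  using q_inv q_diag by (cases i j rule: linorder_cases) (auto simp: chi_unit_exp_unit_exp)

definition rho :: "nat list \<Rightarrow> (nat \<Rightarrow> nat) \<Rightarrow> 'k" where
  "rho w = foldr (\<lambda>i. mul (bas (unit_exp i))) w unit"

lemma unit_mul_box: "u \<in> box \<Longrightarrow> mul unit (bas u) = bas u"
  unfolding unit_mul by (rule ext) (simp add: bas_def)

lemma rho_Nil: "rho [] = unit" and rho_Cons: "rho (i # w) = mul (bas (unit_exp i)) (rho w)"
  by (simp_all add: rho_def)

lemma unit_rho: "mul unit (rho w) = rho w"
proof (induction w)
  case (Cons i w)
  have "mul unit (rho (i # w)) = mul (mul unit (bas (unit_exp i))) (rho w)" by (simp only: rho_Cons
      mul_assoc)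
  also have "\<dots> = mul (bas (unit_exp i)) (mul unit (rho w))" by (simp only: e_central[symmetric] mul_assoc)
  finally show ?case by (simp only: Cons.IH rho_Cons)
qed (simp only: rho_Nil e_idem)

lemma rho_append: "rho (u @ v) = mul (rho u) (rho v)"
  by (induction u) (simp_all only: append_Nil append_Cons rho_Nil rho_Cons unit_rho mul_assoc)

text \<open>Prepending a smallest letter creates no inversion, so \<open>chi\<close> contributes
  1.\<close>

lemma rho_sorted:
  assumes "sorted w" "set w \<subseteq> {1..N}" "count_list w \<in> box"
  shows "rho w = bas (count_list w)"
  using assms
proof (induction w)
  case Nil
  have "count_list ([] :: nat list) = 0" by (rule ext) simp
  then show ?case by (simp only: rho_Nil)
next
  case (Cons i w)
  have c: "count_list (i # w) = unit_exp i + count_list w" by (rule ext) (simp add: unit_exp_def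
      plus_fun_apply)
  have "count_list w \<in> box" by (rule box_down[OF Cons.prems(3)]) (simp add: le_fun_def)
  then have IH: "rho w = bas (count_list w)" using Cons by simp
  have "j < i \<Longrightarrow> count_list w j = 0" for j
    using Cons.prems(1) by (force simp: count_list_0_iff)
  then have "chi (unit_exp i) (count_list w) = 1"
    using Cons.prems(2) by (subst chi_unit_exp) (auto intro!: prod.neutral)
  note chi = this
  have box: "unit_exp i + count_list w \<in> box" using Cons.prems(3) unfolding c .
  show ?case unfolding rho_Cons IH bas_bas c chi if_P[OF box] by (rule scl_simps)
qed

lemma count_word: "u \<in> box \<Longrightarrow> count_list (word N u) = u"
proof
  fix i assume "u \<in> box"
  then have "u i \<le> top_exp i" by (simp add: box_def le_fun_def)
  then show "count_list (word N u) i = u i"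
    unfolding word_def by (subst count_blocks) (auto simp: top_exp_def split: if_splits)
qed

lemma rho_word: "u \<in> box \<Longrightarrow> rho (word N u) = bas u"
proof -
  assume "u \<in> box"
  moreover have "sorted (word N u)" unfolding word_def by (rule sorted_blocks) (rule sorted_upt)
  ultimately show "rho (word N u) = bas u" using rho_sorted[OF _ set_word, of u] by (simp only: count_word)
qed

text \<open>The linear extension of \<open>rho\<close>, an algebra map by
  \<open>ev_fmult\<close>.\<close>

definition ev :: "(nat list \<Rightarrow> 'k) \<Rightarrow> (nat \<Rightarrow> nat) \<Rightarrow> 'k" where
  "ev f = (\<Sum>w\<in>{w. f w \<noteq> 0}. scl (f w) (rho w))"

lemma ev_support:
  assumes "finite S" "{w. f w \<noteq> 0} \<subseteq> S"
  shows "ev f = (\<Sum>w\<in>S. scl (f w) (rho w))"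
  unfolding ev_def
  by (rule sum.mono_neutral_left[OF assms]) (auto simp: scl_simps)

lemma ev_add: "f \<in> carrier F \<Longrightarrow> g \<in> carrier F \<Longrightarrow> ev (f + g) = ev f + ev g"
proof -
  assume "f \<in> carrier F" "g \<in> carrier F"
  then have fin: "finite ({w. f w \<noteq> 0} \<union> {w. g w \<noteq> 0})" by (simp add: carrier_iff)
  have "{w. (f + g) w \<noteq> 0} \<subseteq> {w. f w \<noteq> 0} \<union> {w. g w \<noteq> 0}" by (auto simp: plus_fun_apply)
  moreover have "scl ((f + g) w) (rho w) = scl (f w) (rho w) + scl (g w) (rho w)" for w
    by (rule ext) (simp add: scl_def plus_fun_apply algebra_simps)
  ultimately show ?thesis
    by (simp only: ev_support[OF fin] Un_upper1 Un_upper2 sum.distrib)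
qed

lemma ev_scl: "f \<in> carrier F \<Longrightarrow> ev (scl c f) = scl c (ev f)"
proof -
  assume "f \<in> carrier F"
  then have fin: "finite {w. f w \<noteq> 0}" by (simp add: carrier_iff)
  have "ev (scl c f) = (\<Sum>w\<in>{w. f w \<noteq> 0}. scl c (scl (f w) (rho w)))"
    by (subst ev_support[OF fin]) (auto simp: scl_def mult.assoc)
  then show ?thesis unfolding ev_def by (simp only: scale_sum_right)
qed

lemma ev_mon: "ev (mon w) = rho w"
  by (subst ev_support[of "{w}"]) (auto simp: mon_def scl_simps)

lemma ev_0: "ev 0 = 0"
  by (simp add: ev_def)

lemma ev_neg: "f \<in> carrier F \<Longrightarrow> ev (- f) = - ev f"
  using ev_scl[of f "- 1"] by (simp add: scl_def fun_Compl_def)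

lemma ev_diff: "f \<in> carrier F \<Longrightarrow> g \<in> carrier F \<Longrightarrow> ev (f - g) = ev f - ev g"
  by (simp only: diff_conv_add_uminus ev_add ev_neg carrier_neg)

lemma ev_fmult: "f \<in> carrier F \<Longrightarrow> g \<in> carrier F \<Longrightarrow> ev (fmult f g) = mul (ev f) (ev g)"
proof (induction f rule: carrier_induct)
  case zero
  show ?case by (simp only: fmult_0 ev_0 mul_0_left)
next
  case (add c w f)
  from \<open>g \<in> carrier F\<close> have "ev (fmult (mon w) g) = mul (rho w) (ev g)"
  proof (induction g rule: carrier_induct)
    case zero
    show ?case by (simp only: fmult_0 ev_0 mul_0_right)
  next
    case (add c' v g)
    then have "mon w \<in> carrier F" "mon v \<in> carrier F" "mon (w @ v) \<in> carrier F" using \<open>set w \<subseteq> {1..N}\<close>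
        by simp_all
    then show ?case using add
      by (simp only: fmult_add_right fmult_scl_right fmult_mon_mon ev_add ev_scl ev_mon rho_append
          carrier_scl carrier_fmult
            mul_add_right mul_scale_right)
  qed
  moreover have "mon w \<in> carrier F" using add.hyps by simp
  ultimately show ?case using add
    by (simp only: fmult_add_left fmult_scl_left ev_add ev_scl ev_mon carrier_scl carrier_fmult
        mul_add_left mul_scale_left)
qed

lemma relations_closed: "qci_relations N q a \<subseteq> carrier F"
  unfolding qci_relations_def Let_def
  by (auto simp: mon_power free_gen_mon free_algebra_simps fmult_mon_mon free_algebra_diff
      intro!: carrier_diff)

lemma ideal_I: "ideal I F"
  by (rule F.genideal_ideal[OF relations_closed])

interpretation I: ideal I F by (rule ideal_I)

text \<open>The kernel of \<open>ev\<close> is an ideal and contains the generators: the powers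
  leave \<open>box\<close>, and the commutation relations hold by
  \<open>chi_unit_exp_commute\<close>.\<close>

lemma ev_I: "f \<in> I \<Longrightarrow> ev f = 0"
proof -
  let ?K = "{f \<in> carrier F. ev f = 0}"
  have "ideal ?K F"
  proof (rule idealI[OF ring_free_algebra])
    show "subgroup ?K (add_monoid F)"
    proof (rule F.add.subgroupI)
      show "?K \<noteq> {}" using ev_0 carrier_0 by blast
      show "\<ominus>\<^bsub>F\<^esub> f \<in> ?K" if "f \<in> ?K" for f
      proof -
        from that have f: "f \<in> carrier F" "ev f = 0" by simp_all
        show ?thesis unfolding free_algebra_minus[OF f(1)] using f(2) carrier_neg[OF f(1)] ev_neg[OF
            f(1)] by simp
      qed
    qed (auto simp: free_algebra_simps ev_add)
  qed (auto simp: free_algebra_simps ev_fmult)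
  moreover have "qci_relations N q a \<subseteq> ?K"
  proof
    fix r assume r: "r \<in> qci_relations N q a"
    then consider i where "i \<in> {1..N}" "r = mon (replicate (a i + 1) i)"
      | i j where "i \<in> {1..N}" "j \<in> {1..N}" "r = mon [i, j] - scl (q i j) (mon [j, i])"
      unfolding qci_relations_def Let_def mon_power free_gen_mon
      by (auto simp: free_algebra_simps fmult_mon_mon free_algebra_diff simp del: replicate_Suc)
    then have "ev r = 0"
    proof cases
      case (1 i)
      let ?u = "count_list (replicate (a i) i)"
      have "?u \<in> box" using 1(1) by (auto simp: box_def le_fun_def count_replicate top_exp_def)
      then have u: "rho (replicate (a i) i) = bas ?u"
        using 1(1) by (intro rho_sorted) auto
      have "\<not> (unit_exp i + ?u) i \<le> top_exp i" using 1(1) by (simp add: top_exp_def unit_exp_def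
          count_replicate plus_fun_apply)
      then have "unit_exp i + ?u \<notin> box" unfolding box_def le_fun_def by blast
      moreover have "replicate (a i + 1) i = i # replicate (a i) i" by simp
      then have "ev r = mul (bas (unit_exp i)) (bas ?u)" by (simp only: 1(2) ev_mon rho_Cons u)
      ultimately show ?thesis by (simp only: bas_bas if_False)
    next
      case (2 i j)
      have *: "rho [i, j] = mul (bas (unit_exp i)) (bas (unit_exp j))" if "i \<in> {1..N}" "j \<in> {1..N}" for i j
        using unit_mul_box[OF unit_exp_box[OF that(2)]] by (simp only: rho_Cons rho_Nil e_central)
      have "mon [i, j] \<in> carrier F" "mon [j, i] \<in> carrier F" using 2(1,2) by simp_all
      then have "ev r = rho [i, j] - scl (q i j) (rho [j, i])"
        unfolding 2(3) by (simp only: ev_diff ev_scl carrier_scl ev_mon)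
      also have "\<dots> = 0"
        unfolding *[OF 2(1,2)] *[OF 2(2,1)] bas_bas add.commute[of "unit_exp j"]
            chi_unit_exp_commute[OF 2(1,2)]
        by (simp add: scl_simps)
      finally show ?thesis .
    qed
    then show "r \<in> ?K" using r relations_closed by auto
  qed
  ultimately have "I \<subseteq> ?K" by (rule F.genideal_minimal)
  then show "f \<in> I \<Longrightarrow> ev f = 0" by auto
qed

section \<open>Reduction of words modulo the relations\<close>

text \<open>A ring ideal absorbs the scalar \<open>c\<close> because it acts as multiplication by
  \<open>scl c (mon [])\<close>.\<close>

lemma scl_I: "f \<in> I \<Longrightarrow> scl c f \<in> I"
  using I.I_l_closed[of f "scl c (mon [])"] I.Icarr[of f]
  by (simp add: free_algebra_simps fmult_scl_left fmult_mon_Nil)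

lemma add_I: "f \<in> I \<Longrightarrow> g \<in> I \<Longrightarrow> f + g \<in> I"
  using I.a_closed by (simp add: free_algebra_simps)

lemma fmult_I: "f \<in> I \<Longrightarrow> g \<in> carrier F \<Longrightarrow> fmult f g \<in> I" "f \<in> I \<Longrightarrow> g \<in> carrier F \<Longrightarrow> fmult g f \<in> I"
  using I.I_l_closed I.I_r_closed by (simp_all add: free_algebra_simps)

lemma zero_I: "0 \<in> I"
  using I.zero_closed[unfolded free_algebra_simps(4)] .

lemma fmult_mon_diff: "fmult (mon u) (mon v - scl c (mon v')) = mon (u @ v) - scl c (mon (u @ v'))"
    "fmult (mon v - scl c (mon v')) (mon u) = mon (v @ u) - scl c (mon (v' @ u))"
  by (simp_all only: fmult_diff_left fmult_diff_right fmult_scl_left fmult_scl_right fmult_mon_mon)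

lemma trans_I:
  assumes "f - scl c g \<in> I" "g - scl c' k \<in> I"
  shows "f - scl (c * c') k \<in> I"
proof -
  have "f - scl (c * c') k = (f - scl c g) + scl c (g - scl c' k)"
    by (simp add: scl_simps)
  then show ?thesis using assms by (simp only: add_I scl_I)
qed

lemma relation_in:
  assumes "i \<in> {1..N}" "j \<in> {1..N}"
  shows "mon [i, j] - scl (q i j) (mon [j, i]) \<in> qci_relations N q a"
proof -
  have "scl (q i j) (mon [j, i]) \<in> carrier F" using assms by simp
  then have "mon [i, j] - scl (q i j) (mon [j, i])
      = free_gen i \<otimes>\<^bsub>F\<^esub> free_gen j \<ominus>\<^bsub>F\<^esub> q i j \<odot>\<^bsub>F\<^esub> (free_gen j \<otimes>\<^bsub>F\<^esub> free_gen i)"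
    by (simp only: free_gen_mon free_algebra_simps fmult_mon_mon append_Cons append_Nil free_algebra_diff)
  then show ?thesis unfolding qci_relations_def Let_def using assms by blast
qed

lemma commute_I:
  assumes "i \<in> {1..N}" "set p \<subseteq> {1..N}" "set s \<subseteq> {1..N}"
  shows "mon (i # p @ s) - scl (prod_list (map (q i) p)) (mon (p @ i # s)) \<in> I"
  using assms(2)
proof (induction p)
  case Nil
  have "mon (i # [] @ s) - scl (prod_list (map (q i) [])) (mon ([] @ i # s)) = 0"
    by (rule ext) (simp add: scl_def minus_apply)
  note eq = this
  show ?case unfolding eq by (rule zero_I)
next
  case (Cons j p)
  have "j \<in> {1..N}" using Cons.prems by simp
  with relation_in[OF assms(1)] have r: "mon [i, j] - scl (q i j) (mon [j, i]) \<in> I"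
    using F.genideal_self[OF relations_closed] by blast
  have "mon (p @ s) \<in> carrier F" "mon [j] \<in> carrier F" using Cons.prems assms by simp_all
  note c = this
  have IH: "mon (i # p @ s) - scl (prod_list (map (q i) p)) (mon (p @ i # s)) \<in> I"
    using Cons by simp
  have 1: "mon (i # j # p @ s) - scl (q i j) (mon (j # i # p @ s)) \<in> I"
    using fmult_I(1)[OF r c(1)] unfolding fmult_mon_diff append_Cons append_Nil .
  have 2: "mon (j # i # p @ s) - scl (prod_list (map (q i) p)) (mon (j # p @ i # s)) \<in> I"
    using fmult_I(2)[OF IH c(2)] unfolding fmult_mon_diff append_Cons append_Nil .
  show ?case using trans_I[OF 1 2] by simp
qed

lemma power_I:
  assumes "i \<in> {1..N}" "set p \<subseteq> {1..N}" "set s \<subseteq> {1..N}"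
  shows "mon (p @ replicate (a i + 1) i @ s) \<in> I"
proof -
  have "mon (replicate (a i + 1) i) \<in> qci_relations N q a"
  proof -
    have "mon (replicate (a i + 1) i) = free_gen i [^]\<^bsub>F\<^esub> (a i + 1)" by (simp only: free_gen_mon mon_power)
    then show ?thesis unfolding qci_relations_def Let_def using assms(1) by blast
  qed
  then have "mon (replicate (a i + 1) i) \<in> I"
    using F.genideal_self[OF relations_closed] by blast
  moreover have "mon p \<in> carrier F" "mon s \<in> carrier F" using assms by simp_all
  ultimately have "fmult (fmult (mon p) (mon (replicate (a i + 1) i))) (mon s) \<in> I" by (intro fmult_I)
  then show ?thesis by (simp only: fmult_mon_mon append_assoc)
qed

text \<open>Moving the new letter to its block costs exactly \<open>chi (unit_exp i) u\<close>, the
  factor that the model produces. If the block becomes too long, the word lies in the ideal and the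
  model gives zero.\<close>

lemma Cons_word:
  assumes i: "i \<in> {1..N}" and u: "u \<in> box"
  obtains c v where "v \<in> box" "mul (bas (unit_exp i)) (bas u) = scl c (bas v)"
    "mon (i # word N u) - scl c (mon (word N v)) \<in> I"
proof -
  define p where "p = concat (map (\<lambda>j. replicate (u j) j) [1..<i])"
  define s where "s = concat (map (\<lambda>j. replicate (u j) j) [Suc i..<Suc N])"
  let ?v = "unit_exp i + u"
  have split: "[1..<Suc N] = [1..<i] @ i # [Suc i..<Suc N]"
    using i upt_add_eq_append[of 1 i "Suc N - i"] upt_conv_Cons[of i "Suc N"] by (simp del: upt_Suc)
  have w: "word N u = p @ replicate (u i) i @ s"
    unfolding word_def split p_def s_def by simp
  have m: "map (\<lambda>j. replicate (?v j) j) [1..<i] = map (\<lambda>j. replicate (u j) j) [1..<i]"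
    "map (\<lambda>j. replicate (?v j) j) [Suc i..<Suc N] = map (\<lambda>j. replicate (u j) j) [Suc i..<Suc N]"
    by (auto simp: unit_exp_def plus_fun_apply)
  have "?v i = Suc (u i)" by (simp add: unit_exp_def plus_fun_apply)
  then have w': "word N ?v = p @ replicate (Suc (u i)) i @ s"
    unfolding word_def split p_def s_def map_append concat_append list.map concat.simps m by (simp only:)
  have sets: "set p \<subseteq> {1..N}" "set s \<subseteq> {1..N}"
    using set_word[of N u] unfolding w by auto
  have c: "prod_list (map (q i) p) = chi (unit_exp i) u"
    unfolding p_def prod_list_blocks chi_unit_exp[OF i] by (simp add:
        prod.distinct_set_conv_list[symmetric])
  have *: "mon (i # word N u) - scl (chi (unit_exp i) u) (mon (word N ?v)) \<in> I"
    using commute_I[OF i sets(1), of "replicate (u i) i @ s"] i sets(2)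
    unfolding w w' c by (simp add: set_replicate_conv_if split: if_splits)
  show thesis
  proof (cases "?v \<in> box")
    case True
    show thesis by (rule that[OF True _ *]) (simp only: bas_bas True if_True)
  next
    case False
    have "u i = a i"
    proof (rule ccontr)
      assume "u i \<noteq> a i"
      moreover have le: "u j \<le> top_exp j" for j using u by (simp add: box_def le_fun_def)
      ultimately have "u i < a i" using i le[of i] by (simp add: top_exp_def)
      then have "?v j \<le> top_exp j" for j
        using i le[of j] by (auto simp: unit_exp_def top_exp_def plus_fun_apply split: if_splits)
      then show False using False by (simp add: box_def le_fun_def)
    qed
    then have "mon (word N ?v) \<in> I" using power_I[OF i sets] unfolding w' by simp
    then have "mon (i # word N u) - scl (chi (unit_exp i) u) (mon (word N ?v)) + scl (chi (unit_exp i)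
        u) (mon (word N ?v)) \<in> I"
      using * by (intro add_I scl_I)
    \<comment> \<open>With coefficient 0 any exponent in \<open>box\<close> can serve as
      \<open>v\<close>; \<open>u\<close> is at hand.\<close>
    then have "mon (i # word N u) - scl 0 (mon (word N u)) \<in> I" by (simp add: scl_simps)
    then show thesis by (rule that[OF u, rotated]) (simp only: bas_bas False if_False scl_simps)
  qed
qed

text \<open>Modulo the relations, a word is a multiple of an ordered one, and \<open>rho\<close> sees the same multiple;
  hence the kernel of \<open>ev\<close> is the ideal of relations.\<close>

lemma word_normal_form:
  assumes "set w \<subseteq> {1..N}"
  obtains c v where "v \<in> box" "rho w = scl c (bas v)" "mon w - scl c (mon (word N v)) \<in> I"
  using assms
proof (induction w arbitrary: thesis)
  case Nil
  have "word N 0 = []" by (simp add: word_def concat_eq_Nil_conv)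
  then show ?case using zero_I by (intro Nil(1)[of 0 1]) (simp_all only: zero_box rho_Nil scl_simps
      diff_self)
next
  case (Cons i w)
  from Cons.prems(2) have i: "i \<in> {1..N}" and "set w \<subseteq> {1..N}" by simp_all
  then obtain c v where v: "v \<in> box" "rho w = scl c (bas v)" "mon w - scl c (mon (word N v)) \<in> I"
    using Cons.IH by blast
  obtain c' v' where v': "v' \<in> box" "mul (bas (unit_exp i)) (bas v) = scl c' (bas v')"
    "mon (i # word N v) - scl c' (mon (word N v')) \<in> I"
    using Cons_word[OF i v(1)] by blast
  have "mon [i] \<in> carrier F" using i by simp
  from fmult_I(2)[OF v(3) this] have "mon (i # w) - scl c (mon (i # word N v)) \<in> I"
    unfolding fmult_mon_diff by simp
  from trans_I[OF this v'(3)] have "mon (i # w) - scl (c * c') (mon (word N v')) \<in> I" .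
  then show ?case
    by (rule Cons.prems(1)[OF v'(1), rotated]) (simp only: rho_Cons v(2) v'(2) mul_scale_right scl_simps)
qed

text \<open>A linear section of \<open>ev\<close>, up to the projection onto
  \<open>box\<close>.\<close>

definition nf :: "((nat \<Rightarrow> nat) \<Rightarrow> 'k) \<Rightarrow> nat list \<Rightarrow> 'k" where
  "nf x = (\<Sum>u\<in>box. scl (x u) (mon (word N u)))"

lemma scale_add_mon: "scl (c + c') (mon w) = scl c (mon w) + scl c' (mon w)" for c c' :: 'k
  by (rule ext) (simp add: scl_def plus_fun_apply algebra_simps)

lemma nf_add: "nf (x + y) = nf x + nf y"
  by (simp only: nf_def plus_fun_apply scale_add_mon sum.distrib)

lemma nf_scl: "nf (scl c x) = scl c (nf x)"
proof -
  have "(\<Sum>u\<in>S. scl (scl c x u) (mon (word N u))) = scl c (\<Sum>u\<in>S. scl (x u) (mon (word N u)))" for S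
    by (induction S rule: infinite_finite_induct)
      (simp_all only: sum.infinite sum.empty sum.insert not_False_eq_True scl_simps, simp add: scl_def
          mult.assoc)
  then show ?thesis unfolding nf_def .
qed

lemma nf_bas: "u \<in> box \<Longrightarrow> nf (bas u) = mon (word N u)"
proof -
  assume u: "u \<in> box"
  have "nf (bas u) = (\<Sum>v\<in>box. if v = u then mon (word N u) else 0)"
    unfolding nf_def by (rule sum.cong) (auto simp: bas_def scl_simps simp del: zero_fun_apply)
  also have "\<dots> = mon (word N u)" using u finite_box by (subst sum.delta) simp_all
  finally show ?thesis .
qed

lemma nf_closed: "nf x \<in> carrier F"
proof -
  have "(\<Sum>u\<in>S. scl (x u) (mon (word N u))) \<in> carrier F" for S
  proof (induction S rule: infinite_finite_induct)
    case (insert u S)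
    then show ?case using set_word[of N u] by (simp only: sum.insert not_False_eq_True carrier_add
        carrier_scl carrier_mon)
  qed (simp_all only: sum.infinite sum.empty carrier_0 not_False_eq_True)
  then show ?thesis unfolding nf_def .
qed

lemma ev_nf: "ev (nf x) = mul unit x"
proof -
  have "S \<subseteq> box \<Longrightarrow> (\<Sum>u\<in>S. scl (x u) (mon (word N u))) \<in> carrier F \<and>
      ev (\<Sum>u\<in>S. scl (x u) (mon (word N u))) = (\<Sum>u\<in>S. scl (x u) (bas u))" if "finite S" for S
    using that
  proof (induction S rule: finite_induct)
    case (insert u S)
    then have "mon (word N u) \<in> carrier F" "rho (word N u) = bas u" "S \<subseteq> box"
      using set_word[of N u] rho_word[of u] by simp_all
    then show ?case using insert.IH insert.hyps
      by (simp only: sum.insert ev_add ev_scl ev_mon carrier_add carrier_scl simp_thms)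
  qed (simp only: sum.empty carrier_0 ev_0 simp_thms)
  from this[OF finite_box order.refl] show ?thesis unfolding nf_def box_expand by blast
qed

text \<open>Together with \<open>ev_I\<close> and \<open>ev_nf\<close> this says that the ordered
  monomials with exponents in \<open>box\<close> form a basis of the quotient.\<close>

lemma nf_ev: "f \<in> carrier F \<Longrightarrow> f - nf (ev f) \<in> I"
proof (induction f rule: carrier_induct)
  case zero
  have "nf 0 = 0" using nf_scl[of 0 0] by (simp only: scl_simps)
  then show ?case using zero_I by (simp only: ev_0 diff_self)
next
  case (add c w f)
  obtain c' v where v: "v \<in> box" "rho w = scl c' (bas v)" "mon w - scl c' (mon (word N v)) \<in> I"
    using word_normal_form[OF add.hyps(1)] by blast
  have "mon w - nf (rho w) \<in> I" using v(3) unfolding v(2) nf_scl nf_bas[OF v(1)] .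
  then have "scl c (mon w - nf (rho w)) + (f - nf (ev f)) \<in> I" using add.IH by (intro add_I scl_I)
  moreover have "mon w \<in> carrier F" using add.hyps by simp
  moreover have "scl c (mon w - nf (rho w)) + (f - nf (ev f)) = scl c (mon w) + f - (scl c (nf (rho
      w)) + nf (ev f))"
    by (simp add: scl_simps algebra_simps)
  ultimately show ?case using add.hyps(2)
    by (simp only: ev_add ev_scl ev_mon carrier_scl nf_add nf_scl)
qed

section \<open>The quotient algebra and the monomial model\<close>

abbreviation A where "A \<equiv> quantum_complete_intersection N q a"
abbreviation residue where "residue f \<equiv> I +>\<^bsub>F\<^esub> f"

lemma A_simps: "carrier A = carrier (F Quot I)" "mult A = mult (F Quot I)" "one A = one (F Quot I)"
    "zero A = zero (F Quot I)" "add A = add (F Quot I)"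
    "smult A c X = (\<Union>x\<in>X. residue (scl c x))"
  by (simp_all add: quantum_complete_intersection_def quot_algebra_def free_algebra_simps)

text \<open>\<open>A\<close> shares its ring operations with \<open>F Quot I\<close> but is a
  different record, so the laws are carried over one by one.\<close>

lemma ring_A: "ring A"
proof -
  interpret Q: ring "F Quot I" by (rule I.quotient_is_ring)
  show ?thesis
  proof (rule ringI)
    show "abelian_group A"
    proof (rule abelian_groupI)
      fix x assume "x \<in> carrier A"
      then show "\<exists>y\<in>carrier A. y \<oplus>\<^bsub>A\<^esub> x = \<zero>\<^bsub>A\<^esub>"
        by (intro bexI[of _ "\<ominus>\<^bsub>F Quot I\<^esub> x"]) (simp_all add: A_simps Q.l_neg)
    qed (simp_all add: A_simps Q.a_ac)
    show "Group.monoid A"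
      by (rule monoidI) (simp_all add: A_simps Q.m_assoc)
  qed (simp_all add: A_simps Q.l_distr Q.r_distr)
qed

lemma carrier_A: "carrier A = residue ` carrier F"
  by (auto simp: A_simps FactRing_simps)

lemma residue_eq_iff: "f \<in> carrier F \<Longrightarrow> g \<in> carrier F \<Longrightarrow> residue f = residue g \<longleftrightarrow> f - g \<in> I"
  using F.quotient_eq_iff_same_a_r_cos[OF ideal_I, of f g] by (simp only: free_algebra_diff)

lemma residue_add: "f \<in> carrier F \<Longrightarrow> g \<in> carrier F \<Longrightarrow> residue f \<oplus>\<^bsub>A\<^esub> residue g = residue (f + g)"
  using I.a_rcos_sum[of f g] by (simp only: A_simps FactRing_def ring_record_simps free_algebra_simps)

lemma residue_mult: "f \<in> carrier F \<Longrightarrow> g \<in> carrier F \<Longrightarrow> residue f \<otimes>\<^bsub>A\<^esub> residue g = residue (fmult f g)"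
  using I.rcoset_mult_add[of f g] by (simp only: A_simps FactRing_def monoid.simps free_algebra_simps)

lemma residue_one: "\<one>\<^bsub>A\<^esub> = residue (mon [])"
  by (simp only: A_simps FactRing_def monoid.simps free_algebra_simps)

text \<open>The union in \<open>quot_algebra\<close> runs over one coset, whose members all give the
  same residue because scalars preserve the ideal.\<close>

lemma residue_smult: "f \<in> carrier F \<Longrightarrow> c \<odot>\<^bsub>A\<^esub> residue f = residue (scl c f)"
proof -
  assume f: "f \<in> carrier F"
  have "residue (scl c g) = residue (scl c f)" if g: "g \<in> residue f" for g
  proof -
    obtain i where "i \<in> I" "g = i + f" using g by (auto simp: a_r_coset_def' free_algebra_simps)
    then have "g \<in> carrier F" "scl c g - scl c f = scl c i"
      using f I.Icarr by (simp_all only: carrier_add scl_simps add_diff_cancel)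
    then show ?thesis using f scl_I[OF \<open>i \<in> I\<close>, of c] by (simp only: residue_eq_iff carrier_scl)
  qed
  moreover have "f \<in> residue f" using f by (rule I.a_rcos_self)
  ultimately show ?thesis unfolding A_simps by blast
qed

text \<open>Independent of the choice by \<open>ev_I\<close>, see
  \<open>phi_residue\<close>.\<close>

definition phi where "phi X = ev (SOME f. f \<in> carrier F \<and> X = residue f)"

lemma phi_residue: "f \<in> carrier F \<Longrightarrow> phi (residue f) = ev f"
proof -
  assume f: "f \<in> carrier F"
  define g where "g = (SOME g. g \<in> carrier F \<and> residue f = residue g)"
  have "\<exists>g. g \<in> carrier F \<and> residue f = residue g" by (rule exI[of _ f], rule conjI, rule f, rule refl)
  then have g: "g \<in> carrier F \<and> residue f = residue g" unfolding g_def by (rule someI_ex)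
  then have "f - g \<in> I" using residue_eq_iff[OF f, of g] by simp
  then have "ev (f - g) = 0" by (rule ev_I)
  then have "ev f = ev g" using f g by (simp only: ev_diff eq_iff_diff_eq_0[symmetric])
  then show ?thesis unfolding phi_def g_def by simp
qed

text \<open>\<open>ev_nf\<close> and \<open>nf_ev\<close> make \<open>phi\<close> and
  \<open>residue\<close> of \<open>nf\<close> inverse to each other up to the projection onto
  \<open>box\<close>, so the abstract result applies to \<open>A\<close>.\<close>

sublocale frob_transfer scl mul unit lam nu mu riesz box bas "\<lambda>i x. x i" nak A phi "\<lambda>v. residue (nf v)"
proof -
  interpret A: ring A by (rule ring_A)
  show "frob_transfer scl mul unit lam nu mu riesz box bas (\<lambda>i x. x i) nak A phi (\<lambda>v. residue (nf v))"
  proof unfold_locales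
    fix x y c v
    show "residue (nf v) \<in> carrier A" unfolding carrier_A using nf_closed by blast
    show "phi (residue (nf v)) = mul unit v" by (simp only: phi_residue nf_closed ev_nf)
    show "phi \<one>\<^bsub>A\<^esub> = unit" by (simp add: residue_one phi_residue ev_mon rho_Nil)
    assume "x \<in> carrier A"
    then obtain f where f: "f \<in> carrier F" "x = residue f" unfolding carrier_A by blast
    show "c \<odot>\<^bsub>A\<^esub> x \<in> carrier A" unfolding carrier_A using f residue_smult[OF f(1), of c]
        carrier_scl[OF f(1)] by blast
    show "residue (nf (phi x)) = x"
      unfolding f(2) phi_residue[OF f(1)] using nf_ev[OF f(1)] residue_eq_iff[OF f(1) nf_closed] by blast
    show "phi (c \<odot>\<^bsub>A\<^esub> x) = scl c (phi x)"
      unfolding f(2) using f(1) by (simp only: residue_smult phi_residue carrier_scl ev_scl)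
    assume "y \<in> carrier A"
    then obtain g where g: "g \<in> carrier F" "y = residue g" unfolding carrier_A by blast
    show "phi (x \<oplus>\<^bsub>A\<^esub> y) = phi x + phi y"
      unfolding f(2) g(2) using f(1) g(1) by (simp only: residue_add phi_residue carrier_add ev_add)
    show "phi (x \<otimes>\<^bsub>A\<^esub> y) = mul (phi x) (phi y)"
      unfolding f(2) g(2) using f(1) g(1) by (simp only: residue_mult phi_residue carrier_fmult ev_fmult)
  qed
qed

end

theorem corollary5p8:
  fixes N :: nat and a :: "nat \<Rightarrow> nat" and q :: "nat \<Rightarrow> nat \<Rightarrow> 'k::field"
  assumes "N \<ge> 2"
    and "\<forall>j\<in>{1..N}. a j \<ge> 1"
    and "\<forall>i\<in>{1..N}. \<forall>j\<in>{1..N}. q i j \<noteq> 0"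
    and "\<forall>i\<in>{1..N}. q i i = 1"
    and "\<forall>i\<in>{1..N}. \<forall>j\<in>{1..N}. q i j * q j i = 1"
  shows "batalin_vilkovisky_algebra
           (HH (quantum_complete_intersection N q a))
           (HH_cup (quantum_complete_intersection N q a))
           (HH_one (quantum_complete_intersection N q a))
           (HH_bracket (quantum_complete_intersection N q a))"
proof -
  interpret qci_data N q a
    by unfold_locales (use assms in blast)+
  show ?thesis by (rule HH_batalin_vilkovisky)
qed

end
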